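(* Let $\Theta_1,\Theta_2$ be two superchannels and $\varepsilon\in(0,1)$. Then the asymptotic Stein exponent over fully parallel strategies satisfies $$\liminf_{n\to\infty}\zeta^n_{fp}(\varepsilon,\Theta_1,\Theta_2)\;\ge\; D^{\infty}(\Theta_1\|\Theta_2).$$
   Context: All systems are finite-dimensional; reference systems $R$ have arbitrary finite dimension; $\log$ is base 2; identity maps on systems not acted upon are omitted. Superchannel: $\Theta$ is given by channels $(\mathcal E_{C\to AS},\mathcal D_{BS\to D})$ and maps a channel $\mathcal N_{AR\to BR}$ to $(\Theta\otimes\mathrm{id}_R)(\mathcal N)=\mathcal D\circ\mathcal N\circ\mathcal E$, a channel from $CR$ to $DR$. $\Theta^{\otimes n}$ is the superchannel given by $(\mathcal E^{\otimes n},\mathcal D^{\otimes n})$, acting on channels $A^nR\to B^nR$. $D(\rho\|\sigma)=\mathrm{Tr}[\rho(\log\rho-\log\sigma)]$ if $\mathrm{supp}\,\rho\subseteq\mathrm{supp}\,\sigma$ and $+\infty$ otherwise. $D(\Theta_1\|\Theta_2)=\sup_{\rho,\mathcal N}D\big((\Theta_1\otimes\mathrm{id}_R)(\mathcal N)(\rho)\|(\Theta_2\otimes\mathrm{id}_R)(\mathcal N)(\rho)\big)$ over states $\rho_{CR}$ and channels $\mathcal N_{AR\to BR}$, and $D^\infty(\Theta_1\|\Theta_2)=\lim_{n\to\infty}\frac1n D(\Theta_1^{\otimes n}\|\Theta_2^{\otimes n})$. Fully parallel strategy with $n$ copies: $\mathcal S=\{\rho_{C^nR},\mathcal N_{A^nR\to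 B^nR},\mathcal Q\}$ with arbitrary joint state $\rho$, arbitrary joint channel $\mathcal N$, and binary POVM $\mathcal Q=\{Q_1,Q_2\}$; the output state is $\rho_i=(\Theta_i^{\otimes n}\otimes\mathrm{id}_R)(\mathcal N)(\rho)$ when the superchannel is $\Theta_i$. The errors are $\alpha_n(\mathcal S)=\mathrm{Tr}(Q_2\rho_1)$ and $\beta_n(\mathcal S)=\mathrm{Tr}(Q_1\rho_2)$, and $\zeta^n_{fp}(\varepsilon,\Theta_1,\Theta_2)=\sup_{\mathcal S}\{-\frac1n\log\beta_n(\mathcal S):\alpha_n(\mathcal S)\le\varepsilon\}$ over fully parallel strategies. *)

theory Defs
  imports "HOL-Analysis.Analysis"
begin

section \<open>Operators on finite-dimensional systems\<close>

text \<open>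
  A system is given by a finite nonempty set I labelling a fixed orthonormal basis, its Hilbert
  space being the functions supported on I. Operators are
  matrices indexed by labels and are required to vanish outside I. The composite of two systems is
  labelled by the product of the label sets, and n copies of a system by the lists of length n; this
  keeps the number of copies and the dimension of reference systems as ordinary variables.
  A reference system of dimension r is labelled by the natural numbers below r.
\<close>

type_synonym 'i op = "'i \<Rightarrow> 'i \<Rightarrow> complex"
type_synonym ('i, 'j) smap = "'i op \<Rightarrow> 'j op"

definition vecs :: "'i set \<Rightarrow> ('i \<Rightarrow> complex) set" where
  "vecs I = {v. \<forall>i. i \<notin> I \<longrightarrow> v i = 0}"

definition ops :: "'i set \<Rightarrow> 'i op set" where
  "ops I = {X. \<forall>i j. i \<notin> I \<or> j \<notin> I \<longrightarrow> X i j = 0}"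

definition op_restrict :: "'i set \<Rightarrow> 'i op \<Rightarrow> 'i op" where
  "op_restrict I X = (\<lambda>i j. if i \<in> I \<and> j \<in> I then X i j else 0)"

definition op_id :: "'i set \<Rightarrow> 'i op" where
  "op_id I = (\<lambda>i j. if i = j \<and> i \<in> I then 1 else 0)"

definition op_unit :: "'i \<Rightarrow> 'i \<Rightarrow> 'i op" where
  "op_unit a b = (\<lambda>i j. if i = a \<and> j = b then 1 else 0)"

definition op_mult :: "'i set \<Rightarrow> 'i op \<Rightarrow> 'i op \<Rightarrow> 'i op" where
  "op_mult I X Y = (\<lambda>i j. \<Sum>k\<in>I. X i k * Y k j)"

definition op_apply :: "'i set \<Rightarrow> 'i op \<Rightarrow> ('i \<Rightarrow> complex) \<Rightarrow> ('i \<Rightarrow> complex)" where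
  "op_apply I X v = (\<lambda>i. \<Sum>j\<in>I. X i j * v j)"

definition op_trace :: "'i set \<Rightarrow> 'i op \<Rightarrow> complex" where
  "op_trace I X = (\<Sum>i\<in>I. X i i)"

definition vec_inner :: "'i set \<Rightarrow> ('i \<Rightarrow> complex) \<Rightarrow> ('i \<Rightarrow> complex) \<Rightarrow> complex" where
  "vec_inner I v w = (\<Sum>i\<in>I. cnj (v i) * w i)"

definition psd :: "'i set \<Rightarrow> 'i op \<Rightarrow> bool" where
  "psd I X \<longleftrightarrow> X \<in> ops I \<and> (\<forall>i j. X j i = cnj (X i j)) \<and>
     (\<forall>v\<in>vecs I. 0 \<le> Re (vec_inner I v (op_apply I X v)))"

definition state :: "'i set \<Rightarrow> 'i op \<Rightarrow> bool" where
  "state I \<rho> \<longleftrightarrow> psd I \<rho> \<and> op_trace I \<rho> = 1"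


section \<open>Relative entropy\<close>

text \<open>
  Functional calculus for Hermitian operators: f is applied to the eigenvalues in a spectral
  decomposition. The result does not depend on the decomposition chosen.
\<close>

definition spectral_decomp ::
    "'i set \<Rightarrow> 'i op \<Rightarrow> ('i \<Rightarrow> real) \<Rightarrow> ('i \<Rightarrow> 'i \<Rightarrow> complex) \<Rightarrow> bool" where
  "spectral_decomp I X ev u \<longleftrightarrow>
     (\<forall>k\<in>I. u k \<in> vecs I) \<and>
     (\<forall>k\<in>I. \<forall>l\<in>I. vec_inner I (u k) (u l) = (if k = l then 1 else 0)) \<and>
     X = (\<lambda>i j. \<Sum>k\<in>I. complex_of_real (ev k) * u k i * cnj (u k j))"

definition op_fun :: "'i set \<Rightarrow> (real \<Rightarrow> real) \<Rightarrow> 'i op \<Rightarrow> 'i op" where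
  "op_fun I f X = (SOME Y. \<exists>ev u. spectral_decomp I X ev u \<and>
     Y = (\<lambda>i j. \<Sum>k\<in>I. complex_of_real (f (ev k)) * u k i * cnj (u k j)))"

text \<open>
  The logarithm of a positive semidefinite operator is taken on its support and is zero on its
  kernel, which is the usual reading of the trace formula for the relative entropy.
\<close>

definition op_log :: "'i set \<Rightarrow> 'i op \<Rightarrow> 'i op" where
  "op_log I X = op_fun I (\<lambda>x. if x = 0 then 0 else log 2 x) X"

definition op_supp :: "'i set \<Rightarrow> 'i op \<Rightarrow> ('i \<Rightarrow> complex) set" where
  "op_supp I X = {v \<in> vecs I. \<forall>w\<in>vecs I. op_apply I X w = (\<lambda>_. 0) \<longrightarrow> vec_inner I w v = 0}"

definition rel_entropy :: "'i set \<Rightarrow> 'i op \<Rightarrow> 'i op \<Rightarrow> ereal" where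
  "rel_entropy I \<rho> \<sigma> =
     (if op_supp I \<rho> \<subseteq> op_supp I \<sigma>
      then ereal (Re (op_trace I (op_mult I \<rho> (\<lambda>i j. op_log I \<rho> i j - op_log I \<sigma> i j))))
      else \<infinity>)"


section \<open>Channels\<close>

text \<open>
  Tensoring a linear map on the right with the identity map of an arbitrary system: the map acts on
  each block obtained by fixing the labels of that system.
\<close>

definition ext_id :: "('i, 'j) smap \<Rightarrow> ('i \<times> 'k, 'j \<times> 'k) smap" where
  "ext_id \<Phi> X = (\<lambda>(j, k) (j', k'). \<Phi> (\<lambda>i i'. X (i, k) (i', k')) j j')"

definition linear_map :: "'i set \<Rightarrow> 'j set \<Rightarrow> ('i, 'j) smap \<Rightarrow> bool" where
  "linear_map I J \<Phi> \<longleftrightarrow> (\<forall>X\<in>ops I. \<Phi> X \<in> ops J) \<and>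
     (\<forall>X\<in>ops I. \<forall>Y\<in>ops I. \<forall>a b.
        \<Phi> (\<lambda>i i'. a * X i i' + b * Y i i') = (\<lambda>j j'. a * \<Phi> X j j' + b * \<Phi> Y j j'))"

definition completely_positive :: "'i set \<Rightarrow> 'j set \<Rightarrow> ('i, 'j) smap \<Rightarrow> bool" where
  "completely_positive I J \<Phi> \<longleftrightarrow> (\<forall>r::nat. \<forall>X.
     psd (I \<times> {..<r}) X \<longrightarrow> psd (J \<times> {..<r}) (ext_id \<Phi> X))"

definition trace_preserving :: "'i set \<Rightarrow> 'j set \<Rightarrow> ('i, 'j) smap \<Rightarrow> bool" where
  "trace_preserving I J \<Phi> \<longleftrightarrow> (\<forall>X\<in>ops I. op_trace J (\<Phi> X) = op_trace I X)"

definition channel :: "'i set \<Rightarrow> 'j set \<Rightarrow> ('i, 'j) smap \<Rightarrow> bool" where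
  "channel I J \<Phi> \<longleftrightarrow>
     linear_map I J \<Phi> \<and> completely_positive I J \<Phi> \<and> trace_preserving I J \<Phi>"

definition sys_pow :: "nat \<Rightarrow> 'i set \<Rightarrow> 'i list set" where
  "sys_pow n I = {xs. set xs \<subseteq> I \<and> length xs = n}"

text \<open>
  The n-fold tensor power of a linear map. A matrix unit on n copies is the tensor product of
  matrix units, so it is sent to the tensor product of their images; extend linearly.
\<close>

definition map_pow :: "nat \<Rightarrow> 'i set \<Rightarrow> 'j set \<Rightarrow> ('i, 'j) smap \<Rightarrow> ('i list, 'j list) smap" where
  "map_pow n I J \<Phi> X = op_restrict (sys_pow n J) (\<lambda>ys ys'.
     \<Sum>xs\<in>sys_pow n I. \<Sum>xs'\<in>sys_pow n I.
       X xs xs' * (\<Prod>k<n. \<Phi> (op_unit (xs ! k) (xs' ! k)) (ys ! k) (ys' ! k)))"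

text \<open>
  The defining property of the tensor power, map_pow_tensor below: product operators are sent to the
  products of the images.
\<close>

lemma linear_map_sum:
  assumes L: "linear_map I J \<Phi>" and "finite F" and "\<And>k. k \<in> F \<Longrightarrow> Z k \<in> ops I"
  shows "\<Phi> (\<lambda>i i'. \<Sum>k\<in>F. c k * Z k i i') = (\<lambda>j j'. \<Sum>k\<in>F. c k * \<Phi> (Z k) j j')"
  using assms(2,3)
proof (induction F)
  case empty
  have z: "(\<lambda>i i'. 0) \<in> ops I" by (simp add: ops_def)
  have "\<forall>X\<in>ops I. \<forall>Y\<in>ops I. \<forall>a b.
        \<Phi> (\<lambda>i i'. a * X i i' + b * Y i i') = (\<lambda>j j'. a * \<Phi> X j j' + b * \<Phi> Y j j')"
    using L unfolding linear_map_def by blast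
  from this[rule_format, OF z z, of 0 0] show ?case by simp
next
  case (insert x F)
  have lin: "\<forall>X\<in>ops I. \<forall>Y\<in>ops I. \<forall>a b.
        \<Phi> (\<lambda>i i'. a * X i i' + b * Y i i') = (\<lambda>j j'. a * \<Phi> X j j' + b * \<Phi> Y j j')"
    using L unfolding linear_map_def by blast
  have o: "(\<lambda>i i'. \<Sum>k\<in>F. c k * Z k i i') \<in> ops I"
    using insert.prems by (auto simp: ops_def intro!: sum.neutral)
  have "Z x \<in> ops I" using insert.prems by simp
  from lin[rule_format, OF this o, of "c x" 1] show ?case
    using insert by simp
qed

lemma linear_map_matrix_units:
  assumes L: "linear_map I J \<Phi>" and I: "finite I" and X: "X \<in> ops I"
  shows "\<Phi> X j j' = (\<Sum>a\<in>I. \<Sum>b\<in>I. X a b * \<Phi> (op_unit a b) j j')"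
proof -
  have e: "X i i' = (\<Sum>k\<in>I\<times>I. X (fst k) (snd k) * op_unit (fst k) (snd k) i i')" for i i'
  proof (cases "(i,i') \<in> I \<times> I")
    case True
    have "(\<Sum>k\<in>I\<times>I. X (fst k) (snd k) * op_unit (fst k) (snd k) i i')
       = (\<Sum>k\<in>I\<times>I. if k = (i,i') then X i i' else 0)"
      by (rule sum.cong) (auto simp: op_unit_def)
    then show ?thesis using True I by (simp add: finite_cartesian_product)
  next
    case False
    then have "X i i' = 0" using X by (auto simp: ops_def)
    moreover have "(\<Sum>k\<in>I\<times>I. X (fst k) (snd k) * op_unit (fst k) (snd k) i i') = 0"
      using False by (intro sum.neutral) (auto simp: op_unit_def)
    ultimately show ?thesis by simp
  qed
  have "\<Phi> X = \<Phi> (\<lambda>i i'. \<Sum>k\<in>I\<times>I. X (fst k) (snd k) * op_unit (fst k) (snd k) i i')"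
    using e by (metis (no_types, lifting) ext)
  also have "\<dots> = (\<lambda>j j'. \<Sum>k\<in>I\<times>I. X (fst k) (snd k) * \<Phi> (op_unit (fst k) (snd k)) j j')"
    by (rule linear_map_sum[OF L]) (use I in \<open>auto simp: ops_def op_unit_def\<close>)
  finally show ?thesis by (simp add: sum.cartesian_product case_prod_unfold)
qed

lemma sys_pow_Suc: "sys_pow (Suc n) I = (\<lambda>(x, xs). x # xs) ` (I \<times> sys_pow n I)"
  by (force simp: sys_pow_def length_Suc_conv image_iff)

lemma sum_sys_pow_prod:
  assumes "finite I"
  shows "(\<Sum>xs\<in>sys_pow n I. \<Sum>xs'\<in>sys_pow n I. \<Prod>k<n. g k (xs ! k) (xs' ! k))
     = (\<Prod>k<n. \<Sum>a\<in>I. \<Sum>b\<in>I. (g k a b :: complex))"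
proof (induction n arbitrary: g)
  case 0
  have "sys_pow 0 I = {[]}" by (auto simp: sys_pow_def)
  then show ?case by simp
next
  case (Suc n)
  have inj: "inj_on (\<lambda>(x, xs). x # xs) (I \<times> sys_pow n I)" by (auto simp: inj_on_def)
  have s: "(\<Sum>xs\<in>sys_pow (Suc n) I. h xs) = (\<Sum>a\<in>I. \<Sum>xs\<in>sys_pow n I. h (a # xs))" for h :: "_ \<Rightarrow> complex"
    unfolding sys_pow_Suc by (subst sum.reindex[OF inj]) (simp add: sum.cartesian_product case_prod_unfold)
  have "(\<Sum>xs\<in>sys_pow (Suc n) I. \<Sum>xs'\<in>sys_pow (Suc n) I. \<Prod>k<Suc n. g k (xs ! k) (xs' ! k))
    = (\<Sum>a\<in>I. \<Sum>xs\<in>sys_pow n I. \<Sum>b\<in>I. \<Sum>xs'\<in>sys_pow n I. g 0 a b * (\<Prod>k<n. g (Suc k) (xs ! k) (xs' ! k)))"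
    by (simp add: s prod.lessThan_Suc_shift del: prod.lessThan_Suc)
  also have "\<dots> = (\<Sum>a\<in>I. \<Sum>b\<in>I. g 0 a b * (\<Sum>xs\<in>sys_pow n I. \<Sum>xs'\<in>sys_pow n I. \<Prod>k<n. g (Suc k) (xs ! k) (xs' ! k)))"
    by (subst sum.swap[of _ I "sys_pow n I"]) (simp add: sum_distrib_left)
  also have "\<dots> = (\<Prod>k<Suc n. \<Sum>a\<in>I. \<Sum>b\<in>I. g k a b)"
    unfolding Suc.IH[of "\<lambda>k. g (Suc k)"]
    by (simp add: prod.lessThan_Suc_shift sum_distrib_right del: prod.lessThan_Suc)
  finally show ?case .
qed

lemma map_pow_tensor:
  assumes L: "linear_map I J \<Phi>" and I: "finite I" and X: "\<And>k. k < n \<Longrightarrow> X k \<in> ops I"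
  shows "map_pow n I J \<Phi> (op_restrict (sys_pow n I) (\<lambda>xs xs'. \<Prod>k<n. X k (xs ! k) (xs' ! k)))
     = op_restrict (sys_pow n J) (\<lambda>ys ys'. \<Prod>k<n. \<Phi> (X k) (ys ! k) (ys' ! k))"
proof -
  have "(\<Sum>xs\<in>sys_pow n I. \<Sum>xs'\<in>sys_pow n I.
       op_restrict (sys_pow n I) (\<lambda>xs xs'. \<Prod>k<n. X k (xs ! k) (xs' ! k)) xs xs' *
         (\<Prod>k<n. \<Phi> (op_unit (xs ! k) (xs' ! k)) (ys ! k) (ys' ! k)))
     = (\<Prod>k<n. \<Phi> (X k) (ys ! k) (ys' ! k))" for ys ys'
  proof -
    have "(\<Prod>k<n. \<Phi> (X k) (ys ! k) (ys' ! k)) =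
      (\<Prod>k<n. \<Sum>a\<in>I. \<Sum>b\<in>I. X k a b * \<Phi> (op_unit a b) (ys ! k) (ys' ! k))"
      by (rule prod.cong) (use linear_map_matrix_units[OF L I X] in auto)
    also have "\<dots> = (\<Sum>xs\<in>sys_pow n I. \<Sum>xs'\<in>sys_pow n I.
        \<Prod>k<n. X k (xs ! k) (xs' ! k) * \<Phi> (op_unit (xs ! k) (xs' ! k)) (ys ! k) (ys' ! k))"
      by (rule sum_sys_pow_prod[OF I, symmetric])
    also have "\<dots> = (\<Sum>xs\<in>sys_pow n I. \<Sum>xs'\<in>sys_pow n I.
       op_restrict (sys_pow n I) (\<lambda>xs xs'. \<Prod>k<n. X k (xs ! k) (xs' ! k)) xs xs' *
         (\<Prod>k<n. \<Phi> (op_unit (xs ! k) (xs' ! k)) (ys ! k) (ys' ! k)))"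
      by (intro sum.cong refl) (simp add: op_restrict_def prod.distrib)
    finally show ?thesis by simp
  qed
  then show ?thesis unfolding map_pow_def by simp
qed


section \<open>Superchannels\<close>

record ('a, 'b, 'c, 'd, 's) superch =
  sysA :: "'a set"
  sysB :: "'b set"
  sysC :: "'c set"
  sysD :: "'d set"
  sysS :: "'s set"
  enc :: "('c, 'a \<times> 's) smap"
  dec :: "('b \<times> 's, 'd) smap"

definition system :: "'i set \<Rightarrow> bool" where
  "system I \<longleftrightarrow> finite I \<and> I \<noteq> {}"

definition superchannel :: "('a, 'b, 'c, 'd, 's) superch \<Rightarrow> bool" where
  "superchannel \<Theta> \<longleftrightarrow>
     system (sysA \<Theta>) \<and> system (sysB \<Theta>) \<and> system (sysC \<Theta>) \<and> system (sysD \<Theta>) \<and> system (sysS \<Theta>) \<and>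
     channel (sysC \<Theta>) (sysA \<Theta> \<times> sysS \<Theta>) (enc \<Theta>) \<and>
     channel (sysB \<Theta> \<times> sysS \<Theta>) (sysD \<Theta>) (dec \<Theta>)"

definition same_systems ::
    "('a, 'b, 'c, 'd, 's) superch \<Rightarrow> ('a, 'b, 'c, 'd, 't) superch \<Rightarrow> bool" where
  "same_systems \<Theta>\<^sub>1 \<Theta>\<^sub>2 \<longleftrightarrow> sysA \<Theta>\<^sub>1 = sysA \<Theta>\<^sub>2 \<and> sysB \<Theta>\<^sub>1 = sysB \<Theta>\<^sub>2 \<and>
     sysC \<Theta>\<^sub>1 = sysC \<Theta>\<^sub>2 \<and> sysD \<Theta>\<^sub>1 = sysD \<Theta>\<^sub>2"

definition swap_last :: "(('x \<times> 'y) \<times> 'z) op \<Rightarrow> (('x \<times> 'z) \<times> 'y) op" where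
  "swap_last X = (\<lambda>((x, z), y) ((x', z'), y'). X ((x, y), z) ((x', y'), z'))"

text \<open>
  Encode C into AS, move R next to A, apply N on AR (identity on S), move S back next to B, decode
  BS into D (identity on R).
\<close>

definition superch_apply ::
    "('a, 'b, 'c, 'd, 's) superch \<Rightarrow> ('a \<times> 'r, 'b \<times> 'r) smap \<Rightarrow> ('c \<times> 'r, 'd \<times> 'r) smap" where
  "superch_apply \<Theta> N =
     ext_id (dec \<Theta>) \<circ> swap_last \<circ> ext_id N \<circ> swap_last \<circ> ext_id (enc \<Theta>)"

text \<open>
  The tensor power of the encoder outputs lists of pairs; these are identified with pairs of lists,
  that is, n copies of AS with the composite of n copies of A and n copies of S. The same
  identification is made at the input of the decoder.
\<close>

definition superch_pow :: "nat \<Rightarrow> ('a, 'b, 'c, 'd, 's) superch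
    \<Rightarrow> ('a list, 'b list, 'c list, 'd list, 's list) superch" where
  "superch_pow n \<Theta> =
     \<lparr>sysA = sys_pow n (sysA \<Theta>), sysB = sys_pow n (sysB \<Theta>), sysC = sys_pow n (sysC \<Theta>),
      sysD = sys_pow n (sysD \<Theta>), sysS = sys_pow n (sysS \<Theta>),
      enc = (\<lambda>X. op_restrict (sys_pow n (sysA \<Theta>) \<times> sys_pow n (sysS \<Theta>))
        (\<lambda>(as, ss) (as', ss').
           map_pow n (sysC \<Theta>) (sysA \<Theta> \<times> sysS \<Theta>) (enc \<Theta>) X (zip as ss) (zip as' ss'))),
      dec = (\<lambda>X. map_pow n (sysB \<Theta> \<times> sysS \<Theta>) (sysD \<Theta>) (dec \<Theta>)
        (\<lambda>zs zs'. X (map fst zs, map snd zs) (map fst zs', map snd zs')))\<rparr>"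

definition superch_div ::
    "('a, 'b, 'c, 'd, 's) superch \<Rightarrow> ('a, 'b, 'c, 'd, 't) superch \<Rightarrow> ereal" where
  "superch_div \<Theta>\<^sub>1 \<Theta>\<^sub>2 = Sup {rel_entropy (sysD \<Theta>\<^sub>1 \<times> {..<r})
        (superch_apply \<Theta>\<^sub>1 N \<rho>) (superch_apply \<Theta>\<^sub>2 N \<rho>) | (r::nat) \<rho> N.
      0 < r \<and> state (sysC \<Theta>\<^sub>1 \<times> {..<r}) \<rho> \<and>
      channel (sysA \<Theta>\<^sub>1 \<times> {..<r}) (sysB \<Theta>\<^sub>1 \<times> {..<r}) N}"

definition superch_div_reg ::
    "('a, 'b, 'c, 'd, 's) superch \<Rightarrow> ('a, 'b, 'c, 'd, 't) superch \<Rightarrow> ereal" where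
  "superch_div_reg \<Theta>\<^sub>1 \<Theta>\<^sub>2 =
     lim (\<lambda>n. ereal (1 / real n) * superch_div (superch_pow n \<Theta>\<^sub>1) (superch_pow n \<Theta>\<^sub>2))"


section \<open>Fully parallel discrimination strategies\<close>

definition binary_povm :: "'i set \<Rightarrow> 'i op \<Rightarrow> 'i op \<Rightarrow> bool" where
  "binary_povm I Q\<^sub>1 Q\<^sub>2 \<longleftrightarrow> psd I Q\<^sub>1 \<and> psd I Q\<^sub>2 \<and> (\<lambda>i j. Q\<^sub>1 i j + Q\<^sub>2 i j) = op_id I"

record ('a, 'b, 'c, 'd) strategy =
  ref_dim :: nat
  input :: "('c list \<times> nat) op"
  chan :: "('a list \<times> nat, 'b list \<times> nat) smap"
  test1 :: "('d list \<times> nat) op"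
  test2 :: "('d list \<times> nat) op"

definition fp_strategy ::
    "nat \<Rightarrow> ('a, 'b, 'c, 'd, 's) superch \<Rightarrow> ('a, 'b, 'c, 'd) strategy \<Rightarrow> bool" where
  "fp_strategy n \<Theta> S \<longleftrightarrow> 0 < ref_dim S \<and>
     state (sys_pow n (sysC \<Theta>) \<times> {..<ref_dim S}) (input S) \<and>
     channel (sys_pow n (sysA \<Theta>) \<times> {..<ref_dim S}) (sys_pow n (sysB \<Theta>) \<times> {..<ref_dim S}) (chan S) \<and>
     binary_povm (sys_pow n (sysD \<Theta>) \<times> {..<ref_dim S}) (test1 S) (test2 S)"

definition fp_output ::
    "nat \<Rightarrow> ('a, 'b, 'c, 'd, 's) superch \<Rightarrow> ('a, 'b, 'c, 'd) strategy \<Rightarrow> ('d list \<times> nat) op" where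
  "fp_output n \<Theta> S = superch_apply (superch_pow n \<Theta>) (chan S) (input S)"

definition err1 ::
    "nat \<Rightarrow> ('a, 'b, 'c, 'd, 's) superch \<Rightarrow> ('a, 'b, 'c, 'd) strategy \<Rightarrow> real" where
  "err1 n \<Theta>\<^sub>1 S = (let I = sys_pow n (sysD \<Theta>\<^sub>1) \<times> {..<ref_dim S} in
     Re (op_trace I (op_mult I (test2 S) (fp_output n \<Theta>\<^sub>1 S))))"

definition err2 ::
    "nat \<Rightarrow> ('a, 'b, 'c, 'd, 's) superch \<Rightarrow> ('a, 'b, 'c, 'd) strategy \<Rightarrow> real" where
  "err2 n \<Theta>\<^sub>2 S = (let I = sys_pow n (sysD \<Theta>\<^sub>2) \<times> {..<ref_dim S} in
     Re (op_trace I (op_mult I (test1 S) (fp_output n \<Theta>\<^sub>2 S))))"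

definition neg_log2 :: "real \<Rightarrow> ereal" where
  "neg_log2 x = (if x = 0 then \<infinity> else ereal (- log 2 x))"

definition stein_fp ::
    "nat \<Rightarrow> real \<Rightarrow> ('a, 'b, 'c, 'd, 's) superch \<Rightarrow> ('a, 'b, 'c, 'd, 't) superch \<Rightarrow> ereal" where
  "stein_fp n \<epsilon> \<Theta>\<^sub>1 \<Theta>\<^sub>2 = Sup {ereal (1 / real n) * neg_log2 (err2 n \<Theta>\<^sub>2 S) | S.
     fp_strategy n \<Theta>\<^sub>1 S \<and> err1 n \<Theta>\<^sub>1 S \<le> \<epsilon>}"

end

theory Submission
  imports Defs
begin

text \<open>
  Write the outputs of an n-copy strategy under the two superchannels in eigenbases u, w with
  eigenvalues p, q. Then P(k,l) = p(k) |<w(l),u(k)>|^2 is a probability distribution, and the relative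
  entropy is the mean of log p(k) - log q(l) under P. Using two strategies side by side multiplies the
  distributions, so the means and variances of log p and log q add up; hence the divergence of the
  tensor powers is superadditive and the limit defining the regularised divergence exists.

  For the test, fix an m-copy strategy, use it k times, and let X be the set of those eigenvectors of
  the first output whose eigenvalue is close to its typical value. Project X to the span of the
  eigenvectors of the second output with typical or smaller eigenvalue, and test for the span of these
  projections. Its dimension is at most the cardinality of X, which bounds the second error. A unit
  vector x and its projection y satisfy <x,y> = |y|^2, so the test accepts x with probability at least
  |y|^2, and Chebyshev's inequality bounds the first error. At most m - 1 remaining copies are used
  with an arbitrary strategy.
\<close>


section \<open>Inner products and orthonormal families\<close>

text \<open>P is one half of the Nussbaum-Szkola pair: it replaces two non-commuting outputs by one
  classical distribution, so Chebyshev's inequality is the only law of large numbers involved. The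
  obstacle is that a typical eigenvector of the first output may overlap with large eigenvalues of
  the second. After the projection, all vectors spanned give the second output a quadratic form of
  at most 2^(-(nu-t)) per unit norm, and a state has at most 2^(mu+t) eigenvalues above 2^(-(mu+t));
  the product of the two is the second error 2^(mu-nu+2t). With k blocks the means and variances
  grow like k, so t = k * delta makes the first error of order 1/k. Hence only finiteness of the
  variances matters, and every positive \<epsilon> is reached. The regularised divergence is a
  \<open>lim\<close>, which says nothing unless the sequence converges. Rates and Stein exponents
  are therefore both compared with the same real numbers (nu - mu) / m of single m-copy strategies:
  one comparison yields the limit, the other the theorem. Infinite divergences need no separate
  limit argument, since those real numbers are then unbounded.\<close>

lemma vec_inner_sum_right:
  "vec_inner I w (\<lambda>i. \<Sum>k\<in>F. c k * u k i) = (\<Sum>k\<in>F. c k * vec_inner I w (u k))"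
  unfolding vec_inner_def sum_distrib_left
  by (subst sum.swap) (simp add: mult_ac)

lemma vec_inner_diff_right:
  "vec_inner I w (\<lambda>i. v i - v' i) = vec_inner I w v - vec_inner I w v'"
  unfolding vec_inner_def by (simp add: right_diff_distrib sum_subtractf)

lemma vec_inner_add_right:
  "vec_inner I w (\<lambda>i. v i + v' i) = vec_inner I w v + vec_inner I w v'"
  unfolding vec_inner_def by (simp add: distrib_left sum.distrib)

lemma vec_inner_scale_right: "vec_inner I w (\<lambda>i. c * v i) = c * vec_inner I w v"
  unfolding vec_inner_def by (simp add: sum_distrib_left mult_ac)

lemma vec_inner_cnj: "cnj (vec_inner I v w) = vec_inner I w v"
  unfolding vec_inner_def by (simp add: cnj_sum mult.commute)

lemma vec_inner_add_left:
  "vec_inner I (\<lambda>i. v i + v' i) w = vec_inner I v w + vec_inner I v' w"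
  unfolding vec_inner_def by (simp add: distrib_right sum.distrib)

lemma vec_inner_scale_left: "vec_inner I (\<lambda>i. c * v i) w = cnj c * vec_inner I v w"
  unfolding vec_inner_def by (simp add: sum_distrib_left mult_ac)

lemma vec_inner_zero [simp]: "vec_inner I (\<lambda>_. 0) w = 0" "vec_inner I w (\<lambda>_. 0) = 0"
  by (simp_all add: vec_inner_def)

lemma vec_inner_self: "vec_inner I v v = complex_of_real (\<Sum>i\<in>I. (cmod (v i))\<^sup>2)"
proof -
  have "cnj z * z = complex_of_real ((cmod z)\<^sup>2)" for z
    by (metis complex_norm_square mult.commute)
  then show ?thesis unfolding vec_inner_def by simp
qed

lemma vec_inner_self_eq_0:
  assumes "finite I" "v \<in> vecs I" "vec_inner I v v = 0"
  shows "v = (\<lambda>_. 0)"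
proof
  fix i
  have "(\<Sum>i\<in>I. (cmod (v i))\<^sup>2) = 0"
    using assms(3) unfolding vec_inner_self of_real_eq_0_iff .
  then have "i \<in> I \<Longrightarrow> v i = 0"
    using assms(1) by (subst (asm) sum_nonneg_eq_0_iff) auto
  then show "v i = 0" using assms(2) by (auto simp: vecs_def)
qed

text \<open>The index set F is separate from the labels I, so that eigenbases indexed by I and
  partial families indexed by \<open>{..<d}\<close> are treated alike.\<close>

definition orthonormal :: "'i set \<Rightarrow> 'k set \<Rightarrow> ('k \<Rightarrow> 'i \<Rightarrow> complex) \<Rightarrow> bool" where
  "orthonormal I F u \<longleftrightarrow> (\<forall>k\<in>F. u k \<in> vecs I) \<and>
     (\<forall>k\<in>F. \<forall>l\<in>F. vec_inner I (u k) (u l) = (if k = l then 1 else 0))"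

text \<open>The component of v orthogonal to the span of the family.\<close>

definition resid :: "'i set \<Rightarrow> 'k set \<Rightarrow> ('k \<Rightarrow> 'i \<Rightarrow> complex) \<Rightarrow> ('i \<Rightarrow> complex) \<Rightarrow> 'i \<Rightarrow> complex" where
  "resid I F u v = (\<lambda>i. v i - (\<Sum>k\<in>F. vec_inner I (u k) v * u k i))"

lemma resid_in_vecs:
  assumes "orthonormal I F u" "v \<in> vecs I"
  shows "resid I F u v \<in> vecs I"
  using assms by (auto simp: orthonormal_def resid_def vecs_def)

lemma resid_orth:
  assumes "orthonormal I F u" "finite F" "l \<in> F"
  shows "vec_inner I (u l) (resid I F u v) = 0"
proof -
  have "vec_inner I (u l) (resid I F u v)
      = vec_inner I (u l) v - (\<Sum>k\<in>F. vec_inner I (u k) v * vec_inner I (u l) (u k))"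
    unfolding resid_def vec_inner_diff_right vec_inner_sum_right ..
  also have "(\<Sum>k\<in>F. vec_inner I (u k) v * vec_inner I (u l) (u k))
      = (\<Sum>k\<in>F. if k = l then vec_inner I (u l) v else 0)"
    using assms by (intro sum.cong) (auto simp: orthonormal_def)
  finally show ?thesis using assms by simp
qed

lemma resid_norm:
  assumes "orthonormal I F u" "finite F"
  shows "Re (vec_inner I (resid I F u v) (resid I F u v))
    = Re (vec_inner I v v) - (\<Sum>k\<in>F. (cmod (vec_inner I (u k) v))\<^sup>2)"
proof -
  let ?r = "resid I F u v"
  have z: "vec_inner I ?r (u k) = 0" if "k \<in> F" for k
    using resid_orth[OF assms that, of v] vec_inner_cnj[of I "u k" ?r] by simp
  have "vec_inner I ?r ?r = vec_inner I ?r v - (\<Sum>k\<in>F. vec_inner I (u k) v * vec_inner I ?r (u k))"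
    by (subst (2) resid_def) (simp add: vec_inner_diff_right vec_inner_sum_right)
  also have "\<dots> = vec_inner I ?r v" using z by simp
  also have "\<dots> = cnj (vec_inner I v ?r)" by (simp add: vec_inner_cnj)
  also have "vec_inner I v ?r = vec_inner I v v - (\<Sum>k\<in>F. vec_inner I (u k) v * vec_inner I v (u k))"
    unfolding resid_def vec_inner_diff_right vec_inner_sum_right ..
  also have "(\<Sum>k\<in>F. vec_inner I (u k) v * vec_inner I v (u k))
      = (\<Sum>k\<in>F. complex_of_real ((cmod (vec_inner I (u k) v))\<^sup>2))"
    by (intro sum.cong refl) (metis complex_norm_square vec_inner_cnj)
  finally show ?thesis by simp
qed

lemma bessel:
  assumes "orthonormal I F u" "finite F"
  shows "(\<Sum>k\<in>F. (cmod (vec_inner I (u k) v))\<^sup>2) \<le> Re (vec_inner I v v)"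
proof -
  have "0 \<le> Re (vec_inner I (resid I F u v) (resid I F u v))"
    unfolding vec_inner_self by (simp add: sum_nonneg)
  then show ?thesis using resid_norm[OF assms, of v] by simp
qed

definition basis_vec :: "'i \<Rightarrow> 'i \<Rightarrow> complex" where
  "basis_vec i = (\<lambda>j. if j = i then 1 else 0)"

lemma basis_vec_in_vecs: "i \<in> I \<Longrightarrow> basis_vec i \<in> vecs I"
  by (auto simp: basis_vec_def vecs_def)

lemma vec_inner_basis:
  assumes "finite I" "i \<in> I"
  shows "vec_inner I v (basis_vec i) = cnj (v i)" "vec_inner I (basis_vec i) v = v i"
  using assms by (simp_all add: vec_inner_def basis_vec_def if_distrib if_distribR cong: if_cong)

text \<open>This is the trace of the projection onto the orthogonal complement. Positive for too few
  vectors, it supplies a direction for the next eigenvector; zero for a full family, it gives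
  completeness.\<close>

lemma sum_resid_basis:
  assumes "orthonormal I F u" "finite F" "finite I"
  shows "(\<Sum>i\<in>I. Re (vec_inner I (resid I F u (basis_vec i)) (resid I F u (basis_vec i))))
     = real (card I) - real (card F)"
proof -
  have "(\<Sum>i\<in>I. Re (vec_inner I (resid I F u (basis_vec i)) (resid I F u (basis_vec i))))
    = (\<Sum>i\<in>I. 1 - (\<Sum>k\<in>F. (cmod (u k i))\<^sup>2))"
    by (intro sum.cong refl) (simp add: resid_norm assms vec_inner_basis, simp add: basis_vec_def)
  also have "\<dots> = real (card I) - (\<Sum>k\<in>F. \<Sum>i\<in>I. (cmod (u k i))\<^sup>2)"
    by (subst sum.swap) (simp add: sum_subtractf)
  also have "(\<Sum>k\<in>F. \<Sum>i\<in>I. (cmod (u k i))\<^sup>2) = (\<Sum>k\<in>F. 1)"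
  proof (intro sum.cong refl)
    fix k assume "k \<in> F"
    then have "vec_inner I (u k) (u k) = 1" using assms(1) by (simp add: orthonormal_def)
    then have "complex_of_real (\<Sum>i\<in>I. (cmod (u k i))\<^sup>2) = of_real 1"
      unfolding vec_inner_self by simp
    then show "(\<Sum>i\<in>I. (cmod (u k i))\<^sup>2) = 1" unfolding of_real_eq_iff .
  qed
  finally show ?thesis by simp
qed

text \<open>
  Summing Bessel's inequality over the standard basis shows that an orthonormal family with as many
  members as the dimension leaves no residual.
\<close>

lemma orthonormal_resolution:
  assumes o: "orthonormal I F u" and "finite F" "finite I" "card F = card I" and i: "i \<in> I"
  shows "(\<Sum>k\<in>F. cnj (u k i) * u k j) = (if i = j then 1 else 0)"
proof -
  have "(\<Sum>i\<in>I. Re (vec_inner I (resid I F u (basis_vec i)) (resid I F u (basis_vec i)))) = 0"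
    using sum_resid_basis[OF assms(1-3)] assms(4) by simp
  moreover have nn: "0 \<le> Re (vec_inner I v v)" for v unfolding vec_inner_self by (simp add: sum_nonneg)
  ultimately have "Re (vec_inner I (resid I F u (basis_vec i)) (resid I F u (basis_vec i))) = 0"
    using i assms(3) by (subst (asm) sum_nonneg_eq_0_iff) auto
  then have "vec_inner I (resid I F u (basis_vec i)) (resid I F u (basis_vec i)) = 0"
    unfolding vec_inner_self by simp
  from vec_inner_self_eq_0[OF assms(3) resid_in_vecs[OF o basis_vec_in_vecs[OF i]] this]
  have "resid I F u (basis_vec i) j = 0" by simp
  then have "(\<Sum>k\<in>F. cnj (u k i) * u k j) = basis_vec i j"
    unfolding resid_def vec_inner_basis(1)[OF assms(3) i] by simp
  then show ?thesis by (auto simp: basis_vec_def)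
qed

lemma orthonormal_expand:
  assumes "orthonormal I F u" and "finite F" "finite I" "card F = card I" and v: "v \<in> vecs I"
  shows "(\<Sum>k\<in>F. vec_inner I (u k) v * u k j) = v j"
proof -
  have "(\<Sum>k\<in>F. vec_inner I (u k) v * u k j) = (\<Sum>i\<in>I. v i * (\<Sum>k\<in>F. cnj (u k i) * u k j))"
    unfolding vec_inner_def sum_distrib_left sum_distrib_right
    by (subst sum.swap) (simp add: mult_ac)
  also have "\<dots> = (\<Sum>i\<in>I. if i = j then v j else 0)"
    by (intro sum.cong refl) (simp add: orthonormal_resolution[OF assms(1-4)])
  also have "\<dots> = v j" using assms v by (auto simp: vecs_def)
  finally show ?thesis .
qed

lemma parseval:
  assumes "orthonormal I F u" and "finite F" "finite I" "card F = card I" and v: "v \<in> vecs I"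
  shows "(\<Sum>k\<in>F. vec_inner I v (u k) * vec_inner I (u k) w) = vec_inner I v w"
proof -
  have "vec_inner I w v = vec_inner I w (\<lambda>j. \<Sum>k\<in>F. vec_inner I (u k) v * u k j)"
    using orthonormal_expand[OF assms] by presburger
  also have "\<dots> = (\<Sum>k\<in>F. vec_inner I (u k) v * vec_inner I w (u k))"
    by (rule vec_inner_sum_right)
  finally have "cnj (vec_inner I w v) = cnj (\<Sum>k\<in>F. vec_inner I (u k) v * vec_inner I w (u k))"
    by simp
  then show ?thesis by (simp add: vec_inner_cnj cnj_sum)
qed


section \<open>The spectral theorem\<close>

definition hermitian_op :: "'i op \<Rightarrow> bool" where
  "hermitian_op X \<longleftrightarrow> (\<forall>i j. X j i = cnj (X i j))"

lemma op_apply_in_vecs: "X \<in> ops I \<Longrightarrow> op_apply I X v \<in> vecs I"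
  by (auto simp: ops_def vecs_def op_apply_def)

lemma hermitian_inner:
  assumes "hermitian_op X"
  shows "vec_inner I (op_apply I X v) w = vec_inner I v (op_apply I X w)"
proof -
  have "cnj (X i j) = X j i" for i j using assms unfolding hermitian_op_def by metis
  then have "vec_inner I (op_apply I X v) w = (\<Sum>i\<in>I. \<Sum>j\<in>I. X j i * cnj (v j) * w i)"
    by (simp add: vec_inner_def op_apply_def cnj_sum sum_distrib_right mult_ac cong: sum.cong)
       (simp add: sum_distrib_left mult_ac)
  also have "\<dots> = vec_inner I v (op_apply I X w)"
    unfolding vec_inner_def op_apply_def sum_distrib_left
    by (subst sum.swap) (simp add: mult_ac)
  finally show ?thesis .
qed

text \<open>The label type may be infinite, so compactness comes from Tychonoff: the set is closed
  in a product of unit discs over I and singletons off I.\<close>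

lemma compact_unit_sphere_orth:
  assumes "finite I" "finite F"
  shows "compact {v \<in> vecs I. vec_inner I v v = 1 \<and> (\<forall>k\<in>F. vec_inner I (u k) v = 0)}" (is "compact ?S")
proof -
  let ?K = "PiE UNIV (\<lambda>i. if i \<in> I then cball 0 1 else {0 :: complex})"
  have "compactin (product_topology (\<lambda>i. euclidean) UNIV) ?K"
    unfolding compactin_PiE by auto
  then have K: "compact ?K" by (simp add: euclidean_product_topology)
  have cont: "continuous_on UNIV (\<lambda>v::'a \<Rightarrow> complex. v i)" for i by simp
  have "closed {v :: 'a \<Rightarrow> complex. \<forall>i. i \<notin> I \<longrightarrow> v i = 0}"
    by (intro closed_Collect_all closed_Collect_imp closed_Collect_eq cont continuous_on_const open_Collect_const) 
  moreover have "closed {v :: 'a \<Rightarrow> complex. vec_inner I v v = 1}"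
    unfolding vec_inner_def by (intro closed_Collect_eq continuous_intros cont)
  moreover have "closed {v :: 'a \<Rightarrow> complex. \<forall>k\<in>F. vec_inner I (u k) v = 0}"
    unfolding vec_inner_def Ball_def
    by (intro closed_Collect_all closed_Collect_imp closed_Collect_eq continuous_intros cont open_Collect_const)
  moreover have "?S = {v. \<forall>i. i \<notin> I \<longrightarrow> v i = 0} \<inter> {v. vec_inner I v v = 1} \<inter>
      {v. \<forall>k\<in>F. vec_inner I (u k) v = 0}"
    by (auto simp: vecs_def)
  ultimately have "closed ?S" by (simp add: closed_Int)
  moreover have "?S \<subseteq> ?K"
  proof
    fix v assume v: "v \<in> ?S"
    have "cmod (v i) \<le> 1" if "i \<in> I" for i
    proof -
      have "complex_of_real (\<Sum>i\<in>I. (cmod (v i))\<^sup>2) = of_real 1" using v unfolding vec_inner_self by simp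
      then have "(\<Sum>i\<in>I. (cmod (v i))\<^sup>2) = 1" unfolding of_real_eq_iff .
      moreover have "(cmod (v i))\<^sup>2 \<le> (\<Sum>i\<in>I. (cmod (v i))\<^sup>2)"
        using that assms by (intro member_le_sum) auto
      ultimately show ?thesis by (simp add: power_le_one_iff)
    qed
    then show "v \<in> ?K" using v by (auto simp: vecs_def)
  qed
  ultimately show ?thesis using compact_Int_closed[OF K, of ?S] by (simp only: inf.absorb2)
qed

text \<open>The first-order condition at a maximum: a linear term cannot stay below a quadratic one
  as t tends to 0.\<close>

lemma nonneg_quadratic_imp_linear_zero:
  fixes b c :: real
  assumes "\<And>t. 0 < t \<Longrightarrow> b * t \<le> c * t\<^sup>2" and "0 \<le> b"
  shows "b = 0"
proof (rule ccontr)
  assume "b \<noteq> 0"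
  then have b: "b > 0" using assms by simp
  \<comment> \<open>Small enough that \<open>\<bar>c\<bar> * t\<close> is at most b / 2.\<close>
  define t where "t = b / (2 * (\<bar>c\<bar> + 1))"
  have t: "t > 0" using b by (simp add: t_def)
  have "b * t \<le> c * t\<^sup>2" by (rule assms(1)[OF t])
  then have "b \<le> c * t" using t by (simp add: power2_eq_square)
  also have "\<dots> \<le> \<bar>c\<bar> * t" using t by (intro mult_right_mono) auto
  also have "\<dots> < b" using b by (simp add: t_def field_simps) (smt (verit) b mult_nonneg_nonneg abs_ge_zero)
  finally show False by simp
qed

text \<open>
  The next eigenvector maximises the quadratic form over the unit vectors orthogonal to the
  eigenvectors found so far.
\<close>

lemma next_eigenvector:
  assumes I: "finite I" and X: "X \<in> ops I" and h: "hermitian_op X"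
    and o: "orthonormal I F u" and F: "finite F" "card F < card I"
    and e: "\<And>k. k \<in> F \<Longrightarrow> op_apply I X (u k) = (\<lambda>i. complex_of_real (ev k) * u k i)"
  obtains v l where "v \<in> vecs I" "vec_inner I v v = 1" "\<And>k. k \<in> F \<Longrightarrow> vec_inner I (u k) v = 0"
    "op_apply I X v = (\<lambda>i. complex_of_real l * v i)"
proof -
  define W where "W = {v \<in> vecs I. \<forall>k\<in>F. vec_inner I (u k) v = 0}"
  define S where "S = {v \<in> vecs I. vec_inner I v v = 1 \<and> (\<forall>k\<in>F. vec_inner I (u k) v = 0)}"
  define f where "f v = Re (vec_inner I v (op_apply I X v))" for v
  have nn: "0 \<le> Re (vec_inner I v v)" for v unfolding vec_inner_self by (simp add: sum_nonneg)
  have normalise: "\<exists>c>0. Re (vec_inner I w w) = c\<^sup>2 \<and> (\<lambda>i. complex_of_real (1/c) * w i) \<in> S"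
    if w: "w \<in> W" "w \<noteq> (\<lambda>_. 0)" for w
  proof -
    have "vec_inner I w w \<noteq> 0" using vec_inner_self_eq_0[OF I] w by (auto simp: W_def)
    then have "Re (vec_inner I w w) \<noteq> 0" unfolding vec_inner_self
      by (simp only: Re_complex_of_real of_real_eq_0_iff not_False_eq_True)
    then have p: "Re (vec_inner I w w) > 0" using nn[of w] by linarith
    define c where "c = sqrt (Re (vec_inner I w w))"
    have c: "c > 0" "Re (vec_inner I w w) = c\<^sup>2" using p by (auto simp: c_def)
    have "vec_inner I w w = of_real (c\<^sup>2)" using c(2) unfolding vec_inner_self by simp
    then have "vec_inner I (\<lambda>i. complex_of_real (1/c) * w i) (\<lambda>i. complex_of_real (1/c) * w i) = 1"
      unfolding vec_inner_scale_left vec_inner_scale_right using c by (simp add: power2_eq_square)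
    moreover have "vec_inner I (u k) (\<lambda>i. complex_of_real (1/c) * w i) = 0" if "k \<in> F" for k
      unfolding vec_inner_scale_right using w that by (simp add: W_def)
    moreover have "(\<lambda>i. complex_of_real (1/c) * w i) \<in> vecs I"
      using w by (auto simp: W_def vecs_def)
    ultimately have "(\<lambda>i. complex_of_real (1/c) * w i) \<in> S"
      unfolding S_def by blast
    then show ?thesis using c by blast
  qed
  \<comment> \<open>Fewer vectors than the dimension leave a positive total residual, so W contains
    a nonzero vector and S is nonempty.\<close>
  have "\<exists>i\<in>I. resid I F u (basis_vec i) \<noteq> (\<lambda>_. 0)"
  proof (rule ccontr)
    assume "\<not> ?thesis"
    then have "(\<Sum>i\<in>I. Re (vec_inner I (resid I F u (basis_vec i)) (resid I F u (basis_vec i)))) = 0"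
      by (intro sum.neutral) simp
    then show False using sum_resid_basis[OF o F(1) I] F(2) by simp
  qed
  then obtain i where i: "i \<in> I" "resid I F u (basis_vec i) \<noteq> (\<lambda>_. 0)" by blast
  have "resid I F u (basis_vec i) \<in> W"
    using resid_orth[OF o F(1)] resid_in_vecs[OF o basis_vec_in_vecs[OF i(1)]] by (simp add: W_def)
  then have "S \<noteq> {}" using normalise i(2) by blast
  moreover have "compact S" unfolding S_def by (rule compact_unit_sphere_orth[OF I F(1)])
  moreover have "continuous_on S f"
    unfolding f_def vec_inner_def op_apply_def
    by (intro continuous_intros continuous_on_subset[OF continuous_on_product_coordinates]) auto
  ultimately obtain v where v: "v \<in> S" and vmax: "\<And>w. w \<in> S \<Longrightarrow> f w \<le> f v"
    using continuous_attains_sup[of S f] by auto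
  \<comment> \<open>The orthogonal complement of eigenvectors is invariant under a Hermitian
    operator, so the perturbation below stays in W.\<close>
  have XW: "op_apply I X w \<in> W" if "w \<in> W" for w
  proof -
    have "vec_inner I (u k) (op_apply I X w) = 0" if k: "k \<in> F" for k
      using \<open>w \<in> W\<close> k e[OF k] hermitian_inner[OF h, of I "u k" w]
      by (simp add: W_def vec_inner_scale_left)
    then show ?thesis using op_apply_in_vecs[OF X] by (simp add: W_def)
  qed
  have homog: "f (\<lambda>i. complex_of_real c * w i) = c\<^sup>2 * f w" for c w
  proof -
    have "op_apply I X (\<lambda>i. complex_of_real c * w i) = (\<lambda>i. complex_of_real c * op_apply I X w i)"
      by (simp add: op_apply_def sum_distrib_left mult_ac)
    then show ?thesis unfolding f_def by (simp add: vec_inner_scale_left vec_inner_scale_right power2_eq_square)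
  qed
  have bound: "f w \<le> f v * Re (vec_inner I w w)" if w: "w \<in> W" for w
  proof (cases "w = (\<lambda>_. 0)")
    case True then show ?thesis by (simp add: f_def)
  next
    case False
    from normalise[OF w this] obtain c where c: "c > 0" "Re (vec_inner I w w) = c\<^sup>2"
      "(\<lambda>i. complex_of_real (1/c) * w i) \<in> S" by blast
    have "(1/c)\<^sup>2 * f w \<le> f v" using vmax[OF c(3)] homog[of "1/c" w] by simp
    then have "f w \<le> f v * c\<^sup>2" using c(1) by (simp add: field_simps power2_eq_square)
    then show ?thesis using c by simp
  qed
  have vW: "v \<in> W" "v \<in> vecs I" "vec_inner I v v = 1" using v by (auto simp: S_def W_def)
  define l where "l = f v"
  \<comment> \<open>The defect of the eigenvalue equation. Moving v in the direction z changes the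
    quadratic form, net of l times the squared norm, by 2 * t * b to first order, so maximality
    forces b = 0.\<close>
  define z where "z = (\<lambda>i. op_apply I X v i - complex_of_real l * v i)"
  have zW: "z \<in> W" using XW[OF vW(1)] vW(1)
    by (auto simp: W_def z_def vecs_def vec_inner_diff_right vec_inner_scale_right)
  define b where "b = Re (vec_inner I z z)"
  have "b = 0"
  proof (rule nonneg_quadratic_imp_linear_zero[where c = "l * b - f z"])
    show "0 \<le> b" using nn by (simp add: b_def)
    fix t :: real assume t: "0 < t"
    let ?w = "\<lambda>i. v i + complex_of_real t * z i"
    have wW: "?w \<in> W" using vW zW
      by (auto simp: W_def vecs_def vec_inner_add_right vec_inner_scale_right)
    have ap: "op_apply I X ?w = (\<lambda>i. op_apply I X v i + complex_of_real t * op_apply I X z i)"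
      by (simp add: op_apply_def sum_distrib_left distrib_left sum.distrib mult_ac)
    let ?g = "vec_inner I z (op_apply I X v)"
    have g': "vec_inner I v (op_apply I X z) = cnj ?g"
      by (simp add: vec_inner_cnj hermitian_inner[OF h])
    have 1: "f ?w = f v + 2 * t * Re ?g + t\<^sup>2 * f z"
      unfolding f_def ap
      by (simp add: vec_inner_add_left vec_inner_add_right vec_inner_scale_left vec_inner_scale_right g'
          power2_eq_square algebra_simps)
    have zv: "vec_inner I v z = cnj (vec_inner I z v)" by (simp add: vec_inner_cnj)
    have 2: "Re (vec_inner I ?w ?w) = 1 + 2 * t * Re (vec_inner I z v) + t\<^sup>2 * b"
      by (simp add: vec_inner_add_left vec_inner_add_right vec_inner_scale_left vec_inner_scale_right
          vW zv b_def power2_eq_square algebra_simps)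
    have 3: "b = Re ?g - l * Re (vec_inner I z v)"
      unfolding b_def by (subst (2) z_def) (simp add: vec_inner_diff_right vec_inner_scale_right)
    have "f v + 2 * t * Re ?g + t\<^sup>2 * f z \<le> l * (1 + 2 * t * Re (vec_inner I z v) + t\<^sup>2 * b)"
      using bound[OF wW] unfolding 1 2 l_def .
    then have "2 * t * b + t\<^sup>2 * f z \<le> l * t\<^sup>2 * b"
      unfolding 3 l_def by (simp add: algebra_simps)
    then have "b * t * 2 \<le> (l * b - f z) * t\<^sup>2" by (simp add: algebra_simps)
    moreover have "0 \<le> b * t" using t nn by (simp add: b_def)
    ultimately show "b * t \<le> (l * b - f z) * t\<^sup>2" by linarith
  qed
  then have "vec_inner I z z = 0" unfolding b_def vec_inner_self by simp
  then have "z = (\<lambda>_. 0)" using vec_inner_self_eq_0[OF I] zW by (auto simp: W_def)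
  then have "op_apply I X v = (\<lambda>i. complex_of_real l * v i)"
    by (auto simp: z_def fun_eq_iff)
  then show ?thesis using that[of v l] vW by (auto simp: W_def)
qed

lemma eigenvectors_exist:
  assumes I: "finite I" and X: "X \<in> ops I" and h: "hermitian_op X" and "n \<le> card I"
  shows "\<exists>u ev. orthonormal I {..<n} u \<and>
     (\<forall>k<n. op_apply I X (u k) = (\<lambda>i. complex_of_real (ev k) * u k i))"
  using assms(4)
proof (induction n)
  case 0
  then show ?case by (auto simp: orthonormal_def)
next
  case (Suc n)
  then obtain u ev where u: "orthonormal I {..<n} u"
    "\<And>k. k \<in> {..<n} \<Longrightarrow> op_apply I X (u k) = (\<lambda>i. complex_of_real (ev k) * u k i)" by auto
  obtain v l where v: "v \<in> vecs I" "vec_inner I v v = 1" "\<And>k. k \<in> {..<n} \<Longrightarrow> vec_inner I (u k) v = 0"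
    "op_apply I X v = (\<lambda>i. complex_of_real l * v i)"
    using next_eigenvector[OF I X h u(1) _ _ u(2)] Suc.prems by (metis card_lessThan finite_lessThan Suc_le_eq)
  have v': "vec_inner I v (u k) = 0" if "k < n" for k
    using v(3)[of k] that vec_inner_cnj[of I "u k" v] by simp
  have "orthonormal I {..<Suc n} (u(n := v))"
    using u(1) v v' by (auto simp: orthonormal_def less_Suc_eq)
  moreover have "\<forall>k<Suc n. op_apply I X ((u(n := v)) k) = (\<lambda>i. complex_of_real ((ev(n := l)) k) * (u(n := v)) k i)"
    using u(2) v(4) by (auto simp: less_Suc_eq)
  ultimately show ?case by blast
qed

lemma spectral_decomp_orthonormal: "spectral_decomp I X ev u \<Longrightarrow> orthonormal I I u"
  by (auto simp: spectral_decomp_def orthonormal_def)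

text \<open>The eigenvectors found one by one are numbered, whereas \<open>spectral_decomp\<close>
  indexes them by the labels themselves; a bijection h transports the family. The entries of X are
  then read off by expanding standard basis vectors.\<close>

theorem spectral_decomp_exists:
  assumes I: "finite I" and X: "X \<in> ops I" and h: "hermitian_op X"
  shows "\<exists>ev u. spectral_decomp I X ev u"
proof -
  from eigenvectors_exist[OF I X h order_refl] obtain u ev where
    u: "orthonormal I {..<card I} u" "\<And>k. k < card I \<Longrightarrow> op_apply I X (u k) = (\<lambda>i. complex_of_real (ev k) * u k i)"
    by auto
  obtain h where h: "bij_betw h I {..<card I}"
    using I by (metis bij_betw_iff_card card_lessThan finite_lessThan)
  define u' where "u' = u \<circ> h"
  define ev' where "ev' = ev \<circ> h"
  have hI: "h k < card I" if "k \<in> I" for k using h that by (auto simp: bij_betw_def)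
  have inj: "h k = h l \<longleftrightarrow> k = l" if "k \<in> I" "l \<in> I" for k l
    using h that by (auto simp: bij_betw_def inj_on_def)
  have o: "orthonormal I I u'"
    using u(1) hI inj by (auto simp: orthonormal_def u'_def)
  have "X i j = (\<Sum>k\<in>I. complex_of_real (ev' k) * u' k i * cnj (u' k j))" for i j
  proof (cases "j \<in> I")
    case True
    have "X i j = op_apply I X (basis_vec j) i"
      using True I by (simp add: op_apply_def basis_vec_def if_distrib cong: if_cong)
    also have "\<dots> = (\<Sum>m\<in>I. X i m * (\<Sum>k\<in>I. vec_inner I (u' k) (basis_vec j) * u' k m))"
      using orthonormal_expand[OF o I I refl basis_vec_in_vecs[OF True]] by (simp add: op_apply_def)
    also have "\<dots> = (\<Sum>k\<in>I. cnj (u' k j) * op_apply I X (u' k) i)"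
      unfolding op_apply_def sum_distrib_left by (subst sum.swap) (simp add: mult_ac vec_inner_basis I True)
    also have "\<dots> = (\<Sum>k\<in>I. complex_of_real (ev' k) * u' k i * cnj (u' k j))"
      by (intro sum.cong refl) (simp add: u'_def ev'_def u(2) hI)
    finally show ?thesis .
  next
    case False
    then have "\<And>k. k \<in> I \<Longrightarrow> u' k j = 0" using o by (auto simp: orthonormal_def vecs_def)
    then show ?thesis using False X by (auto simp: ops_def)
  qed
  then have "spectral_decomp I X ev' u'"
    using o by (auto simp: spectral_decomp_def orthonormal_def)
  then show ?thesis by blast
qed


section \<open>Spectral calculus\<close>

lemma op_apply_rank_one_sum:
  "op_apply I (\<lambda>i j. \<Sum>k\<in>K. c k * u k i * cnj (u k j)) v = (\<lambda>i. \<Sum>k\<in>K. c k * vec_inner I (u k) v * u k i)"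
proof
  fix i
  show "op_apply I (\<lambda>i j. \<Sum>k\<in>K. c k * u k i * cnj (u k j)) v i = (\<Sum>k\<in>K. c k * vec_inner I (u k) v * u k i)"
    unfolding op_apply_def vec_inner_def sum_distrib_left sum_distrib_right
    by (subst sum.swap) (simp add: mult_ac)
qed

lemma spectral_decomp_apply:
  assumes "spectral_decomp I X ev u"
  shows "op_apply I X v = (\<lambda>i. \<Sum>k\<in>I. complex_of_real (ev k) * vec_inner I (u k) v * u k i)"
proof -
  have "X = (\<lambda>i j. \<Sum>k\<in>I. complex_of_real (ev k) * u k i * cnj (u k j))"
    using assms by (simp add: spectral_decomp_def)
  then show ?thesis by (simp add: op_apply_rank_one_sum)
qed

lemma spectral_decomp_inner_apply:
  assumes "spectral_decomp I X ev u" "finite I" "k \<in> I"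
  shows "vec_inner I (u k) (op_apply I X v) = complex_of_real (ev k) * vec_inner I (u k) v"
proof -
  have "vec_inner I (u k) (op_apply I X v)
      = (\<Sum>l\<in>I. complex_of_real (ev l) * vec_inner I (u l) v * vec_inner I (u k) (u l))"
    unfolding spectral_decomp_apply[OF assms(1)] vec_inner_sum_right ..
  also have "\<dots> = (\<Sum>l\<in>I. if l = k then complex_of_real (ev k) * vec_inner I (u k) v else 0)"
    using assms(1,3) by (intro sum.cong refl) (simp add: spectral_decomp_def)
  finally show ?thesis using assms by simp
qed

lemma spectral_decomp_eigen:
  assumes "spectral_decomp I X ev u" "finite I" "k \<in> I"
  shows "op_apply I X (u k) = (\<lambda>i. complex_of_real (ev k) * u k i)"
proof
  fix i
  have "op_apply I X (u k) i = (\<Sum>l\<in>I. complex_of_real (ev l) * vec_inner I (u l) (u k) * u l i)"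
    unfolding spectral_decomp_apply[OF assms(1)] ..
  also have "\<dots> = (\<Sum>l\<in>I. if l = k then complex_of_real (ev k) * u k i else 0)"
    using assms(1,3) by (intro sum.cong refl) (simp add: spectral_decomp_def)
  finally show "op_apply I X (u k) i = complex_of_real (ev k) * u k i" using assms by simp
qed

text \<open>If eigenvectors from the two decompositions overlap, their eigenvalues agree, and so do
  the values of f. Expanding one basis in the other then changes \<open>f (ev k)\<close> into
  \<open>f (ev' l)\<close> termwise. This makes the choice in \<open>op_fun\<close>
  harmless.\<close>

lemma spectral_fun_unique:
  assumes 1: "spectral_decomp I X ev u" and 2: "spectral_decomp I X ev' u'" and I: "finite I"
  shows "(\<Sum>k\<in>I. complex_of_real (f (ev k)) * u k i * cnj (u k j))
       = (\<Sum>k\<in>I. complex_of_real (f (ev' k)) * u' k i * cnj (u' k j))"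
proof -
  note o = spectral_decomp_orthonormal[OF 1] and o' = spectral_decomp_orthonormal[OF 2]
  have uv: "u k \<in> vecs I" "u' k \<in> vecs I" if "k \<in> I" for k
    using 1 2 that by (auto simp: spectral_decomp_def)
  have ov: "complex_of_real (f (ev k)) * vec_inner I (u' l) (u k) = complex_of_real (f (ev' l)) * vec_inner I (u' l) (u k)"
    if "k \<in> I" "l \<in> I" for k l
  proof -
    have "complex_of_real (ev k) * vec_inner I (u' l) (u k) = vec_inner I (u' l) (op_apply I X (u k))"
      unfolding spectral_decomp_eigen[OF 1 I that(1)] vec_inner_scale_right ..
    also have "\<dots> = complex_of_real (ev' l) * vec_inner I (u' l) (u k)"
      by (rule spectral_decomp_inner_apply[OF 2 I that(2)])
    finally show ?thesis by auto
  qed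
  have "(\<Sum>k\<in>I. complex_of_real (f (ev k)) * u k i * cnj (u k j))
    = (\<Sum>k\<in>I. \<Sum>l\<in>I. complex_of_real (f (ev k)) * vec_inner I (u' l) (u k) * u' l i * cnj (u k j))"
  proof (intro sum.cong refl)
    fix k assume k: "k \<in> I"
    have "u k i = (\<Sum>l\<in>I. vec_inner I (u' l) (u k) * u' l i)"
      using orthonormal_expand[OF o' I I refl uv(1)[OF k]] by simp
    then show "complex_of_real (f (ev k)) * u k i * cnj (u k j)
      = (\<Sum>l\<in>I. complex_of_real (f (ev k)) * vec_inner I (u' l) (u k) * u' l i * cnj (u k j))"
      by (simp add: sum_distrib_left sum_distrib_right mult_ac)
  qed
  also have "\<dots> = (\<Sum>k\<in>I. \<Sum>l\<in>I. complex_of_real (f (ev' l)) * vec_inner I (u' l) (u k) * u' l i * cnj (u k j))"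
    by (intro sum.cong refl) (simp add: ov)
  also have "\<dots> = (\<Sum>l\<in>I. complex_of_real (f (ev' l)) * u' l i * cnj (\<Sum>k\<in>I. vec_inner I (u k) (u' l) * u k j))"
    by (subst sum.swap) (simp add: cnj_sum vec_inner_cnj sum_distrib_left mult_ac)
  also have "\<dots> = (\<Sum>l\<in>I. complex_of_real (f (ev' l)) * u' l i * cnj (u' l j))"
    by (intro sum.cong refl) (simp add: orthonormal_expand[OF o I I refl uv(2)])
  finally show ?thesis .
qed

lemma op_fun_eq:
  assumes "spectral_decomp I X ev u" "finite I"
  shows "op_fun I f X = (\<lambda>i j. \<Sum>k\<in>I. complex_of_real (f (ev k)) * u k i * cnj (u k j))"
proof -
  let ?P = "\<lambda>Y. \<exists>ev u. spectral_decomp I X ev u \<and>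
     Y = (\<lambda>i j. \<Sum>k\<in>I. complex_of_real (f (ev k)) * u k i * cnj (u k j))"
  have "?P (op_fun I f X)"
    unfolding op_fun_def by (rule someI[of ?P]) (use assms in blast)
  then obtain ev' u' where "spectral_decomp I X ev' u'"
    "op_fun I f X = (\<lambda>i j. \<Sum>k\<in>I. complex_of_real (f (ev' k)) * u' k i * cnj (u' k j))" by blast
  then show ?thesis using spectral_fun_unique[OF assms(1) _ assms(2)] by (simp add: fun_eq_iff)
qed

section \<open>Positive operators as Gram matrices\<close>

lemma psd_ops: "psd I X \<Longrightarrow> X \<in> ops I"
  unfolding psd_def by blast

lemma psd_hermitian: "psd I X \<Longrightarrow> hermitian_op X"
  unfolding psd_def hermitian_op_def by blast

lemma psd_nonneg: "psd I X \<Longrightarrow> v \<in> vecs I \<Longrightarrow> 0 \<le> Re (vec_inner I v (op_apply I X v))"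
  unfolding psd_def by blast

lemma psd_spectral:
  assumes "psd I X" "finite I"
  obtains ev u where "spectral_decomp I X ev u" "\<And>k. k \<in> I \<Longrightarrow> 0 \<le> ev k"
proof -
  obtain ev u where s: "spectral_decomp I X ev u"
    using spectral_decomp_exists[OF assms(2) psd_ops[OF assms(1)] psd_hermitian[OF assms(1)]] by blast
  have "0 \<le> ev k" if k: "k \<in> I" for k
  proof -
    have "0 \<le> Re (vec_inner I (u k) (op_apply I X (u k)))"
      using psd_nonneg[OF assms(1)] s k unfolding spectral_decomp_def by blast
    also have "vec_inner I (u k) (op_apply I X (u k)) = complex_of_real (ev k)"
      using spectral_decomp_inner_apply[OF s assms(2) k, of "u k"] s k by (simp add: spectral_decomp_def)
    finally show ?thesis by simp
  qed
  then show ?thesis using that s by blast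
qed

lemma gram_psd:
  assumes "\<And>k. k \<in> K \<Longrightarrow> v k \<in> vecs I"
  shows "psd I (\<lambda>i j. \<Sum>k\<in>K. v k i * cnj (v k j))"
proof -
  have "0 \<le> Re (vec_inner I x (op_apply I (\<lambda>i j. \<Sum>k\<in>K. v k i * cnj (v k j)) x))" for x
  proof -
    have "vec_inner I x (op_apply I (\<lambda>i j. \<Sum>k\<in>K. v k i * cnj (v k j)) x)
      = (\<Sum>k\<in>K. vec_inner I (v k) x * vec_inner I x (v k))"
      using op_apply_rank_one_sum[where c = "\<lambda>_. 1" and I = I and u = v and v = x and K = K] by (simp add: vec_inner_sum_right)
    also have "\<dots> = (\<Sum>k\<in>K. complex_of_real ((cmod (vec_inner I (v k) x))\<^sup>2))"
      by (intro sum.cong refl) (metis complex_norm_square vec_inner_cnj)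
    finally show ?thesis by (simp add: sum_nonneg)
  qed
  moreover have "(\<lambda>i j. \<Sum>k\<in>K. v k i * cnj (v k j)) \<in> ops I"
    using assms by (auto simp: ops_def vecs_def intro!: sum.neutral)
  ultimately show ?thesis by (simp add: psd_def cnj_sum mult.commute)
qed

text \<open>Scale each eigenvector by the square root of its eigenvalue. Together with
  \<open>gram_psd\<close> this is the working form of positivity: Gram vectors can be pulled back,
  multiplied and summed freely.\<close>

lemma psd_gram:
  assumes "psd I X" "finite I"
  obtains v where "\<And>k. k \<in> I \<Longrightarrow> v k \<in> vecs I" "X = (\<lambda>i j. \<Sum>k\<in>I. v k i * cnj (v k j))"
proof -
  obtain ev u where s: "spectral_decomp I X ev u" and p: "\<And>k. k \<in> I \<Longrightarrow> 0 \<le> ev k"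
    using psd_spectral[OF assms] by blast
  define v where "v = (\<lambda>k i. complex_of_real (sqrt (ev k)) * u k i)"
  have "v k \<in> vecs I" if "k \<in> I" for k
    using s that by (auto simp: spectral_decomp_def v_def vecs_def)
  moreover have "X = (\<lambda>i j. \<Sum>k\<in>I. v k i * cnj (v k j))"
  proof -
    have "v k i * cnj (v k j) = complex_of_real (ev k) * u k i * cnj (u k j)" if "k \<in> I" for k i j
    proof -
      have "complex_of_real (sqrt (ev k)) * complex_of_real (sqrt (ev k)) = complex_of_real (ev k)"
        using p[OF that] by (metis of_real_mult real_sqrt_mult_self abs_of_nonneg)
      moreover have "v k i * cnj (v k j)
        = complex_of_real (sqrt (ev k)) * complex_of_real (sqrt (ev k)) * u k i * cnj (u k j)"
        by (simp add: v_def mult_ac)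
      ultimately show ?thesis by metis
    qed
    then show ?thesis using s by (simp add: spectral_decomp_def)
  qed
  ultimately show ?thesis using that by blast
qed

section \<open>Supports and relative entropy in terms of overlaps of eigenbases\<close>

lemma vec_inner_mult_swap: "vec_inner I v w * vec_inner I w v = complex_of_real ((cmod (vec_inner I v w))\<^sup>2)"
  by (metis complex_norm_square vec_inner_cnj)

lemma op_trace_mult_rank_one_sums:
  assumes "finite I"
  shows "op_trace I (op_mult I (\<lambda>i j. \<Sum>k\<in>K. a k * u k i * cnj (u k j)) (\<lambda>i j. \<Sum>l\<in>L. b l * w l i * cnj (w l j)))
    = (\<Sum>k\<in>K. \<Sum>l\<in>L. a k * b l * complex_of_real ((cmod (vec_inner I (w l) (u k)))\<^sup>2))"
proof -
  have "op_trace I (op_mult I (\<lambda>i j. \<Sum>k\<in>K. a k * u k i * cnj (u k j)) (\<lambda>i j. \<Sum>l\<in>L. b l * w l i * cnj (w l j)))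
    = (\<Sum>i\<in>I. \<Sum>j\<in>I. \<Sum>k\<in>K. \<Sum>l\<in>L. a k * b l * (cnj (w l i) * u k i) * (cnj (u k j) * w l j))"
    unfolding op_trace_def op_mult_def sum_distrib_left sum_distrib_right
    by (subst (3) sum.swap) (simp add: mult_ac)
  also have "\<dots> = (\<Sum>k\<in>K. \<Sum>l\<in>L. \<Sum>i\<in>I. \<Sum>j\<in>I. a k * b l * (cnj (w l i) * u k i) * (cnj (u k j) * w l j))"
    by (simp only: sum.swap[of _ I K] sum.swap[of _ I L])
  also have "\<dots> = (\<Sum>k\<in>K. \<Sum>l\<in>L. a k * b l * (vec_inner I (w l) (u k) * vec_inner I (u k) (w l)))"
    unfolding vec_inner_def unfolding sum_product unfolding sum_distrib_left by (simp add: mult_ac)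
  also have "\<dots> = (\<Sum>k\<in>K. \<Sum>l\<in>L. a k * b l * complex_of_real ((cmod (vec_inner I (w l) (u k)))\<^sup>2))"
    unfolding vec_inner_mult_swap ..
  finally show ?thesis .
qed

lemma op_supp_spectral:
  assumes s: "spectral_decomp I X ev u" and I: "finite I"
  shows "op_supp I X = {v \<in> vecs I. \<forall>k\<in>I. ev k = 0 \<longrightarrow> vec_inner I (u k) v = 0}"
proof -
  note o = spectral_decomp_orthonormal[OF s]
  have uv: "u k \<in> vecs I" if "k \<in> I" for k using s that by (auto simp: spectral_decomp_def)
  have "(\<forall>w\<in>vecs I. op_apply I X w = (\<lambda>_. 0) \<longrightarrow> vec_inner I w v = 0)
    \<longleftrightarrow> (\<forall>k\<in>I. ev k = 0 \<longrightarrow> vec_inner I (u k) v = 0)" (is "?L \<longleftrightarrow> ?R") if v: "v \<in> vecs I" for v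
  proof
    assume ?L
    then show ?R using spectral_decomp_eigen[OF s I] uv by simp
  next
    assume R: ?R
    show ?L
    proof (intro ballI impI)
      fix w assume w: "w \<in> vecs I" "op_apply I X w = (\<lambda>_. 0)"
      have "vec_inner I w (u k) * vec_inner I (u k) v = 0" if k: "k \<in> I" for k
      proof -
        have "complex_of_real (ev k) * vec_inner I (u k) w = 0"
          using spectral_decomp_inner_apply[OF s I k, of w] w by simp
        then show ?thesis using R k vec_inner_cnj[of I "u k" w] by auto
      qed
      then have "(\<Sum>k\<in>I. vec_inner I w (u k) * vec_inner I (u k) v) = 0" by (intro sum.neutral) blast
      then show "vec_inner I w v = 0" using parseval[OF o I I refl w(1), of v] by simp
    qed
  qed
  then show ?thesis unfolding op_supp_def by auto
qed

text \<open>The support of \<rho> is spanned by its eigenvectors with nonzero eigenvalue and that of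
  \<sigma> is the orthogonal complement of its kernel eigenvectors, so inclusion is a condition on
  finitely many inner products.\<close>

lemma op_supp_subset_spectral:
  assumes s: "spectral_decomp I \<rho> p u" and t: "spectral_decomp I \<sigma> q w" and I: "finite I"
  shows "op_supp I \<rho> \<subseteq> op_supp I \<sigma> \<longleftrightarrow>
    (\<forall>k\<in>I. \<forall>l\<in>I. p k \<noteq> 0 \<and> q l = 0 \<longrightarrow> vec_inner I (w l) (u k) = 0)" (is "?L \<longleftrightarrow> ?R")
proof
  have uv: "u k \<in> vecs I" if "k \<in> I" for k using s that by (auto simp: spectral_decomp_def)
  assume L: ?L
  show ?R
  proof (intro ballI impI)
    fix k l assume kl: "k \<in> I" "l \<in> I" "p k \<noteq> 0 \<and> q l = 0"
    have "u k \<in> op_supp I \<rho>"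
      using s kl uv unfolding op_supp_spectral[OF s I] by (auto simp: spectral_decomp_def)
    then show "vec_inner I (w l) (u k) = 0" using L kl unfolding op_supp_spectral[OF t I] by auto
  qed
next
  note o = spectral_decomp_orthonormal[OF s]
  have wv: "w k \<in> vecs I" if "k \<in> I" for k using t that by (auto simp: spectral_decomp_def)
  assume R: ?R
  show ?L
  proof
    fix v assume v: "v \<in> op_supp I \<rho>"
    have "vec_inner I (w l) v = 0" if l: "l \<in> I" "q l = 0" for l
    proof -
      have "vec_inner I (w l) v = (\<Sum>k\<in>I. vec_inner I (w l) (u k) * vec_inner I (u k) v)"
        using parseval[OF o I I refl wv[OF l(1)], of v] by simp
      also have "\<dots> = 0"
        using R v l unfolding op_supp_spectral[OF s I] by (intro sum.neutral) auto
      finally show ?thesis .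
    qed
    then show "v \<in> op_supp I \<sigma>" using v unfolding op_supp_spectral[OF s I] op_supp_spectral[OF t I] by auto
  qed
qed

text \<open>The first Nussbaum-Szkola distribution of a pair of states. The second operator enters
  only through its eigenbasis w.\<close>

definition overlap :: "'i set \<Rightarrow> ('i \<Rightarrow> real) \<Rightarrow> ('i \<Rightarrow> 'i \<Rightarrow> complex) \<Rightarrow> ('i \<Rightarrow> 'i \<Rightarrow> complex) \<Rightarrow> 'i \<Rightarrow> 'i \<Rightarrow> real" where
  "overlap I p u w k l = p k * (cmod (vec_inner I (w l) (u k)))\<^sup>2"

lemma parseval_norm:
  assumes "orthonormal I I w" "finite I" "v \<in> vecs I"
  shows "(\<Sum>l\<in>I. (cmod (vec_inner I (w l) v))\<^sup>2) = Re (vec_inner I v v)"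
proof -
  have "(\<Sum>l\<in>I. complex_of_real ((cmod (vec_inner I (w l) v))\<^sup>2)) = (\<Sum>l\<in>I. vec_inner I v (w l) * vec_inner I (w l) v)"
    by (intro sum.cong refl) (metis vec_inner_mult_swap mult.commute)
  also have "\<dots> = vec_inner I v v" by (rule parseval[OF assms(1,2,2) refl assms(3)])
  finally have "complex_of_real (\<Sum>l\<in>I. (cmod (vec_inner I (w l) v))\<^sup>2) = vec_inner I v v"
    unfolding of_real_sum .
  then show ?thesis by (metis Re_complex_of_real)
qed

lemma overlap_sum:
  assumes "spectral_decomp I \<rho> p u" "spectral_decomp I \<sigma> q w" "finite I" "k \<in> I"
  shows "(\<Sum>l\<in>I. overlap I p u w k l) = p k"
proof -
  have "(\<Sum>l\<in>I. (cmod (vec_inner I (w l) (u k)))\<^sup>2) = Re (vec_inner I (u k) (u k))"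
    using assms by (intro parseval_norm) (auto simp: spectral_decomp_def orthonormal_def)
  then show ?thesis using assms(1,4) by (simp add: overlap_def spectral_decomp_def flip: sum_distrib_left)
qed

text \<open>The value at 0 follows the convention of \<open>op_log\<close>, zero on the
  kernel.\<close>

definition lg :: "real \<Rightarrow> real" where "lg x = (if x = 0 then 0 else log 2 x)"

lemma rel_entropy_spectral:
  assumes s: "spectral_decomp I \<rho> p u" and t: "spectral_decomp I \<sigma> q w" and I: "finite I"
  shows "rel_entropy I \<rho> \<sigma> =
    (if \<forall>k\<in>I. \<forall>l\<in>I. p k \<noteq> 0 \<and> q l = 0 \<longrightarrow> vec_inner I (w l) (u k) = 0
     then ereal (\<Sum>k\<in>I. \<Sum>l\<in>I. overlap I p u w k l * (lg (p k) - lg (q l))) else \<infinity>)"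
proof -
  have lin: "op_trace I (op_mult I A (\<lambda>i j. B i j - C i j)) = op_trace I (op_mult I A B) - op_trace I (op_mult I A C)" for A B C
    by (simp add: op_trace_def op_mult_def right_diff_distrib sum_subtractf)
  have r: "\<rho> = (\<lambda>i j. \<Sum>k\<in>I. complex_of_real (p k) * u k i * cnj (u k j))"
    using s by (simp add: spectral_decomp_def)
  have lgr: "op_log I X = (\<lambda>i j. \<Sum>k\<in>I. complex_of_real (lg (ev k)) * v k i * cnj (v k j))"
    if "spectral_decomp I X ev v" for X ev v
    unfolding op_log_def op_fun_eq[OF that I] lg_def ..
  have T: "Re (op_trace I (op_mult I \<rho> (op_log I X))) = (\<Sum>k\<in>I. \<Sum>l\<in>I. overlap I p u v k l * lg (ev l))"
    if "spectral_decomp I X ev v" for X ev v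
    unfolding lgr[OF that]
    by (subst r, subst op_trace_mult_rank_one_sums[OF I]) (simp add: overlap_def mult_ac)
  \<comment> \<open>For the logarithm of \<rho> the second basis is u itself, so the overlaps are
    diagonal. \<open>overlap_sum\<close> respreads \<open>p k\<close> over the basis w, which puts
    both logarithms under the same weights.\<close>
  have "(\<Sum>k\<in>I. \<Sum>l\<in>I. overlap I p u u k l * lg (p l)) = (\<Sum>k\<in>I. p k * lg (p k))"
  proof (intro sum.cong refl)
    fix k assume k: "k \<in> I"
    have "(\<Sum>l\<in>I. overlap I p u u k l * lg (p l)) = (\<Sum>l\<in>I. if l = k then p k * lg (p k) else 0)"
      using s k by (intro sum.cong refl) (auto simp: spectral_decomp_def overlap_def)
    then show "(\<Sum>l\<in>I. overlap I p u u k l * lg (p l)) = p k * lg (p k)" using k I by simp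
  qed
  also have "\<dots> = (\<Sum>k\<in>I. \<Sum>l\<in>I. overlap I p u w k l * lg (p k))"
    by (simp add: overlap_sum[OF s t I] flip: sum_distrib_right)
  finally have "Re (op_trace I (op_mult I \<rho> (\<lambda>i j. op_log I \<rho> i j - op_log I \<sigma> i j)))
     = (\<Sum>k\<in>I. \<Sum>l\<in>I. overlap I p u w k l * (lg (p k) - lg (q l)))"
    by (simp add: lin T[OF s] T[OF t] right_diff_distrib sum_subtractf)
  then show ?thesis unfolding rel_entropy_def op_supp_subset_spectral[OF s t I] by (simp only:)
qed


section \<open>Tensor products\<close>

text \<open>
  A system J is regarded as the composite of I and I' by means of the two coordinate maps a and b.
\<close>

definition splits :: "'j set \<Rightarrow> ('j \<Rightarrow> 'i) \<Rightarrow> ('j \<Rightarrow> 'k) \<Rightarrow> 'i set \<Rightarrow> 'k set \<Rightarrow> bool" where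
  "splits J a b I I' \<longleftrightarrow> bij_betw (\<lambda>z. (a z, b z)) J (I \<times> I')"

definition tens :: "'j set \<Rightarrow> ('j \<Rightarrow> 'i) \<Rightarrow> ('j \<Rightarrow> 'k) \<Rightarrow> 'i op \<Rightarrow> 'k op \<Rightarrow> 'j op" where
  "tens J a b X Y = op_restrict J (\<lambda>z z'. X (a z) (a z') * Y (b z) (b z'))"

definition tens_vec :: "'j set \<Rightarrow> ('j \<Rightarrow> 'i) \<Rightarrow> ('j \<Rightarrow> 'k) \<Rightarrow> ('i \<Rightarrow> complex) \<Rightarrow> ('k \<Rightarrow> complex) \<Rightarrow> 'j \<Rightarrow> complex" where
  "tens_vec J a b v w = (\<lambda>z. if z \<in> J then v (a z) * w (b z) else 0)"

lemma splits_mem: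
  assumes "splits J a b I I'" "z \<in> J"
  shows "a z \<in> I" "b z \<in> I'"
  using bij_betwE[OF assms(1)[unfolded splits_def]] assms(2) by auto

lemma splits_eq_iff:
  assumes "splits J a b I I'" "z \<in> J" "z' \<in> J"
  shows "z = z' \<longleftrightarrow> a z = a z' \<and> b z = b z'"
  using assms unfolding splits_def bij_betw_def inj_on_def by auto

lemma sum_splits:
  assumes "splits J a b I I'"
  shows "(\<Sum>z\<in>J. F (a z) (b z)) = (\<Sum>x\<in>I. \<Sum>y\<in>I'. F x y)"
proof -
  have "(\<Sum>z\<in>J. case (a z, b z) of (x, y) \<Rightarrow> F x y) = (\<Sum>(x, y)\<in>I \<times> I'. F x y)"
    using assms unfolding splits_def by (rule sum.reindex_bij_betw)
  then show ?thesis by (simp add: sum.cartesian_product)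
qed

lemma sum_splits_mult:
  fixes f :: "_ \<Rightarrow> 'z :: comm_semiring_0"
  assumes "splits J a b I I'"
  shows "(\<Sum>z\<in>J. f (a z) * g (b z)) = sum f I * sum g I'"
  using sum_splits[OF assms, of "\<lambda>x y. f x * g y"] by (simp add: sum_product)

lemma splits_finite:
  assumes "splits J a b I I'" "finite I" "finite I'"
  shows "finite J"
  using assms unfolding splits_def by (metis bij_betw_finite finite_cartesian_product)

lemma vec_inner_tens:
  assumes "splits J a b I I'"
  shows "vec_inner J (tens_vec J a b v w) (tens_vec J a b v' w') = vec_inner I v v' * vec_inner I' w w'"
proof -
  have "vec_inner J (tens_vec J a b v w) (tens_vec J a b v' w')
    = (\<Sum>z\<in>J. (cnj (v (a z)) * v' (a z)) * (cnj (w (b z)) * w' (b z)))"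
    unfolding vec_inner_def by (intro sum.cong refl) (simp add: tens_vec_def)
  then show ?thesis
    using sum_splits_mult[OF assms, of "\<lambda>x. cnj (v x) * v' x" "\<lambda>y. cnj (w y) * w' y"]
    by (simp add: vec_inner_def)
qed

lemma spectral_decomp_tens:
  assumes sp: "splits J a b I I'" and s: "spectral_decomp I X ev u" and t: "spectral_decomp I' Y ev' u'"
  shows "spectral_decomp J (tens J a b X Y) (\<lambda>k. ev (a k) * ev' (b k)) (\<lambda>k. tens_vec J a b (u (a k)) (u' (b k)))"
proof -
  have X: "X = (\<lambda>i j. \<Sum>k\<in>I. complex_of_real (ev k) * u k i * cnj (u k j))"
    using s by (simp add: spectral_decomp_def)
  have Y: "Y = (\<lambda>i j. \<Sum>k\<in>I'. complex_of_real (ev' k) * u' k i * cnj (u' k j))"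
    using t by (simp add: spectral_decomp_def)
  have "tens J a b X Y z z' = (\<Sum>k\<in>J. complex_of_real (ev (a k) * ev' (b k)) *
      tens_vec J a b (u (a k)) (u' (b k)) z * cnj (tens_vec J a b (u (a k)) (u' (b k)) z'))" for z z'
  proof (cases "z \<in> J \<and> z' \<in> J")
    case True
    have "(\<Sum>k\<in>J. complex_of_real (ev (a k) * ev' (b k)) *
      tens_vec J a b (u (a k)) (u' (b k)) z * cnj (tens_vec J a b (u (a k)) (u' (b k)) z'))
      = (\<Sum>k\<in>J. (complex_of_real (ev (a k)) * u (a k) (a z) * cnj (u (a k) (a z'))) *
          (complex_of_real (ev' (b k)) * u' (b k) (b z) * cnj (u' (b k) (b z'))))"
      using True by (simp add: tens_vec_def mult_ac)
    also have "\<dots> = X (a z) (a z') * Y (b z) (b z')"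
      unfolding X Y
      by (rule sum_splits_mult[OF sp, of "\<lambda>k. complex_of_real (ev k) * u k (a z) * cnj (u k (a z'))"
            "\<lambda>k. complex_of_real (ev' k) * u' k (b z) * cnj (u' k (b z'))"])
    finally show ?thesis using True by (simp add: tens_def op_restrict_def)
  next
    case False
    then show ?thesis by (auto simp: tens_def op_restrict_def tens_vec_def)
  qed
  moreover have "vec_inner J (tens_vec J a b (u (a k)) (u' (b k))) (tens_vec J a b (u (a l)) (u' (b l)))
      = (if k = l then 1 else 0)" if "k \<in> J" "l \<in> J" for k l
    unfolding vec_inner_tens[OF sp]
    using s t splits_mem[OF sp that(1)] splits_mem[OF sp that(2)] splits_eq_iff[OF sp that]
    by (auto simp: spectral_decomp_def)
  ultimately show ?thesis by (auto simp: spectral_decomp_def vecs_def tens_vec_def fun_eq_iff)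
qed

lemma overlap_tens:
  assumes "splits J a b I I'"
  shows "overlap J (\<lambda>k. p (a k) * p' (b k)) (\<lambda>k. tens_vec J a b (u (a k)) (u' (b k)))
      (\<lambda>k. tens_vec J a b (w (a k)) (w' (b k))) k l
    = overlap I p u w (a k) (a l) * overlap I' p' u' w' (b k) (b l)"
  unfolding overlap_def vec_inner_tens[OF assms] by (simp add: norm_mult power_mult_distrib)


section \<open>Moments of the logarithmic eigenvalues\<close>

text \<open>No normalisation is built in; total mass one is expressed as
  \<open>avg J P (\<lambda>_ _. 1) = 1\<close>.\<close>

definition avg :: "'i set \<Rightarrow> ('i \<Rightarrow> 'i \<Rightarrow> real) \<Rightarrow> ('i \<Rightarrow> 'i \<Rightarrow> real) \<Rightarrow> real" where
  "avg J P h = (\<Sum>k\<in>J. \<Sum>l\<in>J. P k l * h k l)"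

lemma avg_add: "avg J P (\<lambda>k l. h k l + h' k l) = avg J P h + avg J P h'"
  by (simp add: avg_def distrib_left sum.distrib)

lemma avg_diff: "avg J P (\<lambda>k l. h k l - h' k l) = avg J P h - avg J P h'"
  by (simp add: avg_def right_diff_distrib sum_subtractf)

lemma avg_cmult: "avg J P (\<lambda>k l. c * h k l) = c * avg J P h"
  by (simp add: avg_def sum_distrib_left mult_ac)

lemma avg_mono:
  assumes "\<And>k l. k \<in> J \<Longrightarrow> l \<in> J \<Longrightarrow> P k l * h k l \<le> P k l * h' k l"
  shows "avg J P h \<le> avg J P h'"
  unfolding avg_def by (intro sum_mono assms)

lemma avg_tens:
  assumes sp: "splits J a b I I'" and P: "\<And>k l. P k l = P1 (a k) (a l) * P2 (b k) (b l)"
  shows "avg J P (\<lambda>k l. h1 (a k) (a l) * h2 (b k) (b l)) = avg I P1 h1 * avg I' P2 h2"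
proof -
  have "avg J P (\<lambda>k l. h1 (a k) (a l) * h2 (b k) (b l))
    = (\<Sum>k\<in>J. \<Sum>l\<in>J. (P1 (a k) (a l) * h1 (a k) (a l)) * (P2 (b k) (b l) * h2 (b k) (b l)))"
    unfolding avg_def P by (simp add: mult_ac)
  also have "\<dots> = (\<Sum>k\<in>J. (\<Sum>x\<in>I. P1 (a k) x * h1 (a k) x) * (\<Sum>y\<in>I'. P2 (b k) y * h2 (b k) y))"
  proof (intro sum.cong refl)
    fix k
    show "(\<Sum>l\<in>J. (P1 (a k) (a l) * h1 (a k) (a l)) * (P2 (b k) (b l) * h2 (b k) (b l)))
      = (\<Sum>x\<in>I. P1 (a k) x * h1 (a k) x) * (\<Sum>y\<in>I'. P2 (b k) y * h2 (b k) y)"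
      by (rule sum_splits_mult[OF sp, of "\<lambda>x. P1 (a k) x * h1 (a k) x" "\<lambda>y. P2 (b k) y * h2 (b k) y"])
  qed
  also have "\<dots> = avg I P1 h1 * avg I' P2 h2"
    unfolding avg_def
    by (rule sum_splits_mult[OF sp, of "\<lambda>k. \<Sum>x\<in>I. P1 k x * h1 k x" "\<lambda>k. \<Sum>y\<in>I'. P2 k y * h2 k y"])
  finally show ?thesis .
qed

definition has_moments :: "'i set \<Rightarrow> ('i \<Rightarrow> 'i \<Rightarrow> real) \<Rightarrow> ('i \<Rightarrow> 'i \<Rightarrow> real) \<Rightarrow> real \<Rightarrow> real \<Rightarrow> bool" where
  "has_moments J P h \<mu> V \<longleftrightarrow> avg J P h = \<mu> \<and> avg J P (\<lambda>k l. (h k l - \<mu>)\<^sup>2) = V"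

text \<open>Under a product weight the two summands are independent: the cross term of the variance
  factorises, and the centred factor \<open>c1\<close> has mean zero.\<close>

lemma has_moments_tens:
  assumes sp: "splits J a b I I'" and P: "\<And>k l. P k l = P1 (a k) (a l) * P2 (b k) (b l)"
    and one: "avg I P1 (\<lambda>_ _. 1) = 1" "avg I' P2 (\<lambda>_ _. 1) = 1"
    and m: "has_moments I P1 h1 \<mu>1 V1" "has_moments I' P2 h2 \<mu>2 V2"
  shows "has_moments J P (\<lambda>k l. h1 (a k) (a l) + h2 (b k) (b l)) (\<mu>1 + \<mu>2) (V1 + V2)"
proof -
  note T = avg_tens[of J a b I I' P P1 P2, OF sp P]
  have L: "avg J P (\<lambda>k l. h (a k) (a l)) = avg I P1 h" for h
    using T[of h "\<lambda>_ _. 1"] one by simp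
  have R: "avg J P (\<lambda>k l. h (b k) (b l)) = avg I' P2 h" for h
    using T[of "\<lambda>_ _. 1" h] one by simp
  have c1: "avg I P1 (\<lambda>k l. h1 k l - \<mu>1) = 0"
    using m(1) one(1) avg_cmult[of I P1 \<mu>1 "\<lambda>_ _. 1"] by (simp add: avg_diff has_moments_def)
  have "avg J P (\<lambda>k l. h1 (a k) (a l) + h2 (b k) (b l)) = \<mu>1 + \<mu>2"
    using m by (simp add: avg_add L R has_moments_def)
  moreover have "(\<lambda>k l. (h1 (a k) (a l) + h2 (b k) (b l) - (\<mu>1 + \<mu>2))\<^sup>2)
    = (\<lambda>k l. (h1 (a k) (a l) - \<mu>1)\<^sup>2 + (2 * ((h1 (a k) (a l) - \<mu>1) * (h2 (b k) (b l) - \<mu>2)) + (h2 (b k) (b l) - \<mu>2)\<^sup>2))"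
    by (simp add: fun_eq_iff power2_eq_square algebra_simps)
  then have "avg J P (\<lambda>k l. (h1 (a k) (a l) + h2 (b k) (b l) - (\<mu>1 + \<mu>2))\<^sup>2)
    = avg J P (\<lambda>k l. (h1 (a k) (a l) - \<mu>1)\<^sup>2) +
      (2 * avg J P (\<lambda>k l. (h1 (a k) (a l) - \<mu>1) * (h2 (b k) (b l) - \<mu>2)) + avg J P (\<lambda>k l. (h2 (b k) (b l) - \<mu>2)\<^sup>2))"
    by (simp only: avg_add avg_cmult)
  then have "avg J P (\<lambda>k l. (h1 (a k) (a l) + h2 (b k) (b l) - (\<mu>1 + \<mu>2))\<^sup>2) = V1 + V2"
    using L[of "\<lambda>x y. (h1 x y - \<mu>1)\<^sup>2"] R[of "\<lambda>x y. (h2 x y - \<mu>2)\<^sup>2"]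
      T[of "\<lambda>x y. h1 x y - \<mu>1" "\<lambda>x y. h2 x y - \<mu>2"] m c1 by (simp add: has_moments_def)
  ultimately show ?thesis by (simp add: has_moments_def)
qed

text \<open>
  Only an upper bound is asked of the eigenvalues of the second operator: a zero eigenvalue admits
  every value of f, which yields arbitrarily large exponents when the supports are not nested.
\<close>

definition stein_data :: "'i set \<Rightarrow> 'i op \<Rightarrow> 'i op \<Rightarrow> real \<Rightarrow> real \<Rightarrow> real \<Rightarrow> real \<Rightarrow> bool" where
  "stein_data J \<rho> \<sigma> \<mu> V \<nu> W \<longleftrightarrow> (\<exists>p u q w g f.
     spectral_decomp J \<rho> p u \<and> spectral_decomp J \<sigma> q w \<and>
     (\<forall>k\<in>J. 0 \<le> p k \<and> (0 < p k \<longrightarrow> p k = 2 powr (- g k))) \<and>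
     (\<forall>l\<in>J. 0 \<le> q l \<and> q l \<le> 2 powr (- f l)) \<and>
     avg J (overlap J p u w) (\<lambda>_ _. 1) = 1 \<and>
     has_moments J (overlap J p u w) (\<lambda>k l. g k) \<mu> V \<and>
     has_moments J (overlap J p u w) (\<lambda>k l. f l) \<nu> W)"

text \<open>The conditions \<open>p k = 2 powr (- g k)\<close> for positive \<open>p k\<close> and
  \<open>q l \<le> 2 powr (- f l)\<close> survive products with the exponents added, and the
  overlaps multiply.\<close>

lemma stein_data_tens:
  assumes sp: "splits J a b I I'"
    and 1: "stein_data I \<rho> \<sigma> \<mu> V \<nu> W" and 2: "stein_data I' \<rho>' \<sigma>' \<mu>' V' \<nu>' W'"
  shows "stein_data J (tens J a b \<rho> \<rho>') (tens J a b \<sigma> \<sigma>') (\<mu> + \<mu>') (V + V') (\<nu> + \<nu>') (W + W')"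
proof -
  obtain p u q w g f where A: "spectral_decomp I \<rho> p u" "spectral_decomp I \<sigma> q w"
     "\<forall>k\<in>I. 0 \<le> p k \<and> (0 < p k \<longrightarrow> p k = 2 powr (- g k))"
     "\<forall>l\<in>I. 0 \<le> q l \<and> q l \<le> 2 powr (- f l)"
     "avg I (overlap I p u w) (\<lambda>_ _. 1) = 1"
     "has_moments I (overlap I p u w) (\<lambda>k l. g k) \<mu> V" "has_moments I (overlap I p u w) (\<lambda>k l. f l) \<nu> W"
    using 1 unfolding stein_data_def by blast
  obtain p' u' q' w' g' f' where B: "spectral_decomp I' \<rho>' p' u'" "spectral_decomp I' \<sigma>' q' w'"
     "\<forall>k\<in>I'. 0 \<le> p' k \<and> (0 < p' k \<longrightarrow> p' k = 2 powr (- g' k))"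
     "\<forall>l\<in>I'. 0 \<le> q' l \<and> q' l \<le> 2 powr (- f' l)"
     "avg I' (overlap I' p' u' w') (\<lambda>_ _. 1) = 1"
     "has_moments I' (overlap I' p' u' w') (\<lambda>k l. g' k) \<mu>' V'" "has_moments I' (overlap I' p' u' w') (\<lambda>k l. f' l) \<nu>' W'"
    using 2 unfolding stein_data_def by blast
  let ?P = "overlap J (\<lambda>k. p (a k) * p' (b k)) (\<lambda>k. tens_vec J a b (u (a k)) (u' (b k)))
      (\<lambda>k. tens_vec J a b (w (a k)) (w' (b k)))"
  note P = overlap_tens[OF sp, of p p' u u' w w']
  note M = has_moments_tens[where P = ?P and ?P1.0 = "overlap I p u w" and ?P2.0 = "overlap I' p' u' w'", OF sp P A(5) B(5)]
  have "0 \<le> p (a k) * p' (b k) \<and> (0 < p (a k) * p' (b k) \<longrightarrow> p (a k) * p' (b k) = 2 powr (- (g (a k) + g' (b k))))"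
    if "k \<in> J" for k
  proof -
    have "0 \<le> p (a k)" "0 \<le> p' (b k)" "0 < p (a k) \<Longrightarrow> p (a k) = 2 powr (- g (a k))"
      "0 < p' (b k) \<Longrightarrow> p' (b k) = 2 powr (- g' (b k))"
      using A(3) B(3) splits_mem[OF sp that] by auto
    moreover have "2 powr (- (x + y)) = 2 powr (- x) * 2 powr (- y)" for x y :: real
      by (simp flip: powr_add)
    ultimately show ?thesis by (auto simp: zero_less_mult_iff)
  qed
  moreover have "0 \<le> q (a k) * q' (b k) \<and> q (a k) * q' (b k) \<le> 2 powr (- (f (a k) + f' (b k)))" if "k \<in> J" for k
  proof -
    have "0 \<le> q (a k)" "0 \<le> q' (b k)" "q (a k) \<le> 2 powr (- f (a k))" "q' (b k) \<le> 2 powr (- f' (b k))"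
      using A(4) B(4) splits_mem[OF sp that] by auto
    then have "q (a k) * q' (b k) \<le> 2 powr (- f (a k)) * 2 powr (- f' (b k))" "0 \<le> q (a k) * q' (b k)"
      by (auto intro: mult_mono)
    then show ?thesis by (simp add: powr_add[symmetric])
  qed
  moreover have "avg J ?P (\<lambda>_ _. 1) = 1"
    using avg_tens[where P = ?P and ?P1.0 = "overlap I p u w" and ?P2.0 = "overlap I' p' u' w'" and
        ?h1.0 = "\<lambda>_ _. 1" and ?h2.0 = "\<lambda>_ _. 1", OF sp P] A(5) B(5) by simp
  ultimately have "(\<forall>k\<in>J. 0 \<le> p (a k) * p' (b k) \<and>
      (0 < p (a k) * p' (b k) \<longrightarrow> p (a k) * p' (b k) = 2 powr (- (g (a k) + g' (b k)))))"
    "(\<forall>k\<in>J. 0 \<le> q (a k) * q' (b k) \<and> q (a k) * q' (b k) \<le> 2 powr (- (f (a k) + f' (b k))))"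
    "avg J ?P (\<lambda>_ _. 1) = 1"
    by simp_all
  note pq = this
  show ?thesis
    unfolding stein_data_def
    by (intro exI conjI) (rule spectral_decomp_tens[OF sp A(1) B(1)] spectral_decomp_tens[OF sp A(2) B(2)]
        pq M[OF A(6) B(6)] M[OF A(7) B(7)])+
qed

section \<open>Moment data of a pair of operators, and their relation to the relative
  entropy\<close>

lemma spectral_trace:
  assumes s: "spectral_decomp I X ev u" and "finite I"
  shows "op_trace I X = complex_of_real (sum ev I)"
proof -
  have "op_trace I X = (\<Sum>i\<in>I. \<Sum>k\<in>I. complex_of_real (ev k) * (cnj (u k i) * u k i))"
    using s by (simp add: op_trace_def spectral_decomp_def mult_ac)
  also have "\<dots> = (\<Sum>k\<in>I. complex_of_real (ev k) * vec_inner I (u k) (u k))"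
    by (subst sum.swap) (simp add: vec_inner_def sum_distrib_left)
  also have "\<dots> = (\<Sum>k\<in>I. complex_of_real (ev k))"
    using s by (intro sum.cong refl) (simp add: spectral_decomp_def)
  finally show ?thesis by simp
qed

text \<open>The exponent g is fixed to \<open>- lg (p k)\<close>, while f remains free within its
  bound. The variances are left existential, since repetition absorbs any real values.\<close>

lemma stein_dataI:
  assumes J: "finite J" and st: "state J \<rho>"
    and s: "spectral_decomp J \<rho> p u" "\<And>k. k \<in> J \<Longrightarrow> 0 \<le> p k"
    and t: "spectral_decomp J \<sigma> q w" "\<And>l. l \<in> J \<Longrightarrow> 0 \<le> q l"
    and f: "\<And>l. l \<in> J \<Longrightarrow> q l \<le> 2 powr (- f l)"
  defines "P \<equiv> overlap J p u w"
  shows "\<exists>V W. stein_data J \<rho> \<sigma> (avg J P (\<lambda>k l. - lg (p k))) V (avg J P (\<lambda>k l. f l)) W"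
proof -
  have "complex_of_real (sum p J) = of_real 1"
    using spectral_trace[OF s(1) J] st by (simp add: state_def)
  then have one: "avg J P (\<lambda>_ _. 1) = 1"
    unfolding of_real_eq_iff by (simp add: avg_def P_def overlap_sum[OF s(1) t(1) J])
  have "p k = 2 powr (- (- lg (p k)))" if "0 < p k" for k
    using that by (simp add: lg_def)
  then have p: "\<forall>k\<in>J. 0 \<le> p k \<and> (0 < p k \<longrightarrow> p k = 2 powr (- (- lg (p k))))" using s(2) by blast
  have q: "\<forall>l\<in>J. 0 \<le> q l \<and> q l \<le> 2 powr (- f l)" using t(2) f by blast
  show ?thesis
    unfolding stein_data_def has_moments_def
    by (intro exI conjI) (rule s(1) t(1) p q one[unfolded P_def] refl | simp add: P_def)+
qed

lemma overlap_nonneg: "0 \<le> p k \<Longrightarrow> 0 \<le> overlap J p u w k l"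
  by (simp add: overlap_def)

lemma stein_data_of_rel_entropy:
  assumes J: "finite J" and st: "state J \<rho>" and psd: "psd J \<sigma>" and c: "ereal c < rel_entropy J \<rho> \<sigma>"
  shows "\<exists>\<mu> V \<nu> W. stein_data J \<rho> \<sigma> \<mu> V \<nu> W \<and> c < \<nu> - \<mu>"
proof -
  obtain p u where s: "spectral_decomp J \<rho> p u" "\<And>k. k \<in> J \<Longrightarrow> 0 \<le> p k"
    using psd_spectral[OF _ J, of \<rho>] st unfolding state_def by blast
  obtain q w where t: "spectral_decomp J \<sigma> q w" "\<And>l. l \<in> J \<Longrightarrow> 0 \<le> q l"
    using psd_spectral[OF psd J] by blast
  define P where "P = overlap J p u w"
  \<comment> \<open>Marks the kernel of \<sigma>. There \<open>lg\<close> vanishes, so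
    \<open>f M l\<close> equals M; elsewhere it is the exact exponent.\<close>
  define z where "z l = (if q l = 0 then 1 else 0 :: real)" for l
  define f where "f M l = - lg (q l) + M * z l" for M l
  have fq: "q l \<le> 2 powr (- f M l)" if "l \<in> J" for M l
    using t(2)[OF that] by (simp add: f_def z_def lg_def)
  \<comment> \<open>The slope in M is the weight of \<rho> on the kernel of \<sigma>: positive
    exactly when the supports are not nested, so that a large M then exceeds any c; otherwise M = 0
    serves.\<close>
  have gap: "avg J P (\<lambda>k l. f M l) - avg J P (\<lambda>k l. - lg (p k))
      = (\<Sum>k\<in>J. \<Sum>l\<in>J. P k l * (lg (p k) - lg (q l))) + M * avg J P (\<lambda>k l. z l)" for M
  proof -
    have "avg J P (\<lambda>k l. f M l) = avg J P (\<lambda>k l. - lg (q l)) + M * avg J P (\<lambda>k l. z l)"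
      unfolding f_def avg_add avg_cmult ..
    moreover have "(\<Sum>k\<in>J. \<Sum>l\<in>J. P k l * (lg (p k) - lg (q l))) = avg J P (\<lambda>k l. - lg (q l) - - lg (p k))"
      by (simp add: avg_def algebra_simps)
    ultimately show ?thesis unfolding avg_diff by simp
  qed
  have "\<exists>M. c < (\<Sum>k\<in>J. \<Sum>l\<in>J. P k l * (lg (p k) - lg (q l))) + M * avg J P (\<lambda>k l. z l)"
  proof (cases "\<forall>k\<in>J. \<forall>l\<in>J. p k \<noteq> 0 \<and> q l = 0 \<longrightarrow> vec_inner J (w l) (u k) = 0")
    case True
    then have "c < (\<Sum>k\<in>J. \<Sum>l\<in>J. P k l * (lg (p k) - lg (q l)))"
      using c unfolding rel_entropy_spectral[OF s(1) t(1) J] if_P[OF True] P_def by simp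
    then show ?thesis by (intro exI[of _ 0]) simp
  next
    case False
    then obtain k l where kl: "k \<in> J" "l \<in> J" "p k \<noteq> 0" "q l = 0" "vec_inner J (w l) (u k) \<noteq> 0" by blast
    have nn: "0 \<le> P k l * z l" if "k \<in> J" for k l
      using overlap_nonneg[of p k, OF s(2)[OF that]] by (simp add: P_def z_def)
    have "0 < P k l * z l" using kl s(2)[OF kl(1)] by (simp add: P_def overlap_def z_def)
    also have "\<dots> \<le> (\<Sum>l\<in>J. P k l * z l)" using kl J nn by (intro member_le_sum) auto
    also have "\<dots> \<le> avg J P (\<lambda>k l. z l)" unfolding avg_def
      using kl J nn by (intro member_le_sum[of k J "\<lambda>k. \<Sum>l\<in>J. P k l * z l"]) (auto intro: sum_nonneg)
    finally have pos: "0 < avg J P (\<lambda>k l. z l)" .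
    let ?S = "\<Sum>k\<in>J. \<Sum>l\<in>J. P k l * (lg (p k) - lg (q l))"
    show ?thesis
      \<comment> \<open>This M makes the right-hand side equal to c + 1.\<close>
      by (rule exI[of _ "(c - ?S + 1) / avg J P (\<lambda>k l. z l)"]) (use pos in simp)
  qed
  then obtain M where "c < avg J P (\<lambda>k l. f M l) - avg J P (\<lambda>k l. - lg (p k))" unfolding gap by blast
  then show ?thesis using stein_dataI[OF J st s t fq[where M = M]] unfolding P_def by blast
qed

text \<open>The eigenvalues of a state are at most 1, so f = 0 is allowed. These data serve the
  copies left over after forming blocks.\<close>

lemma stein_data_trivial:
  assumes J: "finite J" and st: "state J \<rho>" "state J \<sigma>"
  shows "\<exists>\<mu> V W. stein_data J \<rho> \<sigma> \<mu> V 0 W"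
proof -
  obtain p u where s: "spectral_decomp J \<rho> p u" "\<And>k. k \<in> J \<Longrightarrow> 0 \<le> p k"
    using psd_spectral[OF _ J, of \<rho>] st unfolding state_def by blast
  obtain q w where t: "spectral_decomp J \<sigma> q w" "\<And>l. l \<in> J \<Longrightarrow> 0 \<le> q l"
    using psd_spectral[OF _ J, of \<sigma>] st unfolding state_def by blast
  have "complex_of_real (sum q J) = of_real 1"
    using spectral_trace[OF t(1) J] st by (simp add: state_def)
  then have "sum q J = 1" unfolding of_real_eq_iff .
  then have "q l \<le> 2 powr (- 0)" if "l \<in> J" for l
    using member_le_sum[OF that, of q] t(2) J by simp
  from stein_dataI[OF J st(1) s t this] show ?thesis by (auto simp: avg_def)
qed

text \<open>With nested supports, pairs where p or q vanishes have zero overlap; on the others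
  \<open>f l - g k\<close> is at most the difference of logarithms. This lets the moments of a
  product strategy bound the divergence of more copies from below.\<close>

lemma stein_data_le_rel_entropy:
  assumes J: "finite J" and d: "stein_data J \<rho> \<sigma> \<mu> V \<nu> W"
  shows "ereal (\<nu> - \<mu>) \<le> rel_entropy J \<rho> \<sigma>"
proof -
  obtain p u q w g f where A: "spectral_decomp J \<rho> p u" "spectral_decomp J \<sigma> q w"
     "\<forall>k\<in>J. 0 \<le> p k \<and> (0 < p k \<longrightarrow> p k = 2 powr (- g k))"
     "\<forall>l\<in>J. 0 \<le> q l \<and> q l \<le> 2 powr (- f l)"
     "avg J (overlap J p u w) (\<lambda>_ _. 1) = 1"
     "has_moments J (overlap J p u w) (\<lambda>k l. g k) \<mu> V" "has_moments J (overlap J p u w) (\<lambda>k l. f l) \<nu> W"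
    using d unfolding stein_data_def by blast
  have "\<nu> - \<mu> \<le> (\<Sum>k\<in>J. \<Sum>l\<in>J. overlap J p u w k l * (lg (p k) - lg (q l)))"
    if z: "\<forall>k\<in>J. \<forall>l\<in>J. p k \<noteq> 0 \<and> q l = 0 \<longrightarrow> vec_inner J (w l) (u k) = 0"
  proof -
    have "\<nu> - \<mu> = avg J (overlap J p u w) (\<lambda>k l. f l - g k)"
      using A(6,7) by (simp add: has_moments_def avg_diff)
    also have "\<dots> \<le> avg J (overlap J p u w) (\<lambda>k l. lg (p k) - lg (q l))"
    proof (rule avg_mono)
      fix k l assume kl: "k \<in> J" "l \<in> J"
      show "overlap J p u w k l * (f l - g k) \<le> overlap J p u w k l * (lg (p k) - lg (q l))"
      proof (cases "p k = 0 \<or> q l = 0")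
        case True
        then have "overlap J p u w k l = 0" using z kl by (auto simp: overlap_def)
        then show ?thesis by simp
      next
        case False
        then have pq: "0 < p k" "0 < q l" using A(3,4) kl by (auto simp: less_le)
        have "p k = 2 powr (- g k)" using A(3) kl pq by blast
        then have 1: "lg (p k) = - g k" using pq by (simp add: lg_def)
        have "log 2 (q l) \<le> log 2 (2 powr (- f l))" using A(4) kl pq by (intro log_mono) auto
        then have 2: "lg (q l) \<le> - f l" using pq by (simp add: lg_def)
        show ?thesis using 1 2 pq by (intro mult_left_mono overlap_nonneg) auto
      qed
    qed
    finally show ?thesis by (simp add: avg_def)
  qed
  note le = this
  show ?thesis
  proof (cases "\<forall>k\<in>J. \<forall>l\<in>J. p k \<noteq> 0 \<and> q l = 0 \<longrightarrow> vec_inner J (w l) (u k) = 0")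
    case True
    show ?thesis unfolding rel_entropy_spectral[OF A(1,2) J] if_P[OF True] using le[OF True] by simp
  next
    case False
    show ?thesis unfolding rel_entropy_spectral[OF A(1,2) J] if_not_P[OF False] by simp
  qed
qed


section \<open>The test\<close>

lemma expand_in_span:
  assumes o: "orthonormal I F z" and F: "finite F" and y: "y = (\<lambda>i. \<Sum>m\<in>F. c m * z m i)"
  shows "(\<Sum>m\<in>F. (cmod (vec_inner I (z m) y))\<^sup>2) = Re (vec_inner I y y)"
proof -
  have c: "vec_inner I (z m) y = c m" if m: "m \<in> F" for m
  proof -
    have "vec_inner I (z m) y = (\<Sum>n\<in>F. if n = m then c m else 0)"
      unfolding y vec_inner_sum_right using o m by (intro sum.cong refl) (auto simp: orthonormal_def)
    then show ?thesis using F m by simp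
  qed
  have "vec_inner I y y = (\<Sum>m\<in>F. c m * vec_inner I y (z m))"
    by (subst (2) y) (rule vec_inner_sum_right)
  also have "\<dots> = (\<Sum>m\<in>F. complex_of_real ((cmod (vec_inner I (z m) y))\<^sup>2))"
  proof (intro sum.cong refl)
    fix m assume m: "m \<in> F"
    show "c m * vec_inner I y (z m) = complex_of_real ((cmod (vec_inner I (z m) y))\<^sup>2)"
      unfolding c[OF m, symmetric] by (rule vec_inner_mult_swap)
  qed
  finally show ?thesis by simp
qed

text \<open>Vectors depending on earlier ones are skipped, hence d can be smaller than the number of
  vectors. The last clause says that z stays inside the span of y, phrased by orthogonality because
  that is how it is used.\<close>

lemma gram_schmidt:
  assumes I: "finite I" and T: "finite T" and y: "\<And>k. k \<in> T \<Longrightarrow> y k \<in> vecs I"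
  shows "\<exists>(d::nat) z. orthonormal I {..<d} z \<and> d \<le> card T \<and>
     (\<forall>k\<in>T. \<exists>c. y k = (\<lambda>i. \<Sum>m<d. c m * z m i)) \<and>
     (\<forall>x. (\<forall>k\<in>T. vec_inner I x (y k) = 0) \<longrightarrow> (\<forall>m<d. vec_inner I x (z m) = 0))"
  using T y
proof (induction T)
  case empty
  show ?case by (intro exI[of _ 0]) (simp add: orthonormal_def)
next
  case (insert t T)
  then obtain d z where o: "orthonormal I {..<d::nat} z" and d: "d \<le> card T"
    and sp: "\<And>k. k \<in> T \<Longrightarrow> \<exists>c. y k = (\<lambda>i. \<Sum>m<d. c m * z m i)"
    and or: "\<And>x m. (\<forall>k\<in>T. vec_inner I x (y k) = 0) \<Longrightarrow> m < d \<Longrightarrow> vec_inner I x (z m) = 0"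
    by auto
  let ?r = "resid I {..<d} z (y t)"
  have yt: "y t = (\<lambda>i. ?r i + (\<Sum>m<d. vec_inner I (z m) (y t) * z m i))"
    by (simp add: resid_def)
  have rv: "?r \<in> vecs I" using resid_in_vecs[OF o] insert.prems by simp
  show ?case
  proof (cases "?r = (\<lambda>_. 0)")
    case True
    then have "y t = (\<lambda>i. \<Sum>m<d. vec_inner I (z m) (y t) * z m i)" using yt by (simp add: fun_eq_iff)
    then show ?thesis using o d sp or insert.hyps
      by (intro exI[of _ d] exI[of _ z]) (auto simp: card_insert_if)
  next
    case False
    define n where "n = Re (vec_inner I ?r ?r)"
    have nr: "vec_inner I ?r ?r = complex_of_real n" unfolding n_def vec_inner_self by simp
    have "n \<noteq> 0" using False vec_inner_self_eq_0[OF I rv] nr by auto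
    moreover have "0 \<le> n" unfolding n_def vec_inner_self by (simp add: sum_nonneg)
    ultimately have n: "0 < n" by simp
    define v where "v = (\<lambda>i. complex_of_real (1 / sqrt n) * ?r i)"
    have v1: "vec_inner I v v = 1"
    proof -
      have "vec_inner I v v = complex_of_real ((1 / sqrt n) * ((1 / sqrt n) * n))"
        unfolding v_def vec_inner_scale_left vec_inner_scale_right nr
        by (simp only: complex_cnj_complex_of_real of_real_mult)
      also have "(1 / sqrt n) * ((1 / sqrt n) * n) = 1" using n by (simp add: field_simps)
      finally show ?thesis by simp
    qed
    have zv: "vec_inner I (z m) v = 0" if "m < d" for m
      unfolding v_def vec_inner_scale_right using resid_orth[OF o, of m "y t"] that by simp
    have vz: "vec_inner I v (z m) = 0" if "m < d" for m
      using zv[OF that] vec_inner_cnj[of I "z m" v] by simp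
    have vv: "v \<in> vecs I" using rv by (auto simp: v_def vecs_def)
    let ?z = "z(d := v)"
    have o': "orthonormal I {..<Suc d} ?z"
      using o vv v1 zv vz by (auto simp: orthonormal_def less_Suc_eq)
    have sp': "\<exists>c. y k = (\<lambda>i. \<Sum>m<Suc d. c m * ?z m i)" if k: "k \<in> insert t T" for k
    proof (cases "k = t")
      case True
      have "y t i = (\<Sum>m<Suc d. (if m = d then complex_of_real (sqrt n) else vec_inner I (z m) (y t)) * ?z m i)" for i
      proof -
        have "?r i = complex_of_real (sqrt n) * v i" using n by (simp add: v_def)
        then show ?thesis by (subst yt) simp
      qed
      then show ?thesis using True by (auto simp: fun_eq_iff intro!: exI[of _ "\<lambda>m. if m = d then complex_of_real (sqrt n) else vec_inner I (z m) (y t)"])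
    next
      case False
      then obtain c where "y k = (\<lambda>i. \<Sum>m<d. c m * z m i)" using sp k by auto
      then have "y k = (\<lambda>i. \<Sum>m<Suc d. (c(d := 0)) m * ?z m i)" by simp
      then show ?thesis by blast
    qed
    have or': "vec_inner I x (?z m) = 0" if x: "\<forall>k\<in>insert t T. vec_inner I x (y k) = 0" and m: "m < Suc d" for x m
    proof -
      have zx: "vec_inner I x (z m) = 0" if "m < d" for m using or[of x] x that by simp
      have "vec_inner I x ?r = vec_inner I x (y t) - (\<Sum>m<d. vec_inner I (z m) (y t) * vec_inner I x (z m))"
        unfolding resid_def vec_inner_diff_right vec_inner_sum_right ..
      then have "vec_inner I x ?r = 0" using x zx by simp
      then have "vec_inner I x v = 0" unfolding v_def vec_inner_scale_right by simp
      then show ?thesis using zx m by (auto simp: less_Suc_eq)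
    qed
    have "Suc d \<le> card (insert t T)" using d insert.hyps by simp
    then show ?thesis using o' sp' or' by blast
  qed
qed

text \<open>
  The test projects onto the span of the projections of the typical eigenvectors of the first state
  to the span of those eigenvectors of the second state whose eigenvalues are small. The dimension
  of this span is at most the number of typical eigenvectors.
\<close>

lemma stein_test:
  assumes J: "finite J" and st: "state J \<rho>" and d: "stein_data J \<rho> \<sigma> \<mu> V \<nu> W" and t: "0 < t"
  shows "\<exists>Q1 Q2. binary_povm J Q1 Q2 \<and> Re (op_trace J (op_mult J Q2 \<rho>)) \<le> (V + W) / t\<^sup>2 \<and>
    0 \<le> Re (op_trace J (op_mult J Q1 \<sigma>)) \<and> Re (op_trace J (op_mult J Q1 \<sigma>)) \<le> 2 powr (\<mu> - \<nu> + 2 * t)"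
proof -
  obtain p u q w g f where A: "spectral_decomp J \<rho> p u" "spectral_decomp J \<sigma> q w"
     "\<forall>k\<in>J. 0 \<le> p k \<and> (0 < p k \<longrightarrow> p k = 2 powr (- g k))"
     "\<forall>l\<in>J. 0 \<le> q l \<and> q l \<le> 2 powr (- f l)"
     "avg J (overlap J p u w) (\<lambda>_ _. 1) = 1"
     "has_moments J (overlap J p u w) (\<lambda>k l. g k) \<mu> V" "has_moments J (overlap J p u w) (\<lambda>k l. f l) \<nu> W"
    using d unfolding stein_data_def by blast
  define P where "P = overlap J p u w"
  have Pnn: "0 \<le> P k l" if "k \<in> J" for k l
    unfolding P_def by (rule overlap_nonneg) (use A(3) that in blast)
  \<comment> \<open>Only large eigenvalues matter here: \<open>p k\<close> is at least
    \<open>2 powr (- (\<mu> + t))\<close>, which caps the size of T.\<close>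
  define T where "T = {k \<in> J. 0 < p k \<and> g k \<le> \<mu> + t}"
  \<comment> \<open>For these l the eigenvalue \<open>q l\<close> is at most
    \<open>2 powr (- (\<nu> - t))\<close>.\<close>
  define L where "L = {l \<in> J. \<nu> - t \<le> f l}"
  have fin: "finite T" "finite L" "T \<subseteq> J" "L \<subseteq> J" using J by (auto simp: T_def L_def)
  note uo = spectral_decomp_orthonormal[OF A(1)] and wo = spectral_decomp_orthonormal[OF A(2)]
  have uv: "u k \<in> vecs J" "w k \<in> vecs J" if "k \<in> J" for k
    using uo wo that by (auto simp: orthonormal_def)
  define y where "y k = (\<lambda>i. \<Sum>l\<in>L. vec_inner J (w l) (u k) * w l i)" for k
  have "y k \<in> vecs J" for k using uv(2) fin by (auto simp: y_def vecs_def intro!: sum.neutral)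
  then obtain d z where Z: "orthonormal J {..<d::nat} z \<and> d \<le> card T \<and>
     (\<forall>k\<in>T. \<exists>c. y k = (\<lambda>i. \<Sum>m<d. c m * z m i)) \<and>
     (\<forall>x. (\<forall>k\<in>T. vec_inner J x (y k) = 0) \<longrightarrow> (\<forall>m<d. vec_inner J x (z m) = 0))"
    using gram_schmidt[OF J fin(1), of y] by auto
  note z = Z[THEN conjunct1] Z[THEN conjunct2, THEN conjunct1]
    Z[THEN conjunct2, THEN conjunct2, THEN conjunct1, rule_format]
    Z[THEN conjunct2, THEN conjunct2, THEN conjunct2, rule_format]
  have zv: "z m \<in> vecs J" "vec_inner J (z m) (z m) = 1" if "m < d" for m
    using z(1) that by (auto simp: orthonormal_def)
  \<comment> \<open>The coefficient 1 gives Q1 the shape of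
    \<open>op_trace_mult_rank_one_sums\<close> and \<open>op_apply_rank_one_sum\<close>.\<close>
  define Q1 where "Q1 = (\<lambda>i j. \<Sum>m<d. 1 * z m i * cnj (z m j))"
  define Q2 where "Q2 = (\<lambda>i j. op_id J i j - Q1 i j)"
  have wL: "orthonormal J L w" using wo fin(4) unfolding orthonormal_def by (simp add: subset_iff)
  \<comment> \<open>Each \<open>z m\<close> lies in the span of the \<open>w l\<close> with l in L:
    the other \<open>w l\<close> are orthogonal to all y, and the last clause of
    \<open>gram_schmidt\<close> passes this on to z.\<close>
  have wz: "vec_inner J (w l) (z m) = 0" if l: "l \<in> J" "l \<notin> L" and m: "m < d" for l m
  proof (rule z(4)[OF _ m])
    fix k
    show "vec_inner J (w l) (y k) = 0"
      unfolding y_def vec_inner_sum_right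
      using l wo by (intro sum.neutral) (auto simp: orthonormal_def subsetD[OF fin(4)])
  qed
  have yy: "Re (vec_inner J (y k) (y k)) = (\<Sum>l\<in>L. (cmod (vec_inner J (w l) (u k)))\<^sup>2)" for k
  proof -
    have "(\<Sum>l\<in>L. (cmod (vec_inner J (w l) (y k)))\<^sup>2) = Re (vec_inner J (y k) (y k))"
      by (rule expand_in_span[OF wL fin(2)]) (rule y_def)
    moreover have "vec_inner J (w l) (y k) = vec_inner J (w l) (u k)" if l: "l \<in> L" for l
    proof -
      have "vec_inner J (w l) (y k) = (\<Sum>n\<in>L. if n = l then vec_inner J (w l) (u k) else 0)"
        unfolding y_def vec_inner_sum_right using wL l by (intro sum.cong refl) (auto simp: orthonormal_def)
      then show ?thesis using l fin(2) by simp
    qed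
    ultimately show ?thesis by simp
  qed
  \<comment> \<open>\<open>u k\<close> and its projection \<open>y k\<close> differ by a vector
    orthogonal to the span of L, which contains \<open>z m\<close>.\<close>
  have zu: "vec_inner J (z m) (u k) = vec_inner J (z m) (y k)" if m: "m < d" for m k
  proof -
    have wz': "vec_inner J (z m) (w l) = 0" if "l \<in> J - L" for l
      using wz[of l m] that m vec_inner_cnj[of J "w l" "z m"] by simp
    have "vec_inner J (z m) (u k) = (\<Sum>l\<in>J. vec_inner J (z m) (w l) * vec_inner J (w l) (u k))"
      by (rule parseval[OF wo J J refl zv(1)[OF m], symmetric])
    also have "\<dots> = (\<Sum>l\<in>L. vec_inner J (z m) (w l) * vec_inner J (w l) (u k))"
      using wz' by (intro sum.mono_neutral_right J fin(4)) simp
    also have "\<dots> = vec_inner J (z m) (y k)"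
      unfolding y_def vec_inner_sum_right by (simp add: mult.commute)
    finally show ?thesis .
  qed
  \<comment> \<open>No norm is lost on T, because \<open>y k\<close> lies in the span of z: the test
    accepts \<open>u k\<close> with probability exactly the squared norm of
    \<open>y k\<close>.\<close>
  have sumz: "(\<Sum>m<d. (cmod (vec_inner J (z m) (u k)))\<^sup>2) = (\<Sum>l\<in>L. (cmod (vec_inner J (w l) (u k)))\<^sup>2)"
    if k: "k \<in> T" for k
  proof -
    from z(3)[OF k] obtain c where c: "y k = (\<lambda>i. \<Sum>m<d. c m * z m i)" by blast
    have "(\<Sum>m<d. (cmod (vec_inner J (z m) (u k)))\<^sup>2) = (\<Sum>m<d. (cmod (vec_inner J (z m) (y k)))\<^sup>2)"
      by (simp add: zu)
    also have "\<dots> = Re (vec_inner J (y k) (y k))" by (rule expand_in_span[OF z(1) _ c]) simp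
    finally show ?thesis unfolding yy .
  qed
  have trace: "Re (op_trace J (op_mult J Q1 X)) = (\<Sum>m<d. \<Sum>k\<in>J. ev k * (cmod (vec_inner J (v k) (z m)))\<^sup>2)"
    if "spectral_decomp J X ev v" for X ev v
  proof -
    have "X = (\<lambda>i j. \<Sum>k\<in>J. complex_of_real (ev k) * v k i * cnj (v k j))"
      using that by (simp add: spectral_decomp_def)
    then show ?thesis unfolding Q1_def
      using op_trace_mult_rank_one_sums[OF J, of "\<lambda>_. 1" z "{..<d}" "\<lambda>k. complex_of_real (ev k)" v J] by simp
  qed
  have psd1: "psd J Q1" using gram_psd[of "{..<d}" z J] zv by (simp add: Q1_def)
  have psd2: "psd J Q2"
  proof -
    have "Q1 \<in> ops J" using psd1 by (rule psd_ops)
    then have "Q2 \<in> ops J" by (auto simp: ops_def Q2_def op_id_def)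
    moreover have "Q2 j i = cnj (Q2 i j)" for i j
      by (auto simp: Q2_def Q1_def op_id_def cnj_sum mult.commute)
    moreover have "0 \<le> Re (vec_inner J x (op_apply J Q2 x))" if x: "x \<in> vecs J" for x
    proof -
      have "op_apply J Q2 x = (\<lambda>i. x i - op_apply J Q1 x i)"
      proof
        fix i
        have "(\<Sum>j\<in>J. op_id J i j * x j) = (\<Sum>j\<in>J. if j = i then x i else 0)"
          by (intro sum.cong refl) (auto simp: op_id_def)
        also have "\<dots> = x i" using J x by (auto simp: vecs_def)
        finally show "op_apply J Q2 x i = x i - op_apply J Q1 x i"
          by (simp add: op_apply_def Q2_def left_diff_distrib sum_subtractf)
      qed
      then have "vec_inner J x (op_apply J Q2 x) = vec_inner J x x - (\<Sum>m<d. vec_inner J (z m) x * vec_inner J x (z m))"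
        unfolding Q1_def op_apply_rank_one_sum by (simp add: vec_inner_diff_right vec_inner_sum_right)
      then have "Re (vec_inner J x (op_apply J Q2 x)) = Re (vec_inner J x x) - (\<Sum>m<d. (cmod (vec_inner J (z m) x))\<^sup>2)"
        unfolding vec_inner_mult_swap by simp
      then show ?thesis using bessel[OF z(1), of x] by simp
    qed
    ultimately show ?thesis unfolding psd_def by blast
  qed
  have "binary_povm J Q1 Q2" using psd1 psd2 by (simp add: binary_povm_def Q2_def)
  moreover have "Re (op_trace J (op_mult J Q2 \<rho>)) \<le> (V + W) / t\<^sup>2"
  proof -
    have "op_trace J (op_mult J Q2 \<rho>) = op_trace J (op_mult J (op_id J) \<rho>) - op_trace J (op_mult J Q1 \<rho>)"
      by (simp add: op_trace_def op_mult_def Q2_def left_diff_distrib sum_subtractf)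
    moreover have "op_mult J (op_id J) \<rho> i i = \<rho> i i" if "i \<in> J" for i
    proof -
      have "op_mult J (op_id J) \<rho> i i = (\<Sum>k\<in>J. if i = k then \<rho> i i else 0)"
        unfolding op_mult_def using that by (intro sum.cong refl) (auto simp: op_id_def)
      then show ?thesis using that J by simp
    qed
    then have "op_trace J (op_mult J (op_id J) \<rho>) = 1"
      using st by (simp add: op_trace_def state_def)
    ultimately have "Re (op_trace J (op_mult J Q2 \<rho>)) = avg J P (\<lambda>_ _. 1) - Re (op_trace J (op_mult J Q1 \<rho>))"
      using A(5) by (simp add: P_def)
    also have "Re (op_trace J (op_mult J Q1 \<rho>)) = (\<Sum>k\<in>J. p k * (\<Sum>m<d. (cmod (vec_inner J (z m) (u k)))\<^sup>2))"
    proof -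
      have "cmod (vec_inner J (u k) (z m)) = cmod (vec_inner J (z m) (u k))" for k m
        by (metis complex_mod_cnj vec_inner_cnj)
      then show ?thesis unfolding trace[OF A(1)] by (subst sum.swap) (simp add: sum_distrib_left)
    qed
    \<comment> \<open>Acceptance of eigenvectors outside T is discarded; what remains is the weight
      of T times L under P.\<close>
    also have "avg J P (\<lambda>_ _. 1) - (\<Sum>k\<in>J. p k * (\<Sum>m<d. (cmod (vec_inner J (z m) (u k)))\<^sup>2))
      \<le> avg J P (\<lambda>_ _. 1) - (\<Sum>k\<in>T. p k * (\<Sum>m<d. (cmod (vec_inner J (z m) (u k)))\<^sup>2))"
      using A(3) by (intro diff_left_mono sum_mono2 J fin(3)) (auto intro!: mult_nonneg_nonneg sum_nonneg)
    also have "(\<Sum>k\<in>T. p k * (\<Sum>m<d. (cmod (vec_inner J (z m) (u k)))\<^sup>2)) = (\<Sum>k\<in>T. \<Sum>l\<in>L. P k l)"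
      by (intro sum.cong refl) (simp add: sumz P_def overlap_def sum_distrib_left)
    also have "\<dots> = avg J P (\<lambda>k l. if k \<in> T \<and> l \<in> L then 1 else 0)"
    proof -
      have "(\<Sum>l\<in>J. P k l * (if k \<in> T \<and> l \<in> L then 1 else 0)) = (if k \<in> T then \<Sum>l\<in>L. P k l else 0)" for k
      proof -
        have "(\<Sum>l\<in>J. P k l * (if k \<in> T \<and> l \<in> L then 1 else 0)) = (\<Sum>l\<in>J. if l \<in> L then (if k \<in> T then P k l else 0) else 0)"
          by (intro sum.cong refl) auto
        also have "\<dots> = (\<Sum>l\<in>L. if k \<in> T then P k l else 0)"
          using J fin(4) by (simp add: sum.inter_restrict[symmetric] Int_absorb1)
        finally show ?thesis by simp
      qed
      then show ?thesis unfolding avg_def using J fin(3) by (simp add: sum.inter_restrict[symmetric] Int_absorb1)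
    qed
    also have "avg J P (\<lambda>_ _. 1) - avg J P (\<lambda>k l. if k \<in> T \<and> l \<in> L then 1 else 0)
      = avg J P (\<lambda>k l. 1 - (if k \<in> T \<and> l \<in> L then 1 else 0))" by (simp add: avg_diff)
    \<comment> \<open>Chebyshev pointwise: outside T times L either \<open>p k = 0\<close>, which
      carries no weight, or \<open>g k\<close> or \<open>f l\<close> is at least t away from its
      mean.\<close>
    also have "\<dots> \<le> avg J P (\<lambda>k l. (1 / t\<^sup>2) * ((g k - \<mu>)\<^sup>2 + (f l - \<nu>)\<^sup>2))"
    proof (rule avg_mono)
      fix k l assume kl: "k \<in> J" "l \<in> J"
      show "P k l * (1 - (if k \<in> T \<and> l \<in> L then 1 else 0)) \<le> P k l * ((1 / t\<^sup>2) * ((g k - \<mu>)\<^sup>2 + (f l - \<nu>)\<^sup>2))"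
      proof (cases "k \<in> T \<and> l \<in> L")
        case True then show ?thesis using Pnn[OF kl(1), of l] by simp
      next
        case False
        show ?thesis
        proof (cases "p k = 0")
          case True then show ?thesis by (simp add: P_def overlap_def)
        next
          case p: False
          then have "t \<le> \<bar>g k - \<mu>\<bar> \<or> t \<le> \<bar>f l - \<nu>\<bar>"
            using False kl A(3) by (auto simp: T_def L_def less_le abs_if)
          then have "t\<^sup>2 \<le> (g k - \<mu>)\<^sup>2 \<or> t\<^sup>2 \<le> (f l - \<nu>)\<^sup>2"
            using t by (metis abs_le_square_iff abs_of_pos)
          then have "t\<^sup>2 \<le> (g k - \<mu>)\<^sup>2 + (f l - \<nu>)\<^sup>2"
            by (meson add_increasing add_increasing2 zero_le_power2)
          then have "1 \<le> (1 / t\<^sup>2) * ((g k - \<mu>)\<^sup>2 + (f l - \<nu>)\<^sup>2)" using t by (simp add: field_simps)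
          then show ?thesis using False Pnn[OF kl(1), of l] by (intro mult_left_mono) auto
        qed
      qed
    qed
    also have "\<dots> = (V + W) / t\<^sup>2"
      unfolding avg_cmult avg_add using A(6,7) by (simp add: has_moments_def P_def)
    finally show ?thesis by simp
  qed
  moreover have "0 \<le> Re (op_trace J (op_mult J Q1 \<sigma>))"
    unfolding trace[OF A(2)] using A(4) by (intro sum_nonneg mult_nonneg_nonneg) auto
  moreover have "Re (op_trace J (op_mult J Q1 \<sigma>)) \<le> 2 powr (\<mu> - \<nu> + 2 * t)"
  proof -
    have "(\<Sum>l\<in>J. q l * (cmod (vec_inner J (w l) (z m)))\<^sup>2) \<le> 2 powr (- (\<nu> - t))" if m: "m < d" for m
    proof -
      have "(\<Sum>l\<in>J. q l * (cmod (vec_inner J (w l) (z m)))\<^sup>2) \<le> (\<Sum>l\<in>J. 2 powr (- (\<nu> - t)) * (cmod (vec_inner J (w l) (z m)))\<^sup>2)"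
      proof (rule sum_mono)
        fix l assume l: "l \<in> J"
        show "q l * (cmod (vec_inner J (w l) (z m)))\<^sup>2 \<le> 2 powr (- (\<nu> - t)) * (cmod (vec_inner J (w l) (z m)))\<^sup>2"
        proof (cases "l \<in> L")
          case True
          have "q l \<le> 2 powr (- f l)" using A(4) l by blast
          also have "\<dots> \<le> 2 powr (- (\<nu> - t))" using True by (intro powr_mono) (auto simp: L_def)
          finally show ?thesis by (intro mult_right_mono) auto
        next
          case False
          then show ?thesis using wz[OF l False m] by simp
        qed
      qed
      also have "\<dots> = 2 powr (- (\<nu> - t)) * Re (vec_inner J (z m) (z m))"
        by (simp add: parseval_norm[OF wo J zv(1)[OF m]] flip: sum_distrib_left)
      finally show ?thesis using zv(2)[OF m] by simp
    qed
    then have "Re (op_trace J (op_mult J Q1 \<sigma>)) \<le> (\<Sum>m<d. 2 powr (- (\<nu> - t)))"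
      unfolding trace[OF A(2)] by (intro sum_mono) simp
    also have "\<dots> \<le> real (card T) * 2 powr (- (\<nu> - t))" using z(2) by (simp add: mult_right_mono)
    also have "\<dots> \<le> 2 powr (\<mu> + t) * 2 powr (- (\<nu> - t))"
    proof (intro mult_right_mono)
      \<comment> \<open>Each element of T takes at least \<open>2 powr (- (\<mu> + t))\<close> of
        the total mass 1.\<close>
      have "real (card T) * 2 powr (- (\<mu> + t)) = (\<Sum>k\<in>T. 2 powr (- (\<mu> + t)))" by simp
      also have "\<dots> \<le> (\<Sum>k\<in>T. p k)"
      proof (rule sum_mono)
        fix k assume k: "k \<in> T"
        then have "p k = 2 powr (- g k)" using A(3) by (auto simp: T_def)
        then show "2 powr (- (\<mu> + t)) \<le> p k" using k by (simp add: T_def)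
      qed
      also have "\<dots> \<le> (\<Sum>k\<in>J. p k)" using A(3) fin J by (intro sum_mono2) auto
      also have "\<dots> = 1" using A(5) by (simp add: avg_def overlap_sum[OF A(1,2) J])
      finally have "real (card T) * 2 powr (- (\<mu> + t)) * 2 powr (\<mu> + t) \<le> 1 * 2 powr (\<mu> + t)"
        by (intro mult_right_mono) auto
      then show "real (card T) \<le> 2 powr (\<mu> + t)"
        by (simp add: mult.assoc flip: powr_add)
    qed simp
    also have "\<dots> = 2 powr (\<mu> - \<nu> + 2 * t)" by (simp add: algebra_simps flip: powr_add)
    finally show ?thesis .
  qed
  ultimately show ?thesis by blast
qed


section \<open>Positivity under relabelling and products\<close>

text \<open>Gram vectors are pulled back along \<phi>, which may be any map; principal blocks,
  relabellings and swaps of factors are instances.\<close>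

lemma psd_relabel:
  assumes "psd I X" "finite I"
  shows "psd J (op_restrict J (\<lambda>z z'. X (\<phi> z) (\<phi> z')))"
proof -
  obtain v where v: "X = (\<lambda>i j. \<Sum>k\<in>I. v k i * cnj (v k j))" using psd_gram[OF assms] by blast
  let ?w = "\<lambda>k z. if z \<in> J then v k (\<phi> z) else 0"
  have "op_restrict J (\<lambda>z z'. X (\<phi> z) (\<phi> z')) = (\<lambda>z z'. \<Sum>k\<in>I. ?w k z * cnj (?w k z'))"
    by (auto simp: op_restrict_def v fun_eq_iff)
  moreover have "psd J (\<lambda>z z'. \<Sum>k\<in>I. ?w k z * cnj (?w k z'))"
    by (rule gram_psd) (simp add: vecs_def)
  ultimately show ?thesis by (simp only:)
qed

text \<open>Products of pulled-back Gram vectors are Gram vectors of the result. The coordinate maps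
  are arbitrary, so the Schur product theorem is included; \<open>psd_prod\<close> uses it with
  \<open>id\<close> as first coordinate.\<close>

lemma psd_tens:
  assumes "psd I X" "finite I" "psd I' Y" "finite I'"
  shows "psd J (tens J a b X Y)"
proof -
  obtain v where v: "X = (\<lambda>i j. \<Sum>k\<in>I. v k i * cnj (v k j))" using psd_gram[OF assms(1,2)] by blast
  obtain w where w: "Y = (\<lambda>i j. \<Sum>k\<in>I'. w k i * cnj (w k j))" using psd_gram[OF assms(3,4)] by blast
  let ?x = "\<lambda>k z. if z \<in> J then v (fst k) (a z) * w (snd k) (b z) else 0"
  have "tens J a b X Y = (\<lambda>z z'. \<Sum>k\<in>I \<times> I'. ?x k z * cnj (?x k z'))"
    by (auto simp: tens_def op_restrict_def v w fun_eq_iff sum_product sum.cartesian_product case_prod_unfold mult_ac)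
  moreover have "psd J (\<lambda>z z'. \<Sum>k\<in>I \<times> I'. ?x k z * cnj (?x k z'))"
    by (rule gram_psd) (simp add: vecs_def)
  ultimately show ?thesis by (simp only:)
qed

lemma psd_prod:
  assumes "psd I X" "finite I" "finite J"
  shows "psd J (op_restrict J (\<lambda>z z'. \<Prod>k<(n::nat). X (\<phi> k z) (\<phi> k z')))"
proof (induction n)
  case 0
  have "op_restrict J (\<lambda>z z'. \<Prod>k<0::nat. X (\<phi> k z) (\<phi> k z'))
    = (\<lambda>z z'. \<Sum>k\<in>{()}. (if z \<in> J then 1 else 0) * cnj (if z' \<in> J then 1 else 0))"
    by (auto simp: op_restrict_def fun_eq_iff)
  moreover have "psd J (\<lambda>z z'. \<Sum>k\<in>{()}. (if z \<in> J then 1 else 0) * cnj (if z' \<in> J then 1 else 0))"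
    by (rule gram_psd) (simp add: vecs_def)
  ultimately show ?case by (simp only:)
next
  case (Suc n)
  have "op_restrict J (\<lambda>z z'. \<Prod>k<Suc n. X (\<phi> k z) (\<phi> k z'))
    = tens J id (\<phi> n) (op_restrict J (\<lambda>z z'. \<Prod>k<n. X (\<phi> k z) (\<phi> k z'))) X"
    by (auto simp: tens_def op_restrict_def fun_eq_iff)
  then show ?case using psd_tens[OF Suc assms(3) assms(1,2)] by simp
qed

lemma op_trace_tens:
  assumes "splits J a b I I'"
  shows "op_trace J (tens J a b X Y) = op_trace I X * op_trace I' Y"
proof -
  have "op_trace J (tens J a b X Y) = (\<Sum>z\<in>J. X (a z) (a z) * Y (b z) (b z))"
    unfolding op_trace_def by (intro sum.cong refl) (simp add: tens_def op_restrict_def)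
  then show ?thesis
    using sum_splits_mult[OF assms, of "\<lambda>x. X x x" "\<lambda>y. Y y y"] by (simp add: op_trace_def)
qed

lemma state_tens:
  assumes "splits J a b I I'" "finite I" "finite I'" "state I X" "state I' Y"
  shows "state J (tens J a b X Y)"
  using assms psd_tens[of I X I' Y J a b] op_trace_tens[of J a b I I' X Y] by (simp add: state_def)


section \<open>Channels and Choi matrices\<close>

definition choi :: "'i set \<Rightarrow> 'j set \<Rightarrow> ('i, 'j) smap \<Rightarrow> ('j \<times> 'i) op" where
  "choi I J \<Phi> = op_restrict (J \<times> I) (\<lambda>(j, a) (j', b). \<Phi> (op_unit a b) j j')"

lemma linear_map_ops: "linear_map I J \<Phi> \<Longrightarrow> X \<in> ops I \<Longrightarrow> \<Phi> X \<in> ops J"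
  by (simp add: linear_map_def)

lemma op_unit_ops: "a \<in> I \<Longrightarrow> b \<in> I \<Longrightarrow> op_unit a b \<in> ops I"
  by (auto simp: ops_def op_unit_def)

lemma choi_entry:
  assumes "linear_map I J \<Phi>" "a \<in> I" "b \<in> I"
  shows "choi I J \<Phi> (j, a) (j', b) = \<Phi> (op_unit a b) j j'"
  using linear_map_ops[OF assms(1) op_unit_ops[OF assms(2,3)]] assms(2,3)
  by (auto simp: choi_def op_restrict_def ops_def)

lemma linear_map_zero: "linear_map I J \<Phi> \<Longrightarrow> \<Phi> (\<lambda>_ _. 0) = (\<lambda>_ _. 0)"
  using linear_map_sum[of I J \<Phi> "{}" "\<lambda>_. undefined" "\<lambda>_. 0"] by simp

lemma block_ops: "X \<in> ops (I \<times> K) \<Longrightarrow> (\<lambda>i i'. X (i, k) (i', k')) \<in> ops I"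
  by (simp add: ops_def)

lemma block_zero:
  assumes "X \<in> ops (I \<times> K)" "k \<notin> K \<or> k' \<notin> K"
  shows "(\<lambda>i i'. X (i, k) (i', k')) = (\<lambda>_ _. 0)"
  using assms by (auto simp: ops_def fun_eq_iff)

lemma ext_id_ops:
  assumes L: "linear_map I J \<Phi>" and X: "X \<in> ops (I \<times> K)"
  shows "ext_id \<Phi> X \<in> ops (J \<times> K)"
proof -
  have "ext_id \<Phi> X (j, k) (j', k') = 0" if "(j, k) \<notin> J \<times> K \<or> (j', k') \<notin> J \<times> K" for j k j' k'
  proof (cases "k \<in> K \<and> k' \<in> K")
    case True
    then have "j \<notin> J \<or> j' \<notin> J" using that by auto
    then show ?thesis using linear_map_ops[OF L block_ops[OF X]] by (simp add: ext_id_def ops_def)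
  next
    case False
    then show ?thesis
      using block_zero[OF X, of k k'] linear_map_zero[OF L] by (simp add: ext_id_def)
  qed
  then show ?thesis by (auto simp: ops_def)
qed

text \<open>Gram vectors of the Choi matrix act as Kraus operators on Gram vectors of X. The
  reference K is any finite label set, whereas \<open>completely_positive\<close> speaks of initial
  segments of the naturals only.\<close>

lemma ext_id_psd:
  assumes fin: "finite I" "finite J" "finite K" and L: "linear_map I J \<Phi>"
    and C: "psd (J \<times> I) (choi I J \<Phi>)" and X: "psd (I \<times> K) X"
  shows "psd (J \<times> K) (ext_id \<Phi> X)"
proof -
  obtain x where x: "\<And>m. m \<in> I \<times> K \<Longrightarrow> x m \<in> vecs (I \<times> K)" "X = (\<lambda>i j. \<Sum>m\<in>I \<times> K. x m i * cnj (x m j))"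
    using psd_gram[OF X] fin by auto
  obtain v where v: "\<And>m. m \<in> J \<times> I \<Longrightarrow> v m \<in> vecs (J \<times> I)" "choi I J \<Phi> = (\<lambda>i j. \<Sum>m\<in>J \<times> I. v m i * cnj (v m j))"
    using psd_gram[OF C] fin by auto
  let ?y = "\<lambda>n (j, k). \<Sum>a\<in>I. x (fst n) (a, k) * v (snd n) (j, a)"
  let ?F = "(I \<times> K) \<times> (J \<times> I)"
  have "ext_id \<Phi> X (j, k) (j', k') = (\<Sum>n\<in>?F. ?y n (j, k) * cnj (?y n (j', k')))" for j k j' k'
  proof -
    have "ext_id \<Phi> X (j, k) (j', k') = (\<Sum>a\<in>I. \<Sum>b\<in>I. X (a, k) (b, k') * choi I J \<Phi> (j, a) (j', b))"
      using linear_map_matrix_units[OF L fin(1) block_ops[OF psd_ops[OF X]], of k k' j j']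
      by (simp add: ext_id_def choi_entry[OF L])
    also have "\<dots> = (\<Sum>a\<in>I. \<Sum>b\<in>I. \<Sum>n\<in>?F. (x (fst n) (a, k) * v (snd n) (j, a)) * cnj (x (fst n) (b, k') * v (snd n) (j', b)))"
      by (intro sum.cong refl)
        (simp add: x(2) v(2) sum_product sum.cartesian_product case_prod_unfold mult_ac)
    also have "\<dots> = (\<Sum>n\<in>?F. \<Sum>a\<in>I. \<Sum>b\<in>I. (x (fst n) (a, k) * v (snd n) (j, a)) * cnj (x (fst n) (b, k') * v (snd n) (j', b)))"
      by (simp only: sum.swap[of _ I ?F])
    also have "\<dots> = (\<Sum>n\<in>?F. ?y n (j, k) * cnj (?y n (j', k')))"
      by (simp add: sum_product cnj_sum)
    finally show ?thesis .
  qed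
  then have "ext_id \<Phi> X = (\<lambda>z z'. \<Sum>n\<in>?F. ?y n z * cnj (?y n z'))"
    by (auto simp: fun_eq_iff)
  moreover have "psd (J \<times> K) (\<lambda>z z'. \<Sum>n\<in>?F. ?y n z * cnj (?y n z'))"
  proof (rule gram_psd)
    fix n assume n: "n \<in> ?F"
    then have "x (fst n) \<in> vecs (I \<times> K)" "v (snd n) \<in> vecs (J \<times> I)" using x(1) v(1) by auto
    then show "?y n \<in> vecs (J \<times> K)" by (auto simp: vecs_def intro!: sum.neutral)
  qed
  ultimately show ?thesis by (simp only:)
qed

lemma channel_linear: "channel I J \<Phi> \<Longrightarrow> linear_map I J \<Phi>"
  by (simp add: channel_def)

text \<open>The Choi matrix is a block of the image of an unnormalised maximally entangled state.\<close>

lemma channel_choi_psd: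
  assumes fin: "finite I" "finite J" and ch: "channel I J \<Phi>"
  shows "psd (J \<times> I) (choi I J \<Phi>)"
proof -
  \<comment> \<open>References in \<open>completely_positive\<close> are labelled by naturals, so I
    is enumerated to serve as its own reference.\<close>
  obtain g where g: "bij_betw g I {..<card I}"
    using fin(1) by (metis bij_betw_iff_card card_lessThan finite_lessThan)
  let ?e = "\<lambda>(i, t). if i \<in> I \<and> t = g i then 1 else 0 :: complex"
  let ?X = "\<lambda>z z'. \<Sum>k\<in>{()}. ?e z * cnj (?e z')"
  have "psd (I \<times> {..<card I}) ?X"
    by (rule gram_psd) (use g in \<open>auto simp: vecs_def bij_betw_def\<close>)
  then have P: "psd (J \<times> {..<card I}) (ext_id \<Phi> ?X)"
    using ch unfolding channel_def completely_positive_def by blast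
  have "choi I J \<Phi> = op_restrict (J \<times> I) (\<lambda>z z'. ext_id \<Phi> ?X (map_prod id g z) (map_prod id g z'))"
  proof -
    have "(\<lambda>i i'. ?X (i, g a) (i', g b)) = op_unit a b" if "a \<in> I" "b \<in> I" for a b
      using g that by (auto simp: op_unit_def fun_eq_iff bij_betw_def inj_on_def)
    then show ?thesis by (auto simp: choi_def op_restrict_def ext_id_def fun_eq_iff)
  qed
  then show ?thesis using psd_relabel[OF P] fin by simp
qed

text \<open>Linearity reduces trace preservation to matrix units, and a positive Choi matrix gives
  complete positivity. All channels constructed below are verified in this form.\<close>

lemma channelI:
  assumes fin: "finite I" "finite J" and L: "linear_map I J \<Phi>"
    and C: "psd (J \<times> I) (choi I J \<Phi>)"
    and T: "\<And>a b. a \<in> I \<Longrightarrow> b \<in> I \<Longrightarrow> op_trace J (\<Phi> (op_unit a b)) = (if a = b then 1 else 0)"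
  shows "channel I J \<Phi>"
proof -
  have "op_trace J (\<Phi> X) = op_trace I X" if X: "X \<in> ops I" for X
  proof -
    have "op_trace J (\<Phi> X) = (\<Sum>j\<in>J. \<Sum>a\<in>I. \<Sum>b\<in>I. X a b * \<Phi> (op_unit a b) j j)"
      unfolding op_trace_def by (intro sum.cong refl) (rule linear_map_matrix_units[OF L fin(1) X])
    also have "\<dots> = (\<Sum>a\<in>I. \<Sum>b\<in>I. X a b * op_trace J (\<Phi> (op_unit a b)))"
      by (simp only: sum.swap[of _ J I] op_trace_def sum_distrib_left)
    also have "\<dots> = (\<Sum>a\<in>I. \<Sum>b\<in>I. if b = a then X a a else 0)"
      by (intro sum.cong refl) (simp add: T)
    finally show ?thesis using fin by (simp add: op_trace_def)
  qed
  moreover have "completely_positive I J \<Phi>"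
    unfolding completely_positive_def using ext_id_psd[OF fin finite_lessThan L C] by blast
  ultimately show ?thesis using L by (simp add: channel_def trace_preserving_def)
qed

lemma channel_trace_unit:
  assumes "channel I J \<Phi>" "finite I" "a \<in> I" "b \<in> I"
  shows "op_trace J (\<Phi> (op_unit a b)) = (if a = b then 1 else 0)"
proof -
  have "op_trace J (\<Phi> (op_unit a b)) = op_trace I (op_unit a b)"
    using assms op_unit_ops[of a I b] by (simp add: channel_def trace_preserving_def)
  also have "\<dots> = (\<Sum>i\<in>I. if i = a then (if a = b then 1 else 0) else 0)"
    unfolding op_trace_def by (intro sum.cong refl) (auto simp: op_unit_def)
  finally show ?thesis using assms by simp
qed

lemma state_ext_id:
  assumes fin: "finite I" "finite J" "finite K" and ch: "channel I J \<Phi>" and X: "state (I \<times> K) X"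
  shows "state (J \<times> K) (ext_id \<Phi> X)"
proof -
  have L: "linear_map I J \<Phi>" by (rule channel_linear[OF ch])
  have P: "psd (I \<times> K) X" using X by (simp add: state_def)
  have s: "(\<Sum>z\<in>A \<times> K. h z) = (\<Sum>k\<in>K. \<Sum>j\<in>A. h (j, k))" for A :: "'x set" and h :: "_ \<Rightarrow> complex"
    by (subst sum.swap) (simp add: sum.cartesian_product)
  have "op_trace (J \<times> K) (ext_id \<Phi> X) = (\<Sum>k\<in>K. op_trace J (\<Phi> (\<lambda>i i'. X (i, k) (i', k))))"
    by (simp add: op_trace_def s ext_id_def)
  also have "\<dots> = (\<Sum>k\<in>K. op_trace I (\<lambda>i i'. X (i, k) (i', k)))"
    using ch block_ops[OF psd_ops[OF P]] by (simp add: channel_def trace_preserving_def)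
  also have "\<dots> = op_trace (I \<times> K) X" by (simp add: op_trace_def s)
  finally show ?thesis
    using X ext_id_psd[OF fin L channel_choi_psd[OF fin(1,2) ch] P] by (simp add: state_def)
qed

lemma state_swap_last:
  assumes fin: "finite I" "finite J" "finite K" and X: "state ((I \<times> J) \<times> K) X"
  shows "state ((I \<times> K) \<times> J) (swap_last X)"
proof -
  have P: "psd ((I \<times> J) \<times> K) X" using X by (simp add: state_def)
  let ?\<phi> = "\<lambda>((x, z), y). ((x, y), z)"
  have "swap_last X = op_restrict ((I \<times> K) \<times> J) (\<lambda>z z'. X (?\<phi> z) (?\<phi> z'))"
    using psd_ops[OF P] by (auto simp: swap_last_def op_restrict_def ops_def fun_eq_iff)
  moreover have "op_trace ((I \<times> K) \<times> J) (swap_last X) = op_trace ((I \<times> J) \<times> K) X"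
    unfolding op_trace_def
    by (rule sum.reindex_bij_witness[of _ "\<lambda>((x, z), y). ((x, y), z)" "\<lambda>((x, z), y). ((x, y), z)"])
      (auto simp: swap_last_def)
  ultimately show ?thesis using X psd_relabel[OF P] fin by (simp add: state_def)
qed

lemma channel_relabel_output:
  assumes fin: "finite I" "finite J" and ch: "channel I J \<Phi>" and \<phi>: "bij_betw \<phi> J' J"
  shows "channel I J' (\<lambda>X. op_restrict J' (\<lambda>z z'. \<Phi> X (\<phi> z) (\<phi> z')))"
proof -
  let ?\<Psi> = "\<lambda>X. op_restrict J' (\<lambda>z z'. \<Phi> X (\<phi> z) (\<phi> z'))"
  have L: "linear_map I J \<Phi>" by (rule channel_linear[OF ch])
  have L': "linear_map I J' ?\<Psi>"
    using L by (auto simp: linear_map_def op_restrict_def ops_def fun_eq_iff)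
  have mem: "\<phi> z \<in> J" if "z \<in> J'" for z using \<phi> that by (auto simp: bij_betw_def)
  have fin': "finite J'" using \<phi> fin bij_betw_finite by blast
  have "choi I J' ?\<Psi> = op_restrict (J' \<times> I) (\<lambda>z z'. choi I J \<Phi> (map_prod \<phi> id z) (map_prod \<phi> id z'))"
    using mem by (auto simp: choi_def op_restrict_def fun_eq_iff)
  then have C: "psd (J' \<times> I) (choi I J' ?\<Psi>)"
    using psd_relabel[OF channel_choi_psd[OF fin ch]] fin by simp
  show ?thesis
  proof (rule channelI[OF fin(1) fin' L' C])
    fix a b assume ab: "a \<in> I" "b \<in> I"
    have "op_trace J' (?\<Psi> (op_unit a b)) = (\<Sum>z\<in>J'. \<Phi> (op_unit a b) (\<phi> z) (\<phi> z))"
      unfolding op_trace_def by (intro sum.cong refl) (simp add: op_restrict_def)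
    also have "\<dots> = op_trace J (\<Phi> (op_unit a b))"
      unfolding op_trace_def by (rule sum.reindex_bij_betw[OF \<phi>])
    finally show "op_trace J' (?\<Psi> (op_unit a b)) = (if a = b then 1 else 0)"
      using channel_trace_unit[OF ch fin(1) ab] by simp
  qed
qed

text \<open>The equivalence \<open>mem\<close> ranges over all labels, not only those in I: it
  ensures that a pulled-back operator vanishes outside I.\<close>

lemma channel_relabel_input:
  assumes fin: "finite I" "finite J" and ch: "channel I J \<Phi>" and \<phi>: "bij_betw \<phi> I I'"
    and mem: "\<And>z. z \<in> I \<longleftrightarrow> \<phi> z \<in> I'"
  shows "channel I' J (\<lambda>X. \<Phi> (\<lambda>z z'. X (\<phi> z) (\<phi> z')))"
proof -
  let ?\<Psi> = "\<lambda>X. \<Phi> (\<lambda>z z'. X (\<phi> z) (\<phi> z'))"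
  have L: "linear_map I J \<Phi>" by (rule channel_linear[OF ch])
  have o: "(\<lambda>z z'. X (\<phi> z) (\<phi> z')) \<in> ops I" if "X \<in> ops I'" for X :: "'c op"
    using that mem by (auto simp: ops_def)
  have L': "linear_map I' J ?\<Psi>"
    using L o unfolding linear_map_def by simp
  have fin': "finite I'" using \<phi> fin bij_betw_finite by blast
  let ?\<psi> = "inv_into I \<phi>"
  have u: "(\<lambda>z z'. op_unit a b (\<phi> z) (\<phi> z')) = op_unit (?\<psi> a) (?\<psi> b)" if "a \<in> I'" "b \<in> I'" for a b
  proof -
    have "\<phi> z = a \<longleftrightarrow> z = ?\<psi> a" if "a \<in> I'" for z a
      using \<phi> mem that by (metis bij_betw_def f_inv_into_f inv_into_f_f)
    then show ?thesis using that by (simp add: op_unit_def)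
  qed
  have m: "?\<psi> a \<in> I" if "a \<in> I'" for a using \<phi> that by (metis bij_betw_def inv_into_into)
  have inj: "?\<psi> a = ?\<psi> b \<longleftrightarrow> a = b" if "a \<in> I'" "b \<in> I'" for a b
    using \<phi> that by (metis bij_betw_def f_inv_into_f)
  have "choi I' J ?\<Psi> = op_restrict (J \<times> I') (\<lambda>z z'. choi I J \<Phi> (map_prod id ?\<psi> z) (map_prod id ?\<psi> z'))"
    using m u by (auto simp: choi_def op_restrict_def fun_eq_iff)
  then have C: "psd (J \<times> I') (choi I' J ?\<Psi>)"
    using psd_relabel[OF channel_choi_psd[OF fin ch]] fin by simp
  show ?thesis
    by (rule channelI[OF fin' fin(2) L' C]) (simp add: u channel_trace_unit[OF ch fin(1) m m] inj)
qed


section \<open>Tensor powers of channels\<close>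

lemma finite_sys_pow [simp]: "finite I \<Longrightarrow> finite (sys_pow n I)"
  unfolding sys_pow_def by (rule finite_lists_length_eq)

lemma system_sys_pow: "system I \<Longrightarrow> system (sys_pow n I)"
proof -
  assume s: "system I"
  then obtain x where "x \<in> I" by (auto simp: system_def)
  then have "replicate n x \<in> sys_pow n I" by (auto simp: sys_pow_def)
  then show ?thesis using s finite_sys_pow by (auto simp: system_def)
qed

lemma sys_pow_nth: "xs \<in> sys_pow n I \<Longrightarrow> k < n \<Longrightarrow> xs ! k \<in> I"
  by (auto simp: sys_pow_def)

lemma sum_sys_pow_prod_single:
  "(\<Sum>xs\<in>sys_pow n I. \<Prod>k<n. g k (xs ! k)) = (\<Prod>k<n. \<Sum>a\<in>I. (g k a :: complex))"
proof (induction n arbitrary: g)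
  case 0
  have "sys_pow 0 I = {[]}" by (auto simp: sys_pow_def)
  then show ?case by simp
next
  case (Suc n)
  have inj: "inj_on (\<lambda>(x, xs). x # xs) (I \<times> sys_pow n I)" by (auto simp: inj_on_def)
  have "(\<Sum>xs\<in>sys_pow (Suc n) I. \<Prod>k<Suc n. g k (xs ! k))
    = (\<Sum>a\<in>I. \<Sum>xs\<in>sys_pow n I. g 0 a * (\<Prod>k<n. g (Suc k) (xs ! k)))"
    unfolding sys_pow_Suc
    by (subst sum.reindex[OF inj])
      (simp add: sum.cartesian_product case_prod_unfold prod.lessThan_Suc_shift del: prod.lessThan_Suc)
  also have "\<dots> = (\<Sum>a\<in>I. g 0 a) * (\<Sum>xs\<in>sys_pow n I. \<Prod>k<n. g (Suc k) (xs ! k))"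
    by (simp add: sum_product)
  also have "\<dots> = (\<Prod>k<Suc n. \<Sum>a\<in>I. g k a)"
    unfolding Suc.IH[of "\<lambda>k. g (Suc k)"] by (simp add: prod.lessThan_Suc_shift del: prod.lessThan_Suc)
  finally show ?case .
qed

lemma linear_map_pow: "linear_map (sys_pow n I) (sys_pow n J) (map_pow n I J \<Phi>)"
  unfolding linear_map_def map_pow_def
  by (auto simp: op_restrict_def ops_def fun_eq_iff distrib_right sum.distrib sum_distrib_left mult_ac)

lemma map_pow_unit:
  assumes "finite I" "us \<in> sys_pow n I" "us' \<in> sys_pow n I"
  shows "map_pow n I J \<Phi> (op_unit us us')
    = op_restrict (sys_pow n J) (\<lambda>ys ys'. \<Prod>k<n. \<Phi> (op_unit (us ! k) (us' ! k)) (ys ! k) (ys' ! k))"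
proof -
  have "(\<Sum>xs\<in>sys_pow n I. \<Sum>xs'\<in>sys_pow n I. op_unit us us' xs xs' * h xs xs') = h us us'" for h
  proof -
    have "(\<Sum>xs\<in>sys_pow n I. \<Sum>xs'\<in>sys_pow n I. op_unit us us' xs xs' * h xs xs')
      = (\<Sum>xs\<in>sys_pow n I. \<Sum>xs'\<in>sys_pow n I. if xs' = us' then (if xs = us then h us us' else 0) else 0)"
      by (intro sum.cong refl) (auto simp: op_unit_def)
    then show ?thesis using assms by simp
  qed
  then show ?thesis unfolding map_pow_def by simp
qed

text \<open>The Choi matrix of the power is the entrywise product of copies of the single Choi
  matrix read at each position, hence positive by \<open>psd_prod\<close>; traces of matrix units
  factorise likewise.\<close>

lemma channel_map_pow:
  assumes fin: "finite I" "finite J" and ch: "channel I J \<Phi>"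
  shows "channel (sys_pow n I) (sys_pow n J) (map_pow n I J \<Phi>)"
proof (rule channelI[OF finite_sys_pow[OF fin(1)] finite_sys_pow[OF fin(2)] linear_map_pow])
  note L = channel_linear[OF ch]
  have "choi (sys_pow n I) (sys_pow n J) (map_pow n I J \<Phi>)
    = op_restrict (sys_pow n J \<times> sys_pow n I)
       (\<lambda>z z'. \<Prod>k<n. choi I J \<Phi> (fst z ! k, snd z ! k) (fst z' ! k, snd z' ! k))"
    unfolding choi_def[of "sys_pow n I"]
    by (auto simp: op_restrict_def fun_eq_iff map_pow_unit[OF fin(1)] choi_entry[OF L] sys_pow_nth)
  moreover have "psd (sys_pow n J \<times> sys_pow n I) (op_restrict (sys_pow n J \<times> sys_pow n I)
       (\<lambda>z z'. \<Prod>k<n. choi I J \<Phi> (fst z ! k, snd z ! k) (fst z' ! k, snd z' ! k)))"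
    by (rule psd_prod[OF channel_choi_psd[OF fin ch], where \<phi> = "\<lambda>k z. (fst z ! k, snd z ! k)"])
      (use fin in auto)
  ultimately show "psd (sys_pow n J \<times> sys_pow n I) (choi (sys_pow n I) (sys_pow n J) (map_pow n I J \<Phi>))"
    by (simp only:)
next
  fix us us' assume us: "us \<in> sys_pow n I" "us' \<in> sys_pow n I"
  have "op_trace (sys_pow n J) (map_pow n I J \<Phi> (op_unit us us'))
     = (\<Sum>ys\<in>sys_pow n J. \<Prod>k<n. \<Phi> (op_unit (us ! k) (us' ! k)) (ys ! k) (ys ! k))"
    unfolding op_trace_def by (intro sum.cong refl) (simp add: map_pow_unit[OF fin(1) us] op_restrict_def)
  also have "\<dots> = (\<Prod>k<n. op_trace J (\<Phi> (op_unit (us ! k) (us' ! k))))"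
    unfolding op_trace_def
    by (rule sum_sys_pow_prod_single[of "\<lambda>k y. \<Phi> (op_unit (us ! k) (us' ! k)) y y"])
  also have "\<dots> = (\<Prod>k<n. if us ! k = us' ! k then 1 else 0)"
    by (intro prod.cong refl channel_trace_unit[OF ch fin(1)] sys_pow_nth[OF us(1)] sys_pow_nth[OF us(2)]) auto
  also have "\<dots> = (if us = us' then 1 else 0)"
  proof (cases "us = us'")
    case False
    then obtain k where "k < n" "us ! k \<noteq> us' ! k"
      using us by (auto simp: sys_pow_def list_eq_iff_nth_eq)
    then show ?thesis using False by (auto intro!: prod_zero)
  qed simp
  finally show "op_trace (sys_pow n J) (map_pow n I J \<Phi> (op_unit us us')) = (if us = us' then 1 else 0)" .
qed

lemma zip_bij: "bij_betw (\<lambda>(xs, ys). zip xs ys) (sys_pow n I \<times> sys_pow n J) (sys_pow n (I \<times> J))"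
  by (rule bij_betw_byWitness[where f' = "\<lambda>zs. (map fst zs, map snd zs)"])
    (auto simp: sys_pow_def zip_map_fst_snd dest: set_zip_leftD set_zip_rightD, force+)

lemma unzip_bij: "bij_betw (\<lambda>zs. (map fst zs, map snd zs)) (sys_pow n (I \<times> J)) (sys_pow n I \<times> sys_pow n J)"
  by (rule bij_betw_byWitness[where f' = "\<lambda>(xs, ys). zip xs ys"])
    (auto simp: sys_pow_def zip_map_fst_snd dest: set_zip_leftD set_zip_rightD, force+)

lemma superchannel_pow:
  assumes "superchannel \<Theta>"
  shows "superchannel (superch_pow n \<Theta>)"
proof -
  have sys: "system (sysA \<Theta>)" "system (sysB \<Theta>)" "system (sysC \<Theta>)" "system (sysD \<Theta>)" "system (sysS \<Theta>)"
    and ch: "channel (sysC \<Theta>) (sysA \<Theta> \<times> sysS \<Theta>) (enc \<Theta>)" "channel (sysB \<Theta> \<times> sysS \<Theta>) (sysD \<Theta>) (dec \<Theta>)"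
    using assms by (simp_all add: superchannel_def)
  have fin: "finite (sysA \<Theta>)" "finite (sysB \<Theta>)" "finite (sysC \<Theta>)" "finite (sysD \<Theta>)" "finite (sysS \<Theta>)"
    using sys by (simp_all add: system_def)
  have "channel (sysC (superch_pow n \<Theta>)) (sysA (superch_pow n \<Theta>) \<times> sysS (superch_pow n \<Theta>)) (enc (superch_pow n \<Theta>))"
    using channel_relabel_output[OF _ _ channel_map_pow[OF _ _ ch(1), of n] zip_bij] fin
    by (simp add: superch_pow_def case_prod_unfold)
  moreover have "channel (sysB (superch_pow n \<Theta>) \<times> sysS (superch_pow n \<Theta>)) (sysD (superch_pow n \<Theta>)) (dec (superch_pow n \<Theta>))"
  proof -
    have "zs \<in> sys_pow n (sysB \<Theta> \<times> sysS \<Theta>) \<longleftrightarrow> (map fst zs, map snd zs) \<in> sys_pow n (sysB \<Theta>) \<times> sys_pow n (sysS \<Theta>)" for zs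
      by (auto simp: sys_pow_def subset_iff)
    from channel_relabel_input[OF _ _ channel_map_pow[OF _ _ ch(2), of n] unzip_bij this]
    show ?thesis using fin by (simp add: superch_pow_def)
  qed
  ultimately show ?thesis using sys
    by (simp add: superchannel_def) (simp add: superch_pow_def system_sys_pow)
qed

lemma state_superch_apply:
  assumes S: "superchannel \<Theta>" and N: "channel (sysA \<Theta> \<times> R) (sysB \<Theta> \<times> R) N" and R: "finite R"
    and \<rho>: "state (sysC \<Theta> \<times> R) \<rho>"
  shows "state (sysD \<Theta> \<times> R) (superch_apply \<Theta> N \<rho>)"
proof -
  have ch: "channel (sysC \<Theta>) (sysA \<Theta> \<times> sysS \<Theta>) (enc \<Theta>)" "channel (sysB \<Theta> \<times> sysS \<Theta>) (sysD \<Theta>) (dec \<Theta>)"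
    and fin: "finite (sysA \<Theta>)" "finite (sysB \<Theta>)" "finite (sysC \<Theta>)" "finite (sysD \<Theta>)" "finite (sysS \<Theta>)"
    using S by (simp_all add: superchannel_def system_def)
  have "state ((sysA \<Theta> \<times> sysS \<Theta>) \<times> R) (ext_id (enc \<Theta>) \<rho>)"
    by (rule state_ext_id[OF _ _ _ ch(1) \<rho>]) (use fin R in auto)
  then have "state ((sysA \<Theta> \<times> R) \<times> sysS \<Theta>) (swap_last (ext_id (enc \<Theta>) \<rho>))"
    by (intro state_swap_last fin R)
  then have "state ((sysB \<Theta> \<times> R) \<times> sysS \<Theta>) (ext_id N (swap_last (ext_id (enc \<Theta>) \<rho>)))"
    by (intro state_ext_id[OF _ _ _ N]) (use fin R in auto)
  then have "state ((sysB \<Theta> \<times> sysS \<Theta>) \<times> R) (swap_last (ext_id N (swap_last (ext_id (enc \<Theta>) \<rho>))))"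
    by (intro state_swap_last fin R)
  then have "state (sysD \<Theta> \<times> R) (ext_id (dec \<Theta>) (swap_last (ext_id N (swap_last (ext_id (enc \<Theta>) \<rho>)))))"
    by (intro state_ext_id[OF _ _ _ ch(2)]) (use fin R in auto)
  then show ?thesis by (simp add: superch_apply_def)
qed


section \<open>Products of strategies\<close>

lemma splits_sys_pow: "splits (sys_pow (m + n) I) (take m) (drop m) (sys_pow m I) (sys_pow n I)"
  unfolding splits_def
  by (rule bij_betw_byWitness[where f' = "\<lambda>(xs, ys). xs @ ys"])
    (auto simp: sys_pow_def dest: in_set_takeD in_set_dropD)

text \<open>References are labelled by naturals below their dimension, so two of them are joined
  into one by quotient and remainder.\<close>

lemma splits_lessThan:
  assumes "0 < s"
  shows "splits {..<r * s} (\<lambda>t. t div s) (\<lambda>t. t mod s) {..<r} {..<s :: nat}"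
  unfolding splits_def
proof (rule bij_betw_byWitness[where f' = "\<lambda>(i, j). i * s + j"])
  have "i * s + j < r * s" if "i < r" "j < s" for i j
  proof -
    have "i * s + j < Suc i * s" using that by simp
    also have "\<dots> \<le> r * s" using that by (intro mult_le_mono1) simp
    finally show ?thesis .
  qed
  then show "(\<lambda>(i, j). i * s + j) ` ({..<r} \<times> {..<s}) \<subseteq> {..<r * s}" by auto
qed (use assms in \<open>auto simp: less_mult_imp_div_less\<close>)

text \<open>Regroups four factors, so that copies and reference are divided between two strategies
  at the same time.\<close>

lemma splits_Times:
  assumes "splits J a b I1 I2" "splits L c d K1 K2"
  shows "splits (J \<times> L) (map_prod a c) (map_prod b d) (I1 \<times> K1) (I2 \<times> K2)"
proof -
  have 1: "inj_on (\<lambda>z. (a z, b z)) J" "(\<lambda>z. (a z, b z)) ` J = I1 \<times> I2"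
    and 2: "inj_on (\<lambda>z. (c z, d z)) L" "(\<lambda>z. (c z, d z)) ` L = K1 \<times> K2"
    using assms by (auto simp: splits_def bij_betw_def)
  have "inj_on (\<lambda>z. (map_prod a c z, map_prod b d z)) (J \<times> L)"
    using 1(1) 2(1) by (auto simp: inj_on_def)
  moreover have "(\<lambda>z. (map_prod a c z, map_prod b d z)) ` (J \<times> L) = (I1 \<times> K1) \<times> (I2 \<times> K2)" (is "?A = ?B")
  proof
    show "?A \<subseteq> ?B" using splits_mem[OF assms(1)] splits_mem[OF assms(2)] by auto
    show "?B \<subseteq> ?A"
    proof
      fix z assume "z \<in> ?B"
      then obtain i k i' k' where z: "z = ((i, k), (i', k'))" "(i, i') \<in> I1 \<times> I2" "(k, k') \<in> K1 \<times> K2" by auto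
      then obtain j l where "j \<in> J" "(a j, b j) = (i, i')" "l \<in> L" "(c l, d l) = (k, k')"
        unfolding 1(2)[symmetric] 2(2)[symmetric] by auto
      then show "z \<in> ?A" using z by (intro image_eqI[of _ _ "(j, l)"]) auto
    qed
  qed
  ultimately show ?thesis by (simp add: splits_def bij_betw_def)
qed

text \<open>The tensor product of two maps, given on matrix units and extended linearly as in
  \<open>map_pow\<close>, since an operator on the composite need not be a product.\<close>

definition tens_map :: "'j set \<Rightarrow> ('j \<Rightarrow> 'i) \<Rightarrow> ('j \<Rightarrow> 'k) \<Rightarrow> 'l set \<Rightarrow> ('l \<Rightarrow> 'm) \<Rightarrow> ('l \<Rightarrow> 'n) \<Rightarrow>
    ('i, 'm) smap \<Rightarrow> ('k, 'n) smap \<Rightarrow> ('j, 'l) smap" where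
  "tens_map J a b J' a' b' \<Phi> \<Psi> X = op_restrict J' (\<lambda>z z'. \<Sum>x\<in>J. \<Sum>x'\<in>J.
     X x x' * (\<Phi> (op_unit (a x) (a x')) (a' z) (a' z') * \<Psi> (op_unit (b x) (b x')) (b' z) (b' z')))"

lemma tens_map_tens:
  assumes sp: "splits J a b I I2" and fin: "finite I" "finite I2"
    and L: "linear_map I M \<Phi>" "linear_map I2 M2 \<Psi>" and X: "X \<in> ops I" "Y \<in> ops I2"
  shows "tens_map J a b J' a' b' \<Phi> \<Psi> (tens J a b X Y) = tens J' a' b' (\<Phi> X) (\<Psi> Y)"
proof -
  have "(\<Sum>x\<in>J. \<Sum>x'\<in>J. tens J a b X Y x x' *
      (\<Phi> (op_unit (a x) (a x')) (a' z) (a' z') * \<Psi> (op_unit (b x) (b x')) (b' z) (b' z')))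
    = \<Phi> X (a' z) (a' z') * \<Psi> Y (b' z) (b' z')" for z z'
  proof -
    let ?f = "\<lambda>p q. X p q * \<Phi> (op_unit p q) (a' z) (a' z')"
    let ?g = "\<lambda>p q. Y p q * \<Psi> (op_unit p q) (b' z) (b' z')"
    have "(\<Sum>x\<in>J. \<Sum>x'\<in>J. tens J a b X Y x x' *
      (\<Phi> (op_unit (a x) (a x')) (a' z) (a' z') * \<Psi> (op_unit (b x) (b x')) (b' z) (b' z')))
      = (\<Sum>x\<in>J. \<Sum>x'\<in>J. ?f (a x) (a x') * ?g (b x) (b x'))"
      by (intro sum.cong refl) (simp add: tens_def op_restrict_def)
    also have "\<dots> = (\<Sum>x\<in>J. sum (?f (a x)) I * sum (?g (b x)) I2)"
      by (intro sum.cong refl) (rule sum_splits_mult[OF sp])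
    also have "\<dots> = (\<Sum>p\<in>I. sum (?f p) I) * (\<Sum>p\<in>I2. sum (?g p) I2)"
      by (rule sum_splits_mult[OF sp, of "\<lambda>p. sum (?f p) I" "\<lambda>p. sum (?g p) I2"])
    also have "(\<Sum>p\<in>I. sum (?f p) I) = \<Phi> X (a' z) (a' z')"
      by (rule linear_map_matrix_units[OF L(1) fin(1) X(1), symmetric])
    also have "(\<Sum>p\<in>I2. sum (?g p) I2) = \<Psi> Y (b' z) (b' z')"
      by (rule linear_map_matrix_units[OF L(2) fin(2) X(2), symmetric])
    finally show ?thesis .
  qed
  then show ?thesis unfolding tens_map_def tens_def by simp
qed

lemma tens_unit:
  assumes "splits J a b I I2" "x \<in> J" "x' \<in> J"
  shows "op_unit x x' = tens J a b (op_unit (a x) (a x')) (op_unit (b x) (b x'))"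
proof (intro ext)
  fix z z'
  show "op_unit x x' z z' = tens J a b (op_unit (a x) (a x')) (op_unit (b x) (b x')) z z'"
    using assms(2,3) splits_eq_iff[OF assms(1), of z x] splits_eq_iff[OF assms(1), of z' x']
    by (auto simp: op_unit_def tens_def op_restrict_def)
qed

text \<open>Up to regrouping of labels, the Choi matrix is the tensor product of the two Choi
  matrices.\<close>

lemma channel_tens_map:
  assumes sp: "splits J a b I I2" and sp': "splits J' a' b' M M2"
    and fin: "finite I" "finite I2" "finite M" "finite M2"
    and ch: "channel I M \<Phi>" "channel I2 M2 \<Psi>"
  shows "channel J J' (tens_map J a b J' a' b' \<Phi> \<Psi>)" (is "channel J J' ?T")
proof (rule channelI)
  note L = channel_linear[OF ch(1)] channel_linear[OF ch(2)]
  show fJ: "finite J" "finite J'" using splits_finite sp sp' fin by blast+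
  show "linear_map J J' ?T"
    unfolding linear_map_def tens_map_def
    by (auto simp: op_restrict_def ops_def fun_eq_iff algebra_simps sum.distrib sum_distrib_left)
  have unit: "?T (op_unit x x') = tens J' a' b' (\<Phi> (op_unit (a x) (a x'))) (\<Psi> (op_unit (b x) (b x')))"
    if "x \<in> J" "x' \<in> J" for x x'
    unfolding tens_unit[OF sp that]
    using tens_map_tens[OF sp fin(1,2) L] op_unit_ops splits_mem[OF sp that(1)] splits_mem[OF sp that(2)] by metis
  have "choi J J' ?T = tens (J' \<times> J) (map_prod a' a) (map_prod b' b) (choi I M \<Phi>) (choi I2 M2 \<Psi>)"
    by (auto simp: choi_def[of J] tens_def op_restrict_def fun_eq_iff unit choi_entry[OF L(1)] choi_entry[OF L(2)]
        splits_mem[OF sp])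
  then show "psd (J' \<times> J) (choi J J' ?T)"
    using psd_tens[OF channel_choi_psd[OF fin(1,3) ch(1)] _ channel_choi_psd[OF fin(2,4) ch(2)]] fin by simp
  fix x x' assume x: "x \<in> J" "x' \<in> J"
  show "op_trace J' (?T (op_unit x x')) = (if x = x' then 1 else 0)"
    unfolding unit[OF x] op_trace_tens[OF sp'] splits_eq_iff[OF sp x]
    using channel_trace_unit[OF ch(1) fin(1)] channel_trace_unit[OF ch(2) fin(2)]
      splits_mem[OF sp x(1)] splits_mem[OF sp x(2)] by simp
qed

text \<open>The map \<Phi> only has to factorise on product operators, because each block of a
  product operator is again a product; blocks with labels outside L are zero, which is where
  \<open>zero\<close> enters. Encoder, joint channel and decoder are all handled by this
  lemma.\<close>

lemma ext_id_tens:
  assumes T: "\<And>X Y. X \<in> ops I \<Longrightarrow> Y \<in> ops I2 \<Longrightarrow> \<Phi> (tens J a b X Y) = tens J' a' b' (\<Phi>1 X) (\<Phi>2 Y)"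
    and zero: "\<Phi> (\<lambda>_ _. 0) = (\<lambda>_ _. 0)"
    and X: "X \<in> ops (I \<times> K)" "Y \<in> ops (I2 \<times> K2)"
  shows "ext_id \<Phi> (tens (J \<times> L) (map_prod a c) (map_prod b d) X Y)
    = tens (J' \<times> L) (map_prod a' c) (map_prod b' d) (ext_id \<Phi>1 X) (ext_id \<Phi>2 Y)"
proof -
  have "ext_id \<Phi> (tens (J \<times> L) (map_prod a c) (map_prod b d) X Y) (j, k) (j', k')
    = tens (J' \<times> L) (map_prod a' c) (map_prod b' d) (ext_id \<Phi>1 X) (ext_id \<Phi>2 Y) (j, k) (j', k')" for j k j' k'
  proof (cases "k \<in> L \<and> k' \<in> L")
    case True
    then have "(\<lambda>i i'. tens (J \<times> L) (map_prod a c) (map_prod b d) X Y (i, k) (i', k'))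
      = tens J a b (\<lambda>i i'. X (i, c k) (i', c k')) (\<lambda>i i'. Y (i, d k) (i', d k'))"
      by (auto simp: tens_def op_restrict_def fun_eq_iff)
    then show ?thesis using True T[OF block_ops[OF X(1)] block_ops[OF X(2)]]
      by (simp add: ext_id_def) (simp add: tens_def op_restrict_def)
  next
    case False
    then have "(\<lambda>i i'. tens (J \<times> L) (map_prod a c) (map_prod b d) X Y (i, k) (i', k')) = (\<lambda>_ _. 0)"
      by (auto simp: tens_def op_restrict_def fun_eq_iff)
    then show ?thesis using False zero by (auto simp: ext_id_def tens_def op_restrict_def)
  qed
  then show ?thesis by (auto simp: fun_eq_iff)
qed

lemma swap_last_tens:
  "swap_last (tens ((J \<times> K) \<times> L) (map_prod (map_prod a c) e) (map_prod (map_prod b d) f) X Y)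
   = tens ((J \<times> L) \<times> K) (map_prod (map_prod a e) c) (map_prod (map_prod b f) d) (swap_last X) (swap_last Y)"
  by (auto simp: swap_last_def tens_def op_restrict_def fun_eq_iff)

lemma swap_last_ops: "X \<in> ops ((I \<times> J) \<times> K) \<Longrightarrow> swap_last X \<in> ops ((I \<times> K) \<times> J)"
  by (auto simp: ops_def swap_last_def; blast)

lemma map_pow_add:
  "map_pow (m + n) I J \<Phi> (tens (sys_pow (m + n) I) (take m) (drop m) X Y)
   = tens (sys_pow (m + n) J) (take m) (drop m) (map_pow m I J \<Phi> X) (map_pow n I J \<Phi> Y)"
proof -
  have pr: "(\<Prod>k<m + n. g k) = (\<Prod>k<m. g k) * (\<Prod>k<n. g (m + k))" for g :: "nat \<Rightarrow> complex"
    by (induction n) (simp_all add: mult.assoc)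
  have "(\<Sum>xs\<in>sys_pow (m + n) I. \<Sum>xs'\<in>sys_pow (m + n) I. tens (sys_pow (m + n) I) (take m) (drop m) X Y xs xs' *
        (\<Prod>k<m + n. \<Phi> (op_unit (xs ! k) (xs' ! k)) (ys ! k) (ys' ! k)))
    = map_pow m I J \<Phi> X (take m ys) (take m ys') * map_pow n I J \<Phi> Y (drop m ys) (drop m ys')"
    if ys: "ys \<in> sys_pow (m + n) J" "ys' \<in> sys_pow (m + n) J" for ys ys'
  proof -
    let ?f = "\<lambda>xs xs'. X xs xs' * (\<Prod>k<m. \<Phi> (op_unit (xs ! k) (xs' ! k)) (take m ys ! k) (take m ys' ! k))"
    let ?g = "\<lambda>xs xs'. Y xs xs' * (\<Prod>k<n. \<Phi> (op_unit (xs ! k) (xs' ! k)) (drop m ys ! k) (drop m ys' ! k))"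
    note sp = splits_sys_pow[of m n I]
    have "(\<Sum>xs\<in>sys_pow (m + n) I. \<Sum>xs'\<in>sys_pow (m + n) I. tens (sys_pow (m + n) I) (take m) (drop m) X Y xs xs' *
        (\<Prod>k<m + n. \<Phi> (op_unit (xs ! k) (xs' ! k)) (ys ! k) (ys' ! k)))
      = (\<Sum>xs\<in>sys_pow (m + n) I. \<Sum>xs'\<in>sys_pow (m + n) I. ?f (take m xs) (take m xs') * ?g (drop m xs) (drop m xs'))"
    proof (intro sum.cong refl)
      fix xs xs' assume xs: "xs \<in> sys_pow (m + n) I" "xs' \<in> sys_pow (m + n) I"
      have len: "length xs = m + n" "length xs' = m + n" "length ys = m + n" "length ys' = m + n"
        using xs ys by (auto simp: sys_pow_def)
      show "tens (sys_pow (m + n) I) (take m) (drop m) X Y xs xs' *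
        (\<Prod>k<m + n. \<Phi> (op_unit (xs ! k) (xs' ! k)) (ys ! k) (ys' ! k))
        = ?f (take m xs) (take m xs') * ?g (drop m xs) (drop m xs')"
        using xs len unfolding pr by (simp add: tens_def op_restrict_def mult_ac)
    qed
    also have "\<dots> = (\<Sum>xs\<in>sys_pow (m + n) I. sum (?f (take m xs)) (sys_pow m I) * sum (?g (drop m xs)) (sys_pow n I))"
      by (intro sum.cong refl) (rule sum_splits_mult[OF sp])
    also have "\<dots> = (\<Sum>p\<in>sys_pow m I. sum (?f p) (sys_pow m I)) * (\<Sum>p\<in>sys_pow n I. sum (?g p) (sys_pow n I))"
      by (rule sum_splits_mult[OF sp, of "\<lambda>p. sum (?f p) (sys_pow m I)" "\<lambda>p. sum (?g p) (sys_pow n I)"])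
    also have "\<dots> = map_pow m I J \<Phi> X (take m ys) (take m ys') * map_pow n I J \<Phi> Y (drop m ys) (drop m ys')"
      using splits_mem[OF splits_sys_pow ys(1)] splits_mem[OF splits_sys_pow ys(2)]
      by (simp add: map_pow_def op_restrict_def)
    finally show ?thesis .
  qed
  then show ?thesis
    by (subst map_pow_def) (auto simp: op_restrict_def tens_def fun_eq_iff)
qed

lemma superch_pow_sys [simp]:
  "sysA (superch_pow n \<Theta>) = sys_pow n (sysA \<Theta>)" "sysB (superch_pow n \<Theta>) = sys_pow n (sysB \<Theta>)"
  "sysC (superch_pow n \<Theta>) = sys_pow n (sysC \<Theta>)" "sysD (superch_pow n \<Theta>) = sys_pow n (sysD \<Theta>)"
  "sysS (superch_pow n \<Theta>) = sys_pow n (sysS \<Theta>)"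
  by (simp_all add: superch_pow_def)

lemma sys_pow_zip: "xs \<in> sys_pow n I \<Longrightarrow> ys \<in> sys_pow n J \<Longrightarrow> zip xs ys \<in> sys_pow n (I \<times> J)"
  using bij_betwE[OF zip_bij[of n I J]] by force

text \<open>\<open>zip\<close> commutes with \<open>take\<close> and \<open>drop\<close>, so the
  identification of lists of pairs with pairs of lists respects cutting at position m.\<close>

lemma enc_pow_add:
  "enc (superch_pow (m + n) \<Theta>) (tens (sys_pow (m + n) (sysC \<Theta>)) (take m) (drop m) X Y)
   = tens (sys_pow (m + n) (sysA \<Theta>) \<times> sys_pow (m + n) (sysS \<Theta>)) (map_prod (take m) (take m)) (map_prod (drop m) (drop m))
       (enc (superch_pow m \<Theta>) X) (enc (superch_pow n \<Theta>) Y)"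
proof -
  have "as \<in> sys_pow (m + n) I \<Longrightarrow> take m as \<in> sys_pow m I" "as \<in> sys_pow (m + n) I \<Longrightarrow> drop m as \<in> sys_pow n I"
    for as :: "'x list" and I
    using splits_mem[OF splits_sys_pow] by blast+
  note mem = this this
  show ?thesis
    unfolding superch_pow_def superch.simps map_pow_add
    by (auto simp: tens_def op_restrict_def fun_eq_iff sys_pow_zip mem take_zip drop_zip)
qed

lemma sys_pow_Times_iff:
  "zs \<in> sys_pow n (I \<times> J) \<longleftrightarrow> map fst zs \<in> sys_pow n I \<and> map snd zs \<in> sys_pow n J"
  by (auto simp: sys_pow_def subset_iff)

lemma dec_pow_add:
  "dec (superch_pow (m + n) \<Theta>) (tens (sys_pow (m + n) (sysB \<Theta>) \<times> sys_pow (m + n) (sysS \<Theta>))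
       (map_prod (take m) (take m)) (map_prod (drop m) (drop m)) X Y)
   = tens (sys_pow (m + n) (sysD \<Theta>)) (take m) (drop m) (dec (superch_pow m \<Theta>) X) (dec (superch_pow n \<Theta>) Y)"
proof -
  let ?u = "\<lambda>Z zs zs'. Z (map fst zs, map snd zs) (map fst zs', map snd zs') :: complex"
  have "?u (tens (sys_pow (m + n) (sysB \<Theta>) \<times> sys_pow (m + n) (sysS \<Theta>))
       (map_prod (take m) (take m)) (map_prod (drop m) (drop m)) X Y)
    = tens (sys_pow (m + n) (sysB \<Theta> \<times> sysS \<Theta>)) (take m) (drop m) (?u X) (?u Y)"
    by (auto simp: tens_def op_restrict_def fun_eq_iff sys_pow_Times_iff take_map drop_map)
  then show ?thesis by (simp add: superch_pow_def map_pow_add)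
qed

text \<open>Every stage of \<open>superch_apply\<close> sends product operators to product
  operators; the pairs X1, Y1 to X4, Y4 are the intermediate factors. Only inputs and joint channels
  of product form are treated, which suffices for running two strategies side by side.\<close>

lemma superch_apply_tens:
  assumes S: "superchannel \<Theta>" and R: "splits R c d R1 R2" and finR: "finite R1" "finite R2"
    and N1: "channel (sys_pow m (sysA \<Theta>) \<times> R1) (sys_pow m (sysB \<Theta>) \<times> R1) N1"
    and N2: "channel (sys_pow n (sysA \<Theta>) \<times> R2) (sys_pow n (sysB \<Theta>) \<times> R2) N2"
    and X: "X \<in> ops (sys_pow m (sysC \<Theta>) \<times> R1)" "Y \<in> ops (sys_pow n (sysC \<Theta>) \<times> R2)"
  shows "superch_apply (superch_pow (m + n) \<Theta>)
      (tens_map (sys_pow (m + n) (sysA \<Theta>) \<times> R) (map_prod (take m) c) (map_prod (drop m) d) (sys_pow (m + n) (sysB \<Theta>) \<times> R) (map_prod (take m) c) (map_prod (drop m) d) N1 N2)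
      (tens (sys_pow (m + n) (sysC \<Theta>) \<times> R) (map_prod (take m) c) (map_prod (drop m) d) X Y)
    = tens (sys_pow (m + n) (sysD \<Theta>) \<times> R) (map_prod (take m) c) (map_prod (drop m) d)
      (superch_apply (superch_pow m \<Theta>) N1 X) (superch_apply (superch_pow n \<Theta>) N2 Y)"
proof -
  have fin: "finite (sysA \<Theta>)" "finite (sysB \<Theta>)" "finite (sysC \<Theta>)" "finite (sysD \<Theta>)" "finite (sysS \<Theta>)"
    using S by (simp_all add: superchannel_def system_def)
  have lin: "linear_map (sys_pow k (sysC \<Theta>)) (sys_pow k (sysA \<Theta>) \<times> sys_pow k (sysS \<Theta>)) (enc (superch_pow k \<Theta>))"
     "linear_map (sys_pow k (sysB \<Theta>) \<times> sys_pow k (sysS \<Theta>)) (sys_pow k (sysD \<Theta>)) (dec (superch_pow k \<Theta>))" for k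
    using superchannel_pow[OF S, of k] channel_linear by (auto simp: superchannel_def)
  let ?N = "tens_map (sys_pow (m + n) (sysA \<Theta>) \<times> R) (map_prod (take m) c) (map_prod (drop m) d) (sys_pow (m + n) (sysB \<Theta>) \<times> R) (map_prod (take m) c) (map_prod (drop m) d) N1 N2"
  have chN: "channel (sys_pow (m + n) (sysA \<Theta>) \<times> R) (sys_pow (m + n) (sysB \<Theta>) \<times> R) ?N"
    by (rule channel_tens_map[OF splits_Times[OF splits_sys_pow R] splits_Times[OF splits_sys_pow R] _ _ _ _ N1 N2])
      (use fin finR in auto)
  define X1 Y1 where "X1 = ext_id (enc (superch_pow m \<Theta>)) X" and "Y1 = ext_id (enc (superch_pow n \<Theta>)) Y"
  have o1: "X1 \<in> ops ((sys_pow m (sysA \<Theta>) \<times> sys_pow m (sysS \<Theta>)) \<times> R1)"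
    "Y1 \<in> ops ((sys_pow n (sysA \<Theta>) \<times> sys_pow n (sysS \<Theta>)) \<times> R2)"
    unfolding X1_def Y1_def by (rule ext_id_ops[OF lin(1) X(1)] ext_id_ops[OF lin(1) X(2)])+
  have e1: "ext_id (enc (superch_pow (m + n) \<Theta>)) (tens (sys_pow (m + n) (sysC \<Theta>) \<times> R) (map_prod (take m) c) (map_prod (drop m) d) X Y)
    = tens ((sys_pow (m + n) (sysA \<Theta>) \<times> sys_pow (m + n) (sysS \<Theta>)) \<times> R)
        (map_prod (map_prod (take m) (take m)) c) (map_prod (map_prod (drop m) (drop m)) d) X1 Y1"
    unfolding X1_def Y1_def
    by (rule ext_id_tens[OF enc_pow_add linear_map_zero[OF lin(1)] X])
  define X2 Y2 where "X2 = swap_last X1" and "Y2 = swap_last Y1"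
  have o2: "X2 \<in> ops ((sys_pow m (sysA \<Theta>) \<times> R1) \<times> sys_pow m (sysS \<Theta>))"
    "Y2 \<in> ops ((sys_pow n (sysA \<Theta>) \<times> R2) \<times> sys_pow n (sysS \<Theta>))"
    unfolding X2_def Y2_def by (rule swap_last_ops[OF o1(1)] swap_last_ops[OF o1(2)])+
  define X3 Y3 where "X3 = ext_id N1 X2" and "Y3 = ext_id N2 Y2"
  have o3: "X3 \<in> ops ((sys_pow m (sysB \<Theta>) \<times> R1) \<times> sys_pow m (sysS \<Theta>))"
    "Y3 \<in> ops ((sys_pow n (sysB \<Theta>) \<times> R2) \<times> sys_pow n (sysS \<Theta>))"
    unfolding X3_def Y3_def
    by (rule ext_id_ops[OF channel_linear[OF N1] o2(1)] ext_id_ops[OF channel_linear[OF N2] o2(2)])+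
  have e3: "ext_id ?N (tens ((sys_pow (m + n) (sysA \<Theta>) \<times> R) \<times> sys_pow (m + n) (sysS \<Theta>))
      (map_prod (map_prod (take m) c) (take m)) (map_prod (map_prod (drop m) d) (drop m)) X2 Y2)
    = tens ((sys_pow (m + n) (sysB \<Theta>) \<times> R) \<times> sys_pow (m + n) (sysS \<Theta>))
      (map_prod (map_prod (take m) c) (take m)) (map_prod (map_prod (drop m) d) (drop m)) X3 Y3"
    unfolding X3_def Y3_def
  proof (rule ext_id_tens[where \<Phi> = ?N, OF _ linear_map_zero[OF channel_linear[OF chN]] o2])
    fix Z W assume "Z \<in> ops (sys_pow m (sysA \<Theta>) \<times> R1)" "W \<in> ops (sys_pow n (sysA \<Theta>) \<times> R2)"
    then show "?N (tens (sys_pow (m + n) (sysA \<Theta>) \<times> R) (map_prod (take m) c) (map_prod (drop m) d) Z W) = tens (sys_pow (m + n) (sysB \<Theta>) \<times> R) (map_prod (take m) c) (map_prod (drop m) d) (N1 Z) (N2 W)"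
      using fin finR by (intro tens_map_tens[OF _ _ _ channel_linear[OF N1] channel_linear[OF N2]])
        (auto intro: splits_Times[OF splits_sys_pow R])
  qed
  define X4 Y4 where "X4 = swap_last X3" and "Y4 = swap_last Y3"
  have o4: "X4 \<in> ops ((sys_pow m (sysB \<Theta>) \<times> sys_pow m (sysS \<Theta>)) \<times> R1)"
    "Y4 \<in> ops ((sys_pow n (sysB \<Theta>) \<times> sys_pow n (sysS \<Theta>)) \<times> R2)"
    unfolding X4_def Y4_def by (rule swap_last_ops[OF o3(1)] swap_last_ops[OF o3(2)])+
  have e5: "ext_id (dec (superch_pow (m + n) \<Theta>)) (tens ((sys_pow (m + n) (sysB \<Theta>) \<times> sys_pow (m + n) (sysS \<Theta>)) \<times> R)
        (map_prod (map_prod (take m) (take m)) c) (map_prod (map_prod (drop m) (drop m)) d) X4 Y4)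
    = tens (sys_pow (m + n) (sysD \<Theta>) \<times> R) (map_prod (take m) c) (map_prod (drop m) d) (ext_id (dec (superch_pow m \<Theta>)) X4) (ext_id (dec (superch_pow n \<Theta>)) Y4)"
    by (rule ext_id_tens[OF dec_pow_add linear_map_zero[OF lin(2)] o4])
  show ?thesis
    unfolding superch_apply_def comp_apply e1 swap_last_tens X2_def[symmetric] Y2_def[symmetric] e3
      X4_def[symmetric] Y4_def[symmetric] e5
    unfolding X4_def Y4_def X3_def Y3_def X2_def Y2_def X1_def Y1_def ..
qed


section \<open>Realizable exponents\<close>

lemma state_pure:
  assumes "finite I" "z \<in> I"
  shows "state I (op_unit z z)"
proof -
  have "op_unit z z = (\<lambda>i j. \<Sum>k\<in>{()}. basis_vec z i * cnj (basis_vec z j))"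
    by (auto simp: op_unit_def basis_vec_def fun_eq_iff)
  moreover have "psd I (\<lambda>i j. \<Sum>k\<in>{()}. basis_vec z i * cnj (basis_vec z j))"
    by (rule gram_psd) (rule basis_vec_in_vecs[OF assms(2)])
  moreover have "op_trace I (op_unit z z) = (\<Sum>i\<in>I. if i = z then 1 else 0)"
    unfolding op_trace_def by (intro sum.cong refl) (simp add: op_unit_def)
  ultimately show ?thesis using assms by (simp add: state_def)
qed

text \<open>Discard the input and prepare a fixed basis state. The Choi matrix is that pure state
  tensored with the identity. It provides a channel for the padding strategies.\<close>

lemma channel_replace:
  fixes I :: "'i set" and J :: "'j set"
  assumes fin: "finite I" "finite J" and z: "z \<in> J"
  shows "channel I J (\<lambda>X. op_restrict J (\<lambda>j j'. op_trace I X * op_unit z z j j'))" (is "channel I J ?\<Phi>")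
proof (rule channelI[OF fin])
  show "linear_map I J ?\<Phi>"
    by (auto simp: linear_map_def ops_def op_restrict_def fun_eq_iff op_trace_def
        sum.distrib sum_distrib_left sum_distrib_right algebra_simps)
  have tr: "op_trace I (op_unit a b) = (if a = b then 1 else 0)" if "a \<in> I" "b \<in> I" for a b
  proof -
    have "op_trace I (op_unit a b) = (\<Sum>i\<in>I. if i = a then (if a = b then 1 else 0) else 0)"
      unfolding op_trace_def by (intro sum.cong refl) (auto simp: op_unit_def)
    then show ?thesis using fin that by simp
  qed
  have "choi I J ?\<Phi> = (\<lambda>x y. \<Sum>k\<in>I. basis_vec (z, k) x * cnj (basis_vec (z, k) y))"
  proof (intro ext)
    fix x y :: "'j \<times> 'i"
    obtain j a j' b where xy: "x = (j, a)" "y = (j', b)" by (metis surj_pair)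
    have "(\<Sum>k\<in>I. basis_vec (z, k) x * cnj (basis_vec (z, k) y))
      = (\<Sum>k\<in>I. if k = a then (if a = b \<and> j = z \<and> j' = z then 1 else 0) else 0)"
      unfolding xy by (intro sum.cong refl) (auto simp: basis_vec_def)
    also have "\<dots> = choi I J ?\<Phi> x y"
      using fin z unfolding xy by (auto simp: choi_def op_restrict_def tr op_unit_def[of z z])
    finally show "choi I J ?\<Phi> x y = (\<Sum>k\<in>I. basis_vec (z, k) x * cnj (basis_vec (z, k) y))" by simp
  qed
  moreover have "psd (J \<times> I) (\<lambda>x y. \<Sum>k\<in>I. basis_vec (z, k) x * cnj (basis_vec (z, k) y))"
    by (rule gram_psd) (use z in \<open>auto intro: basis_vec_in_vecs\<close>)
  ultimately show "psd (J \<times> I) (choi I J ?\<Phi>)" by (simp only:)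
  fix a b assume ab: "a \<in> I" "b \<in> I"
  have "op_trace J (?\<Phi> (op_unit a b)) = (\<Sum>j\<in>J. if j = z then (if a = b then 1 else 0) else 0)"
    unfolding op_trace_def[of J] by (intro sum.cong refl) (auto simp: op_restrict_def tr ab op_unit_def[of z z])
  then show "op_trace J (?\<Phi> (op_unit a b)) = (if a = b then 1 else 0)" using fin z by simp
qed

section \<open>Strategies for a fixed pair of superchannels\<close>

locale superchannel_pair =
  fixes \<Theta>1 :: "('a, 'b, 'c, 'd, 's) superch" and \<Theta>2 :: "('a, 'b, 'c, 'd, 't) superch"
  assumes sc1: "superchannel \<Theta>1" and sc2: "superchannel \<Theta>2" and same: "same_systems \<Theta>1 \<Theta>2"
begin

lemma sys_eq: "sysA \<Theta>2 = sysA \<Theta>1" "sysB \<Theta>2 = sysB \<Theta>1" "sysC \<Theta>2 = sysC \<Theta>1" "sysD \<Theta>2 = sysD \<Theta>1"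
  using same by (simp_all add: same_systems_def)

lemma fin: "finite (sysA \<Theta>1)" "finite (sysB \<Theta>1)" "finite (sysC \<Theta>1)" "finite (sysD \<Theta>1)"
  using sc1 by (simp_all add: superchannel_def system_def)

definition admissible :: "nat \<Rightarrow> nat \<Rightarrow> ('c list \<times> nat) op \<Rightarrow> ('a list \<times> nat, 'b list \<times> nat) smap \<Rightarrow> bool" where
  "admissible n r \<rho> N \<longleftrightarrow> 0 < r \<and> state (sys_pow n (sysC \<Theta>1) \<times> {..<r}) \<rho> \<and>
     channel (sys_pow n (sysA \<Theta>1) \<times> {..<r}) (sys_pow n (sysB \<Theta>1) \<times> {..<r}) N"

text \<open>Records a strategy by its moments only and leaves out the POVM, which
  \<open>stein_test\<close> supplies after the strategies have been combined.\<close>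

definition realizable :: "nat \<Rightarrow> real \<Rightarrow> real \<Rightarrow> real \<Rightarrow> real \<Rightarrow> bool" where
  "realizable n \<mu> V \<nu> W \<longleftrightarrow> (\<exists>r \<rho> N. admissible n r \<rho> N \<and>
     stein_data (sys_pow n (sysD \<Theta>1) \<times> {..<r})
       (superch_apply (superch_pow n \<Theta>1) N \<rho>) (superch_apply (superch_pow n \<Theta>2) N \<rho>) \<mu> V \<nu> W)"

definition divs :: "nat \<Rightarrow> ereal" where
  "divs n = superch_div (superch_pow n \<Theta>1) (superch_pow n \<Theta>2)"

lemma output_states:
  assumes "admissible n r \<rho> N"
  shows "state (sys_pow n (sysD \<Theta>1) \<times> {..<r}) (superch_apply (superch_pow n \<Theta>1) N \<rho>)"
    "state (sys_pow n (sysD \<Theta>1) \<times> {..<r}) (superch_apply (superch_pow n \<Theta>2) N \<rho>)"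
  using state_superch_apply[OF superchannel_pow[OF sc1, of n], of "{..<r}" N \<rho>]
    state_superch_apply[OF superchannel_pow[OF sc2, of n], of "{..<r}" N \<rho>] assms
  by (simp_all add: admissible_def sys_eq)

lemma divs_eq: "divs n = Sup {rel_entropy (sys_pow n (sysD \<Theta>1) \<times> {..<r})
    (superch_apply (superch_pow n \<Theta>1) N \<rho>) (superch_apply (superch_pow n \<Theta>2) N \<rho>) | r \<rho> N. admissible n r \<rho> N}"
  by (simp add: divs_def superch_div_def admissible_def)

lemma realizable_of_divs:
  assumes "ereal c < divs n"
  shows "\<exists>\<mu> V \<nu> W. realizable n \<mu> V \<nu> W \<and> c < \<nu> - \<mu>"
proof -
  obtain r \<rho> N where adm: "admissible n r \<rho> N" and
    lt: "ereal c < rel_entropy (sys_pow n (sysD \<Theta>1) \<times> {..<r})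
      (superch_apply (superch_pow n \<Theta>1) N \<rho>) (superch_apply (superch_pow n \<Theta>2) N \<rho>)"
    using assms unfolding divs_eq less_Sup_iff by auto
  have "finite (sys_pow n (sysD \<Theta>1) \<times> {..<r})" using fin by simp
  from stein_data_of_rel_entropy[OF this output_states(1)[OF adm] _ lt] output_states(2)[OF adm]
  show ?thesis using adm unfolding realizable_def state_def by blast
qed

lemma divs_of_realizable:
  assumes "realizable n \<mu> V \<nu> W"
  shows "ereal (\<nu> - \<mu>) \<le> divs n"
proof -
  obtain r \<rho> N where adm: "admissible n r \<rho> N" and
    d: "stein_data (sys_pow n (sysD \<Theta>1) \<times> {..<r})
       (superch_apply (superch_pow n \<Theta>1) N \<rho>) (superch_apply (superch_pow n \<Theta>2) N \<rho>) \<mu> V \<nu> W"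
    using assms unfolding realizable_def by blast
  have "finite (sys_pow n (sysD \<Theta>1) \<times> {..<r})" using fin by simp
  from stein_data_le_rel_entropy[OF this d] show ?thesis
    unfolding divs_eq by (rule order_trans) (use adm in \<open>auto intro!: Sup_upper\<close>)
qed

text \<open>The product input and product channel do not depend on which superchannel acts, and both
  outputs factorise along the same splitting, so \<open>stein_data_tens\<close> applies to the
  pair.\<close>

lemma realizable_add:
  assumes "realizable m \<mu> V \<nu> W" "realizable n \<mu>' V' \<nu>' W'"
  shows "realizable (m + n) (\<mu> + \<mu>') (V + V') (\<nu> + \<nu>') (W + W')"
proof -
  obtain r \<rho> N where adm: "admissible m r \<rho> N" and
    d: "stein_data (sys_pow m (sysD \<Theta>1) \<times> {..<r})
       (superch_apply (superch_pow m \<Theta>1) N \<rho>) (superch_apply (superch_pow m \<Theta>2) N \<rho>) \<mu> V \<nu> W"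
    using assms(1) unfolding realizable_def by blast
  obtain r' \<rho>' N' where adm': "admissible n r' \<rho>' N'" and
    d': "stein_data (sys_pow n (sysD \<Theta>1) \<times> {..<r'})
       (superch_apply (superch_pow n \<Theta>1) N' \<rho>') (superch_apply (superch_pow n \<Theta>2) N' \<rho>') \<mu>' V' \<nu>' W'"
    using assms(2) unfolding realizable_def by blast
  have r: "0 < r" "0 < r'" using adm adm' by (simp_all add: admissible_def)
  note R = splits_lessThan[OF r(2), of r]
  let ?a = "map_prod (take m) (\<lambda>t. t div r')" and ?b = "map_prod (drop m) (\<lambda>t. t mod r')"
  have st: "state (sys_pow m (sysC \<Theta>1) \<times> {..<r}) \<rho>" "state (sys_pow n (sysC \<Theta>1) \<times> {..<r'}) \<rho>'"
    and ch: "channel (sys_pow m (sysA \<Theta>1) \<times> {..<r}) (sys_pow m (sysB \<Theta>1) \<times> {..<r}) N"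
      "channel (sys_pow n (sysA \<Theta>1) \<times> {..<r'}) (sys_pow n (sysB \<Theta>1) \<times> {..<r'}) N'"
    using adm adm' by (simp_all add: admissible_def)
  have ops: "\<rho> \<in> ops (sys_pow m (sysC \<Theta>1) \<times> {..<r})" "\<rho>' \<in> ops (sys_pow n (sysC \<Theta>1) \<times> {..<r'})"
    using st psd_ops unfolding state_def by blast+
  let ?N = "tens_map (sys_pow (m + n) (sysA \<Theta>1) \<times> {..<r * r'}) ?a ?b (sys_pow (m + n) (sysB \<Theta>1) \<times> {..<r * r'}) ?a ?b N N'"
  let ?\<rho> = "tens (sys_pow (m + n) (sysC \<Theta>1) \<times> {..<r * r'}) ?a ?b \<rho> \<rho>'"
  have "admissible (m + n) (r * r') ?\<rho> ?N"
    unfolding admissible_def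
  proof (intro conjI)
    show "state (sys_pow (m + n) (sysC \<Theta>1) \<times> {..<r * r'}) ?\<rho>"
      by (rule state_tens[OF splits_Times[OF splits_sys_pow R] _ _ st]) (use fin in auto)
    show "channel (sys_pow (m + n) (sysA \<Theta>1) \<times> {..<r * r'}) (sys_pow (m + n) (sysB \<Theta>1) \<times> {..<r * r'}) ?N"
      by (rule channel_tens_map[OF splits_Times[OF splits_sys_pow R] splits_Times[OF splits_sys_pow R] _ _ _ _ ch])
        (use fin in auto)
  qed (use r in simp)
  moreover have "stein_data (sys_pow (m + n) (sysD \<Theta>1) \<times> {..<r * r'})
      (superch_apply (superch_pow (m + n) \<Theta>1) ?N ?\<rho>) (superch_apply (superch_pow (m + n) \<Theta>2) ?N ?\<rho>)
      (\<mu> + \<mu>') (V + V') (\<nu> + \<nu>') (W + W')"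
    unfolding superch_apply_tens[OF sc1 R finite_lessThan finite_lessThan ch ops]
      superch_apply_tens[OF sc2 R finite_lessThan finite_lessThan, unfolded sys_eq, OF ch ops]
    by (rule stein_data_tens[OF splits_Times[OF splits_sys_pow R] d d'])
  ultimately show ?thesis unfolding realizable_def by blast
qed

lemma realizable_iterate:
  assumes "realizable m \<mu> V \<nu> W" "realizable n \<mu>' V' \<nu>' W'"
  shows "realizable (k * m + n) (real k * \<mu> + \<mu>') (real k * V + V') (real k * \<nu> + \<nu>') (real k * W + W')"
proof (induction k)
  case 0
  then show ?case using assms(2) by simp
next
  case (Suc k)
  from realizable_add[OF assms(1) Suc] show ?case by (simp add: algebra_simps)
qed

text \<open>Padding for incomplete blocks: basis states, a replacement channel and a one-dimensional
  reference.\<close>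

lemma realizable_trivial: "\<exists>\<mu> V W. realizable n \<mu> V 0 W"
proof -
  have "system (sys_pow n (sysC \<Theta>1))" "system (sys_pow n (sysB \<Theta>1))"
    using sc1 system_sys_pow unfolding superchannel_def by blast+
  then obtain x y where "x \<in> sys_pow n (sysC \<Theta>1)" "y \<in> sys_pow n (sysB \<Theta>1)"
    by (auto simp: system_def)
  then have xy: "(x, 0::nat) \<in> sys_pow n (sysC \<Theta>1) \<times> {..<1}" "(y, 0::nat) \<in> sys_pow n (sysB \<Theta>1) \<times> {..<1}"
    by auto
  have f: "finite (sys_pow n (sysA \<Theta>1) \<times> {..<1::nat})" "finite (sys_pow n (sysB \<Theta>1) \<times> {..<1::nat})"
    "finite (sys_pow n (sysC \<Theta>1) \<times> {..<1::nat})" "finite (sys_pow n (sysD \<Theta>1) \<times> {..<1::nat})"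
    using fin by auto
  have adm: "admissible n 1 (op_unit (x, 0) (x, 0)) (\<lambda>X. op_restrict (sys_pow n (sysB \<Theta>1) \<times> {..<1})
      (\<lambda>j j'. op_trace (sys_pow n (sysA \<Theta>1) \<times> {..<1}) X * op_unit (y, 0) (y, 0) j j'))"
    unfolding admissible_def using state_pure[OF f(3) xy(1)] channel_replace[OF f(1,2) xy(2)] by blast
  from stein_data_trivial[OF f(4) output_states[OF adm]] show ?thesis
    using adm unfolding realizable_def by blast
qed

lemma stein_of_realizable:
  assumes d: "realizable n \<mu> V \<nu> W" and t: "0 < t" and \<epsilon>: "(V + W) / t\<^sup>2 \<le> \<epsilon>"
  shows "ereal ((\<nu> - \<mu> - 2 * t) / real n) \<le> stein_fp n \<epsilon> \<Theta>1 \<Theta>2"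
proof -
  obtain r \<rho> N where adm: "admissible n r \<rho> N" and
    d: "stein_data (sys_pow n (sysD \<Theta>1) \<times> {..<r})
       (superch_apply (superch_pow n \<Theta>1) N \<rho>) (superch_apply (superch_pow n \<Theta>2) N \<rho>) \<mu> V \<nu> W"
    using d unfolding realizable_def by blast
  let ?J = "sys_pow n (sysD \<Theta>1) \<times> {..<r}"
  have "finite ?J" using fin by simp
  from stein_test[OF this output_states(1)[OF adm] d t] obtain Q1 Q2 where Q: "binary_povm ?J Q1 Q2"
    "Re (op_trace ?J (op_mult ?J Q2 (superch_apply (superch_pow n \<Theta>1) N \<rho>))) \<le> (V + W) / t\<^sup>2"
    "0 \<le> Re (op_trace ?J (op_mult ?J Q1 (superch_apply (superch_pow n \<Theta>2) N \<rho>)))"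
    "Re (op_trace ?J (op_mult ?J Q1 (superch_apply (superch_pow n \<Theta>2) N \<rho>))) \<le> 2 powr (\<mu> - \<nu> + 2 * t)"
    by blast
  define S where "S = \<lparr>ref_dim = r, input = \<rho>, chan = N, test1 = Q1, test2 = Q2\<rparr>"
  have S: "fp_strategy n \<Theta>1 S" using adm Q(1) by (simp add: fp_strategy_def S_def admissible_def)
  have e1: "err1 n \<Theta>1 S \<le> \<epsilon>" using Q(2) \<epsilon> by (simp add: err1_def S_def fp_output_def Let_def)
  have e2: "0 \<le> err2 n \<Theta>2 S" "err2 n \<Theta>2 S \<le> 2 powr (\<mu> - \<nu> + 2 * t)"
    using Q(3,4) by (simp_all add: err2_def S_def fp_output_def Let_def sys_eq)
  have "ereal (\<nu> - \<mu> - 2 * t) \<le> neg_log2 (err2 n \<Theta>2 S)"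
  proof (cases "err2 n \<Theta>2 S = 0")
    case False
    then have "log 2 (err2 n \<Theta>2 S) \<le> log 2 (2 powr (\<mu> - \<nu> + 2 * t))"
      using e2 by (intro log_mono) auto
    then show ?thesis using False by (simp add: neg_log2_def)
  qed (simp add: neg_log2_def)
  then have "ereal (1 / real n) * ereal (\<nu> - \<mu> - 2 * t) \<le> ereal (1 / real n) * neg_log2 (err2 n \<Theta>2 S)"
    by (intro ereal_mult_left_mono) auto
  also have "\<dots> \<le> stein_fp n \<epsilon> \<Theta>1 \<Theta>2"
    unfolding stein_fp_def by (rule Sup_upper) (use S e1 in blast)
  finally show ?thesis by simp
qed

end


section \<open>Asymptotics\<close>

text \<open>Replacing \<open>n div m\<close> by n / m alters the numerator by an amount that depends
  only on the remainder, hence takes finitely many values.\<close>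

lemma tendsto_div_mod_ratio:
  fixes d :: real and b :: "nat \<Rightarrow> real"
  assumes m: "0 < m"
  shows "(\<lambda>n. (real (n div m) * d + b (n mod m)) / real n) \<longlonglongrightarrow> d / real m"
proof -
  \<comment> \<open>The deviation of the numerator from d * n / m at remainder r.\<close>
  define c where "c r = b r - d * real r / real m" for r
  define C where "C = (\<Sum>r<m. \<bar>c r\<bar>)"
  have C: "\<bar>c (n mod m)\<bar> \<le> C" for n
    unfolding C_def using m by (intro member_le_sum[of "n mod m" "{..<m}" "\<lambda>r. \<bar>c r\<bar>"]) auto
  have "(\<lambda>n. C / real n) \<longlonglongrightarrow> 0" by (rule lim_const_over_n)
  then have z: "(\<lambda>n. c (n mod m) / real n) \<longlonglongrightarrow> 0"
    by (rule Lim_null_comparison[rotated]) (auto intro!: always_eventually divide_right_mono simp: C abs_divide)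
  have "(\<lambda>n. d / real m + c (n mod m) / real n) \<longlonglongrightarrow> d / real m + 0"
    by (intro tendsto_intros z)
  moreover have "eventually (\<lambda>n. d / real m + c (n mod m) / real n = (real (n div m) * d + b (n mod m)) / real n) sequentially"
  proof (rule eventually_sequentiallyI[of 1])
    fix n :: nat assume n: "1 \<le> n"
    have "real n = real (n div m) * real m + real (n mod m)"
      by (metis of_nat_add of_nat_mult div_mult_mod_eq)
    moreover have "d * (q * M + r) / M = q * d + d * r / M" if "0 < M" for q r M :: real
      using that by (simp add: field_simps)
    ultimately have "d * real n / real m = real (n div m) * d + d * real (n mod m) / real m"
      using m by (metis of_nat_0_less_iff)
    moreover have "d / real m = (d * real n / real m) / real n" using n by simp
    ultimately show "d / real m + c (n mod m) / real n = (real (n div m) * d + b (n mod m)) / real n"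
      by (simp add: c_def flip: add_divide_distrib)
  qed
  ultimately show ?thesis by (simp add: filterlim_cong tendsto_cong)
qed

lemma liminf_ge_of_tendsto:
  fixes f :: "nat \<Rightarrow> ereal" and g :: "nat \<Rightarrow> real"
  assumes "eventually (\<lambda>n. ereal (g n) \<le> f n) sequentially" "g \<longlonglongrightarrow> x"
  shows "ereal x \<le> liminf f"
proof -
  have "liminf (\<lambda>n. ereal (g n)) = ereal x"
    using assms(2) by (intro lim_imp_Liminf) auto
  then show ?thesis using Liminf_mono[OF assms(1)] by simp
qed

section \<open>Limits along repeated blocks\<close>

context superchannel_pair
begin

definition rates :: "nat \<Rightarrow> ereal" where
  "rates n = ereal (1 / real n) * divs n"

text \<open>Use n div m blocks of the given strategy and pad the n mod m remaining copies. The
  moments of the padding depend only on the remainder, so they disappear after division by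
  n.\<close>

lemma liminf_ge_realizable:
  assumes m: "0 < m" and d: "realizable m \<mu> V \<nu> W" and \<epsilon>: "0 < \<epsilon>"
  shows "ereal ((\<nu> - \<mu>) / real m) \<le> liminf rates"
    and "ereal ((\<nu> - \<mu>) / real m) \<le> liminf (\<lambda>n. stein_fp n \<epsilon> \<Theta>1 \<Theta>2)"
proof -
  obtain \<mu>' V' W' where triv: "\<And>r. realizable r (\<mu>' r) (V' r) 0 (W' r)"
    using realizable_trivial by metis
  define k where "k n = real (n div m)" for n
  have R: "realizable n (k n * \<mu> + \<mu>' (n mod m)) (k n * V + V' (n mod m)) (k n * \<nu> + 0) (k n * W + W' (n mod m))" for n
    using realizable_iterate[OF d triv, of "n div m" "n mod m"] by (simp add: k_def)
  show "ereal ((\<nu> - \<mu>) / real m) \<le> liminf rates"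
  proof (rule liminf_ge_of_tendsto)
    show "(\<lambda>n. (real (n div m) * (\<nu> - \<mu>) + - \<mu>' (n mod m)) / real n) \<longlonglongrightarrow> (\<nu> - \<mu>) / real m"
      by (rule tendsto_div_mod_ratio[OF m, where b = "\<lambda>r. - \<mu>' r"])
    have "ereal ((real (n div m) * (\<nu> - \<mu>) + - \<mu>' (n mod m)) / real n) \<le> rates n" for n
    proof -
      have "ereal (1 / real n) * ereal (k n * \<nu> + 0 - (k n * \<mu> + \<mu>' (n mod m))) \<le> rates n"
        unfolding rates_def by (intro ereal_mult_left_mono divs_of_realizable[OF R]) simp
      also have "ereal (1 / real n) * ereal (k n * \<nu> + 0 - (k n * \<mu> + \<mu>' (n mod m)))
        = ereal ((real (n div m) * (\<nu> - \<mu>) + - \<mu>' (n mod m)) / real n)"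
        unfolding k_def times_ereal.simps by (intro arg_cong[of _ _ ereal]) (simp add: algebra_simps diff_divide_distrib add_divide_distrib)
      finally show ?thesis .
    qed
    then show "eventually (\<lambda>n. ereal ((real (n div m) * (\<nu> - \<mu>) + - \<mu>' (n mod m)) / real n) \<le> rates n) sequentially"
      by simp
  qed
  \<comment> \<open>The deviation is t = k n * \<delta>: the first error is at most (k n * (V + W) +
    C) / (k n * \<delta>)^2, which tends to 0, at the price of 2 * \<delta> / m in the exponent. C
    bounds the variances of the padding.\<close>
  have "ereal ((\<nu> - \<mu> - 2 * \<delta>) / real m) \<le> liminf (\<lambda>n. stein_fp n \<epsilon> \<Theta>1 \<Theta>2)" if \<delta>: "0 < \<delta>" for \<delta>
  proof (rule liminf_ge_of_tendsto)
    show "(\<lambda>n. (real (n div m) * (\<nu> - \<mu> - 2 * \<delta>) + - \<mu>' (n mod m)) / real n) \<longlonglongrightarrow> (\<nu> - \<mu> - 2 * \<delta>) / real m"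
      by (rule tendsto_div_mod_ratio[OF m, where b = "\<lambda>r. - \<mu>' r"])
    define C where "C = (\<Sum>r<m. \<bar>V' r + W' r\<bar>)"
    have C: "V' (n mod m) + W' (n mod m) \<le> C" for n
    proof -
      have "\<bar>V' (n mod m) + W' (n mod m)\<bar> \<le> C"
        unfolding C_def using m by (intro member_le_sum[of "n mod m" "{..<m}" "\<lambda>r. \<bar>V' r + W' r\<bar>"]) auto
      then show ?thesis by simp
    qed
    have "eventually (\<lambda>n. Z \<le> n div m) sequentially" for Z
      by (rule eventually_sequentiallyI[of "Z * m"]) (use m in \<open>simp add: less_eq_div_iff_mult_less_eq\<close>)
    then have "filterlim (\<lambda>n. n div m) at_top sequentially" by (simp add: filterlim_at_top)
    then have kinf: "filterlim k at_top sequentially"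
      unfolding k_def by (rule filterlim_compose[OF filterlim_real_sequentially])
    have inv: "(\<lambda>n. inverse (k n)) \<longlonglongrightarrow> 0"
      by (rule tendsto_inverse_0_at_top[OF kinf])
    have "(\<lambda>n. (V + W) / \<delta>\<^sup>2 * inverse (k n) + C / \<delta>\<^sup>2 * (inverse (k n) * inverse (k n)))
        \<longlonglongrightarrow> (V + W) / \<delta>\<^sup>2 * 0 + C / \<delta>\<^sup>2 * (0 * 0)"
      by (intro tendsto_add tendsto_mult tendsto_const inv)
    moreover have "(V + W) / \<delta>\<^sup>2 * inverse (k n) + C / \<delta>\<^sup>2 * (inverse (k n) * inverse (k n))
        = (k n * (V + W) + C) / (k n * \<delta>)\<^sup>2" for n
      using \<delta> by (cases "k n = 0") (simp_all add: field_simps power2_eq_square)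
    ultimately have "(\<lambda>n. (k n * (V + W) + C) / (k n * \<delta>)\<^sup>2) \<longlonglongrightarrow> 0" by simp
    then have "eventually (\<lambda>n. (k n * (V + W) + C) / (k n * \<delta>)\<^sup>2 < \<epsilon>) sequentially"
      using \<epsilon> by (rule order_tendstoD(2))
    moreover have "eventually (\<lambda>n. 0 < k n) sequentially"
      using kinf by (simp add: filterlim_at_top_dense)
    ultimately show "eventually (\<lambda>n. ereal ((real (n div m) * (\<nu> - \<mu> - 2 * \<delta>) + - \<mu>' (n mod m)) / real n)
        \<le> stein_fp n \<epsilon> \<Theta>1 \<Theta>2) sequentially"
    proof eventually_elim
      case (elim n)
      have "k n * V + V' (n mod m) + (k n * W + W' (n mod m)) \<le> k n * (V + W) + C"
        using C[of n] by (simp add: algebra_simps)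
      then have "(k n * V + V' (n mod m) + (k n * W + W' (n mod m))) / (k n * \<delta>)\<^sup>2 \<le> (k n * (V + W) + C) / (k n * \<delta>)\<^sup>2"
        by (rule divide_right_mono) simp
      then have "(k n * V + V' (n mod m) + (k n * W + W' (n mod m))) / (k n * \<delta>)\<^sup>2 \<le> \<epsilon>"
        using elim by linarith
      from stein_of_realizable[OF R _ this]
      have "ereal ((k n * \<nu> + 0 - (k n * \<mu> + \<mu>' (n mod m)) - 2 * (k n * \<delta>)) / real n) \<le> stein_fp n \<epsilon> \<Theta>1 \<Theta>2"
        using elim \<delta> by simp
      also have "k n * \<nu> + 0 - (k n * \<mu> + \<mu>' (n mod m)) - 2 * (k n * \<delta>)
        = real (n div m) * (\<nu> - \<mu> - 2 * \<delta>) + - \<mu>' (n mod m)"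
        by (simp add: k_def algebra_simps)
      finally show ?case .
    qed
  qed
  note le = this
  show "ereal ((\<nu> - \<mu>) / real m) \<le> liminf (\<lambda>n. stein_fp n \<epsilon> \<Theta>1 \<Theta>2)"
  proof (rule ereal_le_epsilon2)
    fix e :: real assume e: "0 < e"
    \<comment> \<open>With \<delta> = e * m / 2 the loss in the exponent is exactly e.\<close>
    have "ereal ((\<nu> - \<mu>) / real m) = ereal ((\<nu> - \<mu> - 2 * (e * real m / 2)) / real m) + ereal e"
      using m by (simp add: field_simps)
    also have "\<dots> \<le> liminf (\<lambda>n. stein_fp n \<epsilon> \<Theta>1 \<Theta>2) + ereal e"
      using e m by (intro add_right_mono le) simp
    finally show "ereal ((\<nu> - \<mu>) / real m) \<le> liminf (\<lambda>n. stein_fp n \<epsilon> \<Theta>1 \<Theta>2) + ereal e" .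
  qed
qed

text \<open>Every real number below the rate is exceeded by a realizable one; approaching from below
  covers an infinite rate as well.\<close>

lemma rates_le:
  assumes m: "0 < m" and L: "\<And>\<mu> V \<nu> W. realizable m \<mu> V \<nu> W \<Longrightarrow> ereal ((\<nu> - \<mu>) / real m) \<le> L"
  shows "rates m \<le> L"
proof (rule dense_le)
  fix z assume z: "z < rates m"
  show "z \<le> L"
  proof (cases z)
    case (real c)
    have "ereal (c * real m) < divs m"
      using z m unfolding real rates_def by (cases "divs m") (auto simp: field_simps)
    from realizable_of_divs[OF this] obtain \<mu> V \<nu> W where d: "realizable m \<mu> V \<nu> W" "c * real m < \<nu> - \<mu>" by blast
    have "z \<le> ereal ((\<nu> - \<mu>) / real m)" unfolding real using d(2) m by (simp add: field_simps)
    also have "\<dots> \<le> L" by (rule L[OF d(1)])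
    finally show ?thesis .
  qed (use z in auto)
qed

lemma superch_div_reg_le_liminf_stein:
  assumes \<epsilon>: "0 < \<epsilon>"
  shows "superch_div_reg \<Theta>1 \<Theta>2 \<le> liminf (\<lambda>n. stein_fp n \<epsilon> \<Theta>1 \<Theta>2)"
proof -
  \<comment> \<open>Any common upper bound of the realizable exponents per copy bounds all rates
    with positive index.\<close>
  have bound: "limsup rates \<le> L"
    if "\<And>m \<mu> V \<nu> W. 0 < m \<Longrightarrow> realizable m \<mu> V \<nu> W \<Longrightarrow> ereal ((\<nu> - \<mu>) / real m) \<le> L" for L
    by (rule Limsup_bounded, rule eventually_sequentiallyI[of 1], rule rates_le) (use that in auto)
  \<comment> \<open>Fekete's argument for superadditive sequences, in the extended reals. It proves
    convergence, so that \<open>lim\<close> is the actual limit.\<close>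
  have "limsup rates \<le> liminf rates" by (rule bound) (rule liminf_ge_realizable(1)[OF _ _ \<epsilon>])
  then have "liminf rates = limsup rates" by (intro antisym Liminf_le_Limsup) auto
  then have "rates \<longlonglongrightarrow> limsup rates" by (intro Liminf_eq_Limsup) auto
  then have "lim rates = limsup rates" by (rule limI)
  also have "\<dots> \<le> liminf (\<lambda>n. stein_fp n \<epsilon> \<Theta>1 \<Theta>2)"
    by (rule bound) (rule liminf_ge_realizable(2)[OF _ _ \<epsilon>])
  finally show ?thesis by (simp add: superch_div_reg_def rates_def[abs_def] divs_def)
qed

end

theorem lemma5p1:
  fixes \<Theta>\<^sub>1 :: "('a, 'b, 'c, 'd, 's) superch"
    and \<Theta>\<^sub>2 :: "('a, 'b, 'c, 'd, 't) superch"
    and \<epsilon> :: real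
  assumes "superchannel \<Theta>\<^sub>1" and "superchannel \<Theta>\<^sub>2"
    and "same_systems \<Theta>\<^sub>1 \<Theta>\<^sub>2"
    and "0 < \<epsilon>" and "\<epsilon> < 1"
  shows "liminf (\<lambda>n. stein_fp n \<epsilon> \<Theta>\<^sub>1 \<Theta>\<^sub>2) \<ge> superch_div_reg \<Theta>\<^sub>1 \<Theta>\<^sub>2"
proof -
  interpret superchannel_pair \<Theta>\<^sub>1 \<Theta>\<^sub>2 by unfold_locales (rule assms)+
  show ?thesis by (rule superch_div_reg_le_liminf_stein[OF assms(4)])
qed

end
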